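(* Let $Q=Q_1\times Q_2$ be a product of smooth manifolds, $\dim Q=n$, $\dim Q_1=r$, with local coordinates $(q^i)=(q^a,q^\alpha)$, $1\le a\le r$, $r+1\le\alpha\le n$. Let $L:TQ\to\mathbb{R}$ be a smooth Lagrangian such that the matrix $\left(\frac{\partial^2L}{\partial\dot q^\alpha\partial\dot q^\beta}\right)_{r+1\le\alpha,\beta\le n}$ is non-singular, and let $C(q^a,q^\alpha,\dot q^a,\dot q^\alpha,u^a)$ be a smooth cost function. Let $\mathcal{M}\subset T^{(2)}Q$, the functions $G^\alpha$, the function $\widetilde{L}_{\mathcal{M}}$, the manifold $W_0=T^*(TQ)\times_{TQ}\mathcal{M}$ with its 2-form $\Omega_{W_0}$ and Hamiltonian $H_{W_0}$, the submanifold $W_1\subset W_0$, and the 2-form $\Omega_{W_1}=i_{W_1}^*\Omega_{W_0}$ (with $i_{W_1}:W_1\hookrightarrow W_0$ the inclusion) be as defined in the context. Then $(W_1,\Omega_{W_1})$ is symplectic if and only if for any choice of local coordinates $(q^i,\dot q^i,\ddot q^a,p^0_i,p^1_i)$ on $W_0$, $$\det(\mathcal{R}_{ab})=\det\left(\frac{\partial^2\widetilde{L}_{\mathcal{M}}}{\partial\ddot q^a\partial\ddot q^b}-p^1_\alpha\frac{\partial^2G^\alpha}{\partial\ddot q^a\partial\ddot q^b}\right)_{1\le a,b\le r}\neq 0\quad\text{along } W_1 .$$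
   Context: Summation over repeated indices is used, with $1\le i\le n$, $1\le a,b\le r$, $r+1\le\alpha,\beta\le n$. $T^{(2)}Q$ is the second-order tangent bundle (2-jets at $0$ of curves in $Q$), with coordinates $(q^i,\dot q^i,\ddot q^i)$; it embeds in $T(TQ)$ by $(q,\dot q,\ddot q)\mapsto(q,\dot q;\dot q,\ddot q)$. The setting is an underactuated control system $\frac{d}{dt}\frac{\partial L}{\partial\dot q^a}-\frac{\partial L}{\partial q^a}=u^a$, $\frac{d}{dt}\frac{\partial L}{\partial\dot q^\alpha}-\frac{\partial L}{\partial q^\alpha}=0$, with controls $u^a$ and cost $\int C\,dt$. Define $\widetilde L:T^{(2)}Q\to\mathbb{R}$ by $$\widetilde L(q,\dot q,\ddot q)=C\left(q^a,q^\alpha,\dot q^a,\dot q^\alpha,\frac{d}{dt}\left(\frac{\partial L}{\partial\dot q^a}\right)-\frac{\partial L}{\partial q^a}\right),$$ and let $\mathcal{M}\subset T^{(2)}Q$ be the submanifold where $$\Phi^\alpha(q,\dot q,\ddot q)=\frac{d}{dt}\left(\frac{\partial L}{\partial\dot q^\alpha}\right)-\frac{\partial L}{\partial q^\alpha}=0,\qquad r+1\le\alpha\le n,$$ the total time derivatives being expanded as functions of $(q,\dot q,\ddot q)$. Since $\left(\frac{\partial^2L}{\partial\dot q^\alpha\partial\dot q^\beta}\right)$ is non-singular, these equations can be solved uniquely for $\ddot q^\alpha$, as $\ddot q^\alpha=G^\alpha(q^i,\dot q^i,\ddot q^a)$; so $(q^i,\dot q^i,\ddot q^a)$ are local coordinates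 on $\mathcal{M}$. Let $\widetilde L_{\mathcal{M}}=\widetilde L|_{\mathcal{M}}$, viewed as a function of $(q^i,\dot q^i,\ddot q^a)$. $W_0=T^*(TQ)\times_{TQ}\mathcal{M}$ has local coordinates $(q^i,\dot q^i,p^0_i,p^1_i,\ddot q^a)$, where $p^0_i,p^1_i$ are the momenta on $T^*(TQ)$ conjugate to $q^i,\dot q^i$. $\Omega_{W_0}$ is the pullback to $W_0$ of the canonical symplectic form of $T^*(TQ)$, and $H_{W_0}(\alpha_x,v_x)=\langle\alpha_x,v_x\rangle-\widetilde L_{\mathcal{M}}(v_x)$ for $x\in TQ$, $\alpha_x\in T_x^*TQ$, $v_x\in\mathcal{M}$ over $x$ (regarded as an element of $T_xTQ$ via the embedding above). Locally, $$\Omega_{W_0}=dq^i\wedge dp^0_i+d\dot q^i\wedge dp^1_i,\qquad H_{W_0}=p^0_i\dot q^i+p^1_a\ddot q^a+p^1_\alpha G^\alpha(q^i,\dot q^i,\ddot q^a)-\widetilde L_{\mathcal{M}}(q^i,\dot q^i,\ddot q^a).$$ $W_1=\{x\in W_0 : dH_{W_0}(x)(V)=0\ \ \forall\,V\in\ker\Omega_{W_0}(x)\}$; locally $W_1$ is given by $$\varphi^1_a=p^1_a+p^1_\alpha\frac{\partial G^\alpha}{\partial\ddot q^a}-\frac{\partial\widetilde L_{\mathcal{M}}}{\partial\ddot q^a}=0,\qquad 1\le a\le r,$$ with local coordinates $(q^i,\dot q^i,\ddot q^a,p^0_i,p^1_\alpha)$. *)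

theory Defs
  imports "HOL-Analysis.Analysis"
begin

section \<open>Smooth maps between open subsets of normed spaces\<close>

primrec Ck_on :: "nat \<Rightarrow> ('a::real_normed_vector \<Rightarrow> 'b::real_normed_vector) \<Rightarrow> 'a set \<Rightarrow> bool" where
  "Ck_on 0 f S \<longleftrightarrow> continuous_on S f"
| "Ck_on (Suc k) f S \<longleftrightarrow>
     (\<forall>x\<in>S. f differentiable (at x)) \<and> (\<forall>v. Ck_on k (\<lambda>x. frechet_derivative f (at x) v) S)"

text \<open>Only used for open \<open>S\<close>.\<close>

definition smooth_on :: "('a::real_normed_vector \<Rightarrow> 'b::real_normed_vector) \<Rightarrow> 'a set \<Rightarrow> bool" where
  "smooth_on f S \<longleftrightarrow> (\<forall>k. Ck_on k f S)"

definition second_partial :: "('a::real_normed_vector \<Rightarrow> 'b::real_normed_vector) \<Rightarrow> 'a \<Rightarrow> 'a \<Rightarrow> 'a \<Rightarrow> 'b" where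
  "second_partial f u v x = frechet_derivative (\<lambda>y. frechet_derivative f (at y) v) (at x) u"

definition curve_deriv :: "nat \<Rightarrow> (real \<Rightarrow> 'b::real_normed_vector) \<Rightarrow> 'b" where
  "curve_deriv k f = ((\<lambda>g t. vector_derivative g (at t)) ^^ k) f 0"


section \<open>Smooth manifolds\<close>

text \<open>
  A chart is a domain together with a coordinate map (whose values outside the domain are
  irrelevant).  A manifold is represented by an atlas, which determines the underlying set and
  the topology.
\<close>

type_synonym ('p, 'e) chart = "'p set \<times> ('p \<Rightarrow> 'e)"
type_synonym ('p, 'e) atlas = "('p, 'e) chart set"

definition chart_inv :: "('p, 'e) chart \<Rightarrow> 'e \<Rightarrow> 'p" where
  "chart_inv \<kappa> = inv_into (fst \<kappa>) (snd \<kappa>)"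

definition points :: "('p, 'e) atlas \<Rightarrow> 'p set" where
  "points A = (\<Union>\<kappa>\<in>A. fst \<kappa>)"

definition is_chart :: "('p, 'e::euclidean_space) chart \<Rightarrow> bool" where
  "is_chart \<kappa> \<longleftrightarrow> inj_on (snd \<kappa>) (fst \<kappa>) \<and> open (snd \<kappa> ` fst \<kappa>)"

definition smooth_transition ::
  "('p, 'e::euclidean_space) chart \<Rightarrow> ('p, 'e) chart \<Rightarrow> bool" where
  "smooth_transition \<kappa> \<kappa>' \<longleftrightarrow>
     open (snd \<kappa> ` (fst \<kappa> \<inter> fst \<kappa>')) \<and>
     smooth_on (snd \<kappa>' \<circ> chart_inv \<kappa>) (snd \<kappa> ` (fst \<kappa> \<inter> fst \<kappa>'))"

definition smooth_atlas :: "('p, 'e::euclidean_space) atlas \<Rightarrow> bool" where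
  "smooth_atlas A \<longleftrightarrow> (\<forall>\<kappa>\<in>A. is_chart \<kappa>) \<and> (\<forall>\<kappa>\<in>A. \<forall>\<kappa>'\<in>A. smooth_transition \<kappa> \<kappa>')"

definition maximal_atlas :: "('p, 'e::euclidean_space) atlas \<Rightarrow> bool" where
  "maximal_atlas A \<longleftrightarrow>
     (\<forall>\<kappa>. is_chart \<kappa> \<and> fst \<kappa> \<subseteq> points A \<and>
          (\<forall>\<kappa>'\<in>A. smooth_transition \<kappa> \<kappa>' \<and> smooth_transition \<kappa>' \<kappa>) \<longrightarrow> \<kappa> \<in> A)"

definition atlas_topology :: "('p, 'e::euclidean_space) atlas \<Rightarrow> 'p topology" where
  "atlas_topology A =
     topology (\<lambda>W. W \<subseteq> points A \<and> (\<forall>\<kappa>\<in>A. open (snd \<kappa> ` (W \<inter> fst \<kappa>))))"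

text \<open>
  By maximality, the charts in \<open>A\<close> are all local coordinate systems on the manifold.
\<close>

definition smooth_manifold :: "('p, 'e::euclidean_space) atlas \<Rightarrow> bool" where
  "smooth_manifold A \<longleftrightarrow>
     smooth_atlas A \<and> maximal_atlas A \<and>
     Hausdorff_space (atlas_topology A) \<and> second_countable (atlas_topology A)"

definition smooth_function ::
  "('p, 'e::euclidean_space) atlas \<Rightarrow> ('p \<Rightarrow> real) \<Rightarrow> bool" where
  "smooth_function A f \<longleftrightarrow> (\<forall>\<kappa>\<in>A. smooth_on (f \<circ> chart_inv \<kappa>) (snd \<kappa> ` fst \<kappa>))"

definition prod_chart :: "('x, 'e) chart \<Rightarrow> ('y, 'f) chart \<Rightarrow> ('x \<times> 'y, 'e \<times> 'f) chart" where
  "prod_chart \<kappa>1 \<kappa>2 = (fst \<kappa>1 \<times> fst \<kappa>2, map_prod (snd \<kappa>1) (snd \<kappa>2))"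

definition prod_atlas :: "('x, 'e) atlas \<Rightarrow> ('y, 'f) atlas \<Rightarrow> ('x \<times> 'y, 'e \<times> 'f) atlas" where
  "prod_atlas A1 A2 = (\<Union>\<kappa>1\<in>A1. \<Union>\<kappa>2\<in>A2. {prod_chart \<kappa>1 \<kappa>2})"


section \<open>Jets of curves, tangent and cotangent bundles\<close>

text \<open>A curve is only required to be defined and smooth near \<open>0\<close>.\<close>

definition smooth_curve :: "('p, 'e::euclidean_space) atlas \<Rightarrow> (real \<Rightarrow> 'p) \<Rightarrow> bool" where
  "smooth_curve A c \<longleftrightarrow>
     (\<exists>\<kappa>\<in>A. \<exists>\<epsilon>>0. c ` {-\<epsilon><..<\<epsilon>} \<subseteq> fst \<kappa> \<and> smooth_on (snd \<kappa> \<circ> c) {-\<epsilon><..<\<epsilon>})"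

type_synonym 'p jet = "(real \<Rightarrow> 'p) set"

definition jet :: "nat \<Rightarrow> ('p, 'e::euclidean_space) atlas \<Rightarrow> (real \<Rightarrow> 'p) \<Rightarrow> 'p jet" where
  "jet k A c =
     {c'. smooth_curve A c' \<and> c' 0 = c 0 \<and>
          (\<forall>\<kappa>\<in>A. c 0 \<in> fst \<kappa> \<longrightarrow>
             (\<forall>i\<le>k. curve_deriv i (snd \<kappa> \<circ> c') = curve_deriv i (snd \<kappa> \<circ> c)))}"

definition rep :: "'p jet \<Rightarrow> real \<Rightarrow> 'p" where
  "rep j = (SOME c. c \<in> j)"

definition jet_base :: "'p jet \<Rightarrow> 'p" where
  "jet_base j = rep j 0"

definition jets_over :: "nat \<Rightarrow> ('p, 'e::euclidean_space) atlas \<Rightarrow> 'p set \<Rightarrow> 'p jet set" where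
  "jets_over k A U = {jet k A c | c. smooth_curve A c \<and> c 0 \<in> U}"

definition tangent_chart ::
  "('p, 'e::euclidean_space) atlas \<Rightarrow> ('p, 'e) chart \<Rightarrow> ('p jet, 'e \<times> 'e) chart" where
  "tangent_chart A \<kappa> =
     (jets_over 1 A (fst \<kappa>),
      \<lambda>j. (curve_deriv 0 (snd \<kappa> \<circ> rep j), curve_deriv 1 (snd \<kappa> \<circ> rep j)))"

definition tangent_atlas :: "('p, 'e::euclidean_space) atlas \<Rightarrow> ('p jet, 'e \<times> 'e) atlas" where
  "tangent_atlas A = tangent_chart A ` A"

definition jet2_chart ::
  "('p, 'e::euclidean_space) atlas \<Rightarrow> ('p, 'e) chart \<Rightarrow> ('p jet, 'e \<times> 'e \<times> 'e) chart" where
  "jet2_chart A \<kappa> =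
     (jets_over 2 A (fst \<kappa>),
      \<lambda>j. (curve_deriv 0 (snd \<kappa> \<circ> rep j), curve_deriv 1 (snd \<kappa> \<circ> rep j),
           curve_deriv 2 (snd \<kappa> \<circ> rep j)))"

definition jet2_atlas :: "('p, 'e::euclidean_space) atlas \<Rightarrow> ('p jet, 'e \<times> 'e \<times> 'e) atlas" where
  "jet2_atlas A = jet2_chart A ` A"

text \<open>The projection of the second-order tangent bundle to the tangent bundle, and its embedding
  \<open>(q, v, a) \<mapsto> (q, v; v, a)\<close> into the tangent bundle of the tangent bundle.\<close>

definition jet21 :: "('p, 'e::euclidean_space) atlas \<Rightarrow> 'p jet \<Rightarrow> 'p jet" where
  "jet21 A j = jet 1 A (rep j)"

definition jet2_embed :: "('p, 'e::euclidean_space) atlas \<Rightarrow> 'p jet \<Rightarrow> 'p jet jet" where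
  "jet2_embed A j = jet 1 (tangent_atlas A) (\<lambda>t. jet 1 A (\<lambda>s. rep j (t + s)))"

definition tangent_space :: "('p, 'e::euclidean_space) atlas \<Rightarrow> 'p \<Rightarrow> 'p jet set" where
  "tangent_space A x = jets_over 1 A {x}"

definition zero_vector :: "('p, 'e::euclidean_space) atlas \<Rightarrow> 'p \<Rightarrow> 'p jet" where
  "zero_vector A x = jet 1 A (\<lambda>_. x)"

text \<open>The tangent vector at \<open>x\<close> whose components in the chart \<open>\<kappa>\<close> are \<open>v\<close>.\<close>

definition coord_vector ::
  "('p, 'e::euclidean_space) atlas \<Rightarrow> ('p, 'e) chart \<Rightarrow> 'e \<Rightarrow> 'p \<Rightarrow> 'p jet" where
  "coord_vector A \<kappa> v x = jet 1 A (\<lambda>t. chart_inv \<kappa> (snd \<kappa> x + t *\<^sub>R v))"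

definition components :: "('p, 'e::euclidean_space) chart \<Rightarrow> 'p jet \<Rightarrow> 'e" where
  "components \<kappa> V = curve_deriv 1 (snd \<kappa> \<circ> rep V)"

text \<open>The tangent map of \<open>f\<close>, where \<open>B\<close> is the atlas of the target.\<close>

definition tangent_map ::
  "('q, 'f::euclidean_space) atlas \<Rightarrow> ('p \<Rightarrow> 'q) \<Rightarrow> 'p jet \<Rightarrow> 'q jet" where
  "tangent_map B f V = jet 1 B (f \<circ> rep V)"

definition differential :: "('p \<Rightarrow> real) \<Rightarrow> 'p jet \<Rightarrow> real" where
  "differential f V = curve_deriv 1 (f \<circ> rep V)"

definition cotangent_space ::
  "('p, 'e::euclidean_space) atlas \<Rightarrow> 'p \<Rightarrow> ('p jet \<Rightarrow> real) set" where
  "cotangent_space A x =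
     {\<alpha>. \<alpha> \<in> extensional (tangent_space A x) \<and>
         (\<forall>\<kappa>\<in>A. x \<in> fst \<kappa> \<longrightarrow> linear (\<lambda>v. \<alpha> (coord_vector A \<kappa> v x)))}"

definition cotangent_chart ::
  "('p, 'e::euclidean_space) atlas \<Rightarrow> ('p, 'e) chart \<Rightarrow> ('p \<times> ('p jet \<Rightarrow> real), 'e \<times> 'e) chart" where
  "cotangent_chart A \<kappa> =
     ({(x, \<alpha>). x \<in> fst \<kappa> \<and> \<alpha> \<in> cotangent_space A x},
      \<lambda>(x, \<alpha>). (snd \<kappa> x, \<Sum>b\<in>Basis. \<alpha> (coord_vector A \<kappa> b x) *\<^sub>R b))"

definition cotangent_atlas ::
  "('p, 'e::euclidean_space) atlas \<Rightarrow> ('p \<times> ('p jet \<Rightarrow> real), 'e \<times> 'e) atlas" where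
  "cotangent_atlas A = cotangent_chart A ` A"


section \<open>Differential forms\<close>

text \<open>
  Forms are functions of tangent vectors, which determine their base point.
\<close>

type_synonym 'p form1 = "'p jet \<Rightarrow> real"
type_synonym 'p form2 = "'p jet \<Rightarrow> 'p jet \<Rightarrow> real"

definition pullback2 ::
  "('q, 'f::euclidean_space) atlas \<Rightarrow> ('p \<Rightarrow> 'q) \<Rightarrow> 'q form2 \<Rightarrow> 'p form2" where
  "pullback2 B f \<omega> V W = \<omega> (tangent_map B f V) (tangent_map B f W)"

definition form1_in_chart ::
  "('p, 'e::euclidean_space) atlas \<Rightarrow> ('p, 'e) chart \<Rightarrow> 'p form1 \<Rightarrow> 'e \<Rightarrow> 'e \<Rightarrow> real" where
  "form1_in_chart A \<kappa> \<theta> y u = \<theta> (coord_vector A \<kappa> u (chart_inv \<kappa> y))"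

definition form2_in_chart ::
  "('p, 'e::euclidean_space) atlas \<Rightarrow> ('p, 'e) chart \<Rightarrow> 'p form2 \<Rightarrow> 'e \<Rightarrow> 'e \<Rightarrow> 'e \<Rightarrow> real" where
  "form2_in_chart A \<kappa> \<omega> y u v =
     \<omega> (coord_vector A \<kappa> u (chart_inv \<kappa> y)) (coord_vector A \<kappa> v (chart_inv \<kappa> y))"

text \<open>
  The exterior derivative of a smooth 1-form, which does not depend on the chart chosen at the
  base point.
\<close>

definition exterior_derivative1 ::
  "('p, 'e::euclidean_space) atlas \<Rightarrow> 'p form1 \<Rightarrow> 'p form2" where
  "exterior_derivative1 A \<theta> V W =
     (let \<kappa> = (SOME \<kappa>. \<kappa> \<in> A \<and> jet_base V \<in> fst \<kappa>);
          y = snd \<kappa> (jet_base V); v = components \<kappa> V; w = components \<kappa> W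
      in frechet_derivative (\<lambda>y. form1_in_chart A \<kappa> \<theta> y w) (at y) v
       - frechet_derivative (\<lambda>y. form1_in_chart A \<kappa> \<theta> y v) (at y) w)"

definition is_form2 :: "('p, 'e::euclidean_space) atlas \<Rightarrow> 'p form2 \<Rightarrow> bool" where
  "is_form2 A \<omega> \<longleftrightarrow>
     (\<forall>\<kappa>\<in>A.
        (\<forall>y\<in>snd \<kappa> ` fst \<kappa>.
           bilinear (form2_in_chart A \<kappa> \<omega> y) \<and> (\<forall>u. form2_in_chart A \<kappa> \<omega> y u u = 0)) \<and>
        (\<forall>u v. smooth_on (\<lambda>y. form2_in_chart A \<kappa> \<omega> y u v) (snd \<kappa> ` fst \<kappa>)))"

definition closed_form2 :: "('p, 'e::euclidean_space) atlas \<Rightarrow> 'p form2 \<Rightarrow> bool" where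
  "closed_form2 A \<omega> \<longleftrightarrow>
     (\<forall>\<kappa>\<in>A. \<forall>y\<in>snd \<kappa> ` fst \<kappa>. \<forall>u v w.
        frechet_derivative (\<lambda>y. form2_in_chart A \<kappa> \<omega> y v w) (at y) u
      + frechet_derivative (\<lambda>y. form2_in_chart A \<kappa> \<omega> y w u) (at y) v
      + frechet_derivative (\<lambda>y. form2_in_chart A \<kappa> \<omega> y u v) (at y) w = 0)"

definition form2_kernel :: "('p, 'e::euclidean_space) atlas \<Rightarrow> 'p form2 \<Rightarrow> 'p \<Rightarrow> 'p jet set" where
  "form2_kernel A \<omega> x = {V \<in> tangent_space A x. \<forall>W\<in>tangent_space A x. \<omega> V W = 0}"

definition symplectic :: "('p, 'e::euclidean_space) atlas \<Rightarrow> 'p form2 \<Rightarrow> bool" where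
  "symplectic A \<omega> \<longleftrightarrow>
     is_form2 A \<omega> \<and> closed_form2 A \<omega> \<and>
     (\<forall>x\<in>points A. form2_kernel A \<omega> x = {zero_vector A x})"

definition tautological_form ::
  "('p, 'e::euclidean_space) atlas \<Rightarrow> ('p \<times> ('p jet \<Rightarrow> real)) form1" where
  "tautological_form A V = snd (jet_base V) (tangent_map A fst V)"

text \<open>The sign is such that the form is \<open>dx\<^sup>i \<and> dp\<^sub>i\<close> in canonical coordinates.\<close>

definition canonical_form ::
  "('p, 'e::euclidean_space) atlas \<Rightarrow> ('p \<times> ('p jet \<Rightarrow> real)) form2" where
  "canonical_form A V W = - exterior_derivative1 (cotangent_atlas A) (tautological_form A) V W"


section \<open>The control system\<close>

text \<open>
  Points of \<open>Q = Q\<^sub>1 \<times> Q\<^sub>2\<close> have coordinates in \<open>real^'r \<times> real^'s\<close>, so that \<open>r = CARD('r)\<close> and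
  \<open>n = CARD('r) + CARD('s)\<close>; the first factor carries the indices \<open>a\<close>, the second the indices \<open>\<alpha>\<close>.
  Local coordinates on \<open>Q\<close> are products of local coordinates on \<open>Q\<^sub>1\<close> and \<open>Q\<^sub>2\<close>.
\<close>

type_synonym ('r, 's) coords = "(real^'r) \<times> (real^'s)"

definition local_function :: "('p, 'e) chart \<Rightarrow> ('p \<Rightarrow> 'b) \<Rightarrow> 'e \<Rightarrow> 'b" where
  "local_function \<kappa> f = f \<circ> chart_inv \<kappa>"

text \<open>The total time derivative of \<open>f(q, v)\<close> as a function of \<open>(q, v, a)\<close>.\<close>

definition total_derivative ::
  "('e::euclidean_space \<times> 'e \<Rightarrow> real) \<Rightarrow> 'e \<times> 'e \<times> 'e \<Rightarrow> real" where
  "total_derivative f = (\<lambda>(q, v, a). frechet_derivative f (at (q, v)) (v, a))"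

text \<open>The vector of all Euler-Lagrange expressions \<open>d/dt (\<partial>l/\<partial>v\<^sup>i) - \<partial>l/\<partial>q\<^sup>i\<close>.\<close>

definition euler_lagrange ::
  "('e::euclidean_space \<times> 'e \<Rightarrow> real) \<Rightarrow> 'e \<times> 'e \<times> 'e \<Rightarrow> 'e" where
  "euler_lagrange l = (\<lambda>(q, v, a). \<Sum>b\<in>Basis.
     (total_derivative (\<lambda>y. frechet_derivative l (at y) (0, b)) (q, v, a)
      - frechet_derivative l (at (q, v)) (b, 0)) *\<^sub>R b)"

definition local_lagrangian ::
  "('x, real^'r) atlas \<Rightarrow> ('y, real^'s) atlas \<Rightarrow> (('x \<times> 'y) jet \<Rightarrow> real) \<Rightarrow>
   ('x \<times> 'y, ('r::finite, 's::finite) coords) chart \<Rightarrow>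
   ('r, 's) coords \<times> ('r, 's) coords \<Rightarrow> real" where
  "local_lagrangian A1 A2 L \<kappa> = local_function (tangent_chart (prod_atlas A1 A2) \<kappa>) L"

definition local_euler_lagrange ::
  "('x, real^'r) atlas \<Rightarrow> ('y, real^'s) atlas \<Rightarrow> (('x \<times> 'y) jet \<Rightarrow> real) \<Rightarrow>
   ('x \<times> 'y, ('r::finite, 's::finite) coords) chart \<Rightarrow>
   ('r, 's) coords \<times> ('r, 's) coords \<times> ('r, 's) coords \<Rightarrow> ('r, 's) coords" where
  "local_euler_lagrange A1 A2 L \<kappa> = euler_lagrange (local_lagrangian A1 A2 L \<kappa>)"

definition vertical_hessian ::
  "('x, real^'r) atlas \<Rightarrow> ('y, real^'s) atlas \<Rightarrow> (('x \<times> 'y) jet \<Rightarrow> real) \<Rightarrow>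
   ('x \<times> 'y, ('r::finite, 's::finite) coords) chart \<Rightarrow>
   ('r, 's) coords \<times> ('r, 's) coords \<Rightarrow> real^'s^'s" where
  "vertical_hessian A1 A2 L \<kappa> z =
     (\<chi> \<alpha> \<beta>. second_partial (local_lagrangian A1 A2 L \<kappa>)
                (0, 0, axis \<alpha> 1) (0, 0, axis \<beta> 1) z)"

definition regular_lagrangian ::
  "('x, real^'r) atlas \<Rightarrow> ('y, real^'s) atlas \<Rightarrow> (('x \<times> 'y) jet \<Rightarrow> real) \<Rightarrow> bool" where
  "regular_lagrangian A1 A2 L \<longleftrightarrow>
     (\<forall>\<kappa>\<in>prod_atlas A1 A2. \<forall>j\<in>fst (tangent_chart (prod_atlas A1 A2) \<kappa>).
        invertible (vertical_hessian A1 A2 L \<kappa> (snd (tangent_chart (prod_atlas A1 A2) \<kappa>) j)))"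

text \<open>
  The Euler-Lagrange expressions with index \<open>a\<close> transform as the components of a covector on
  \<open>Q\<^sub>1\<close>.  The cost is therefore a function on the fibre product of \<open>TQ\<close> and \<open>T\<^sup>*Q\<^sub>1\<close> over \<open>Q\<^sub>1\<close>,
  with coordinates \<open>(q\<^sup>a, q\<^sup>\<alpha>, v\<^sup>a, v\<^sup>\<alpha>, u\<^sup>a)\<close>.
\<close>

type_synonym ('x, 'y) control_point = "('x \<times> 'y) jet \<times> ('x \<times> ('x jet \<Rightarrow> real))"

definition control_chart ::
  "('x, real^'r) atlas \<Rightarrow> ('y, real^'s) atlas \<Rightarrow> ('x, real^'r) chart \<Rightarrow> ('y, real^'s) chart \<Rightarrow>
   (('x, 'y) control_point,
    ('r::finite, 's::finite) coords \<times> ('r, 's) coords \<times> (real^'r)) chart" where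
  "control_chart A1 A2 \<kappa>1 \<kappa>2 =
     ({(x, \<mu>). x \<in> fst (tangent_chart (prod_atlas A1 A2) (prod_chart \<kappa>1 \<kappa>2)) \<and>
              \<mu> \<in> fst (cotangent_chart A1 \<kappa>1) \<and> fst \<mu> = fst (jet_base x)},
      \<lambda>(x, \<mu>). (let (q, v) = snd (tangent_chart (prod_atlas A1 A2) (prod_chart \<kappa>1 \<kappa>2)) x
               in (q, v, snd (snd (cotangent_chart A1 \<kappa>1) \<mu>))))"

definition control_atlas ::
  "('x, real^'r) atlas \<Rightarrow> ('y, real^'s) atlas \<Rightarrow>
   (('x, 'y) control_point,
    ('r::finite, 's::finite) coords \<times> ('r, 's) coords \<times> (real^'r)) atlas" where
  "control_atlas A1 A2 = (\<Union>\<kappa>1\<in>A1. \<Union>\<kappa>2\<in>A2. {control_chart A1 A2 \<kappa>1 \<kappa>2})"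

text \<open>The covector on \<open>Q\<^sub>1\<close> at the base point of \<open>j\<close> whose components in every chart are
  \<open>d/dt (\<partial>L/\<partial>v\<^sup>a) - \<partial>L/\<partial>q\<^sup>a\<close>.\<close>

definition control_force ::
  "('x, real^'r) atlas \<Rightarrow> ('y, real^'s) atlas \<Rightarrow> (('x \<times> 'y) jet \<Rightarrow> real) \<Rightarrow>
   ('x \<times> 'y) jet \<Rightarrow> 'x \<times> ('x jet \<Rightarrow> real)" where
  "control_force A1 A2 L j =
     (THE \<mu>. \<mu> \<in> points (cotangent_atlas A1) \<and> fst \<mu> = fst (jet_base j) \<and>
        (\<forall>\<kappa>1\<in>A1. \<forall>\<kappa>2\<in>A2. jet_base j \<in> fst (prod_chart \<kappa>1 \<kappa>2) \<longrightarrow>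
           snd (snd (cotangent_chart A1 \<kappa>1) \<mu>) =
           fst (local_euler_lagrange A1 A2 L (prod_chart \<kappa>1 \<kappa>2)
                  (snd (jet2_chart (prod_atlas A1 A2) (prod_chart \<kappa>1 \<kappa>2)) j))))"

definition cost_lagrangian ::
  "('x, real^'r::finite) atlas \<Rightarrow> ('y, real^'s::finite) atlas \<Rightarrow> (('x \<times> 'y) jet \<Rightarrow> real) \<Rightarrow>
   (('x, 'y) control_point \<Rightarrow> real) \<Rightarrow> ('x \<times> 'y) jet \<Rightarrow> real" where
  "cost_lagrangian A1 A2 L C j = C (jet21 (prod_atlas A1 A2) j, control_force A1 A2 L j)"

definition constraint_submanifold ::
  "('x, real^'r::finite) atlas \<Rightarrow> ('y, real^'s::finite) atlas \<Rightarrow> (('x \<times> 'y) jet \<Rightarrow> real) \<Rightarrow>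
   ('x \<times> 'y) jet set" where
  "constraint_submanifold A1 A2 L =
     {j \<in> points (jet2_atlas (prod_atlas A1 A2)).
        \<forall>\<kappa>\<in>prod_atlas A1 A2. jet_base j \<in> fst \<kappa> \<longrightarrow>
          snd (local_euler_lagrange A1 A2 L \<kappa> (snd (jet2_chart (prod_atlas A1 A2) \<kappa>) j)) = 0}"

text \<open>The coordinates \<open>(q\<^sup>i, v\<^sup>i, a\<^sup>a)\<close> on the constraint submanifold.\<close>

definition constraint_chart ::
  "('x, real^'r) atlas \<Rightarrow> ('y, real^'s) atlas \<Rightarrow> (('x \<times> 'y) jet \<Rightarrow> real) \<Rightarrow>
   ('x \<times> 'y, ('r::finite, 's::finite) coords) chart \<Rightarrow>
   (('x \<times> 'y) jet, ('r, 's) coords \<times> ('r, 's) coords \<times> (real^'r)) chart" where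
  "constraint_chart A1 A2 L \<kappa> =
     (constraint_submanifold A1 A2 L \<inter> fst (jet2_chart (prod_atlas A1 A2) \<kappa>),
      \<lambda>j. let (q, v, a) = snd (jet2_chart (prod_atlas A1 A2) \<kappa>) j in (q, v, fst a))"

definition local_constraint_lagrangian ::
  "('x, real^'r) atlas \<Rightarrow> ('y, real^'s) atlas \<Rightarrow> (('x \<times> 'y) jet \<Rightarrow> real) \<Rightarrow>
   (('x, 'y) control_point \<Rightarrow> real) \<Rightarrow>
   ('x \<times> 'y, ('r::finite, 's::finite) coords) chart \<Rightarrow>
   ('r, 's) coords \<times> ('r, 's) coords \<times> (real^'r) \<Rightarrow> real" where
  "local_constraint_lagrangian A1 A2 L C \<kappa> =
     local_function (constraint_chart A1 A2 L \<kappa>) (cost_lagrangian A1 A2 L C)"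

definition constraint_solution ::
  "('x, real^'r) atlas \<Rightarrow> ('y, real^'s) atlas \<Rightarrow> (('x \<times> 'y) jet \<Rightarrow> real) \<Rightarrow>
   ('x \<times> 'y, ('r::finite, 's::finite) coords) chart \<Rightarrow>
   ('r, 's) coords \<times> ('r, 's) coords \<times> (real^'r) \<Rightarrow> real^'s" where
  "constraint_solution A1 A2 L \<kappa> =
     (\<lambda>(q, v, a). THE g. snd (local_euler_lagrange A1 A2 L \<kappa> (q, v, (a, g))) = 0)"


section \<open>The presymplectic system on \<open>W\<^sub>0\<close> and the submanifold \<open>W\<^sub>1\<close>\<close>

type_synonym ('x, 'y) w_point =
  "(('x \<times> 'y) jet \<times> (('x \<times> 'y) jet jet \<Rightarrow> real)) \<times> ('x \<times> 'y) jet"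

definition TQ :: "('x, real^'r) atlas \<Rightarrow> ('y, real^'s) atlas \<Rightarrow>
   (('x \<times> 'y) jet, ('r::finite, 's::finite) coords \<times> ('r, 's) coords) atlas" where
  "TQ A1 A2 = tangent_atlas (prod_atlas A1 A2)"

definition W0_chart ::
  "('x, real^'r) atlas \<Rightarrow> ('y, real^'s) atlas \<Rightarrow> (('x \<times> 'y) jet \<Rightarrow> real) \<Rightarrow>
   ('x \<times> 'y, ('r::finite, 's::finite) coords) chart \<Rightarrow>
   (('x, 'y) w_point,
    ('r, 's) coords \<times> ('r, 's) coords \<times> ('r, 's) coords \<times> ('r, 's) coords \<times> (real^'r)) chart" where
  "W0_chart A1 A2 L \<kappa> =
     ({(\<mu>, j). \<mu> \<in> fst (cotangent_chart (TQ A1 A2) (tangent_chart (prod_atlas A1 A2) \<kappa>)) \<and>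
              j \<in> constraint_submanifold A1 A2 L \<and> fst \<mu> = jet21 (prod_atlas A1 A2) j},
      \<lambda>(\<mu>, j).
        (let ((q, v), (p0, p1)) =
               snd (cotangent_chart (TQ A1 A2) (tangent_chart (prod_atlas A1 A2) \<kappa>)) \<mu>;
             (_, _, a) = snd (constraint_chart A1 A2 L \<kappa>) j
         in (q, v, p0, p1, a)))"

definition W0 ::
  "('x, real^'r) atlas \<Rightarrow> ('y, real^'s) atlas \<Rightarrow> (('x \<times> 'y) jet \<Rightarrow> real) \<Rightarrow>
   (('x, 'y) w_point,
    ('r::finite, 's::finite) coords \<times> ('r, 's) coords \<times> ('r, 's) coords \<times> ('r, 's) coords \<times> (real^'r))
   atlas" where
  "W0 A1 A2 L = W0_chart A1 A2 L ` prod_atlas A1 A2"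

definition Omega_W0 ::
  "('x, real^'r::finite) atlas \<Rightarrow> ('y, real^'s::finite) atlas \<Rightarrow> ('x, 'y) w_point form2" where
  "Omega_W0 A1 A2 = pullback2 (cotangent_atlas (TQ A1 A2)) fst (canonical_form (TQ A1 A2))"

definition H_W0 ::
  "('x, real^'r::finite) atlas \<Rightarrow> ('y, real^'s::finite) atlas \<Rightarrow> (('x \<times> 'y) jet \<Rightarrow> real) \<Rightarrow>
   (('x, 'y) control_point \<Rightarrow> real) \<Rightarrow> ('x, 'y) w_point \<Rightarrow> real" where
  "H_W0 A1 A2 L C =
     (\<lambda>((x, \<alpha>), j). \<alpha> (jet2_embed (prod_atlas A1 A2) j) - cost_lagrangian A1 A2 L C j)"

definition W1_points ::
  "('x, real^'r::finite) atlas \<Rightarrow> ('y, real^'s::finite) atlas \<Rightarrow> (('x \<times> 'y) jet \<Rightarrow> real) \<Rightarrow>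
   (('x, 'y) control_point \<Rightarrow> real) \<Rightarrow> ('x, 'y) w_point set" where
  "W1_points A1 A2 L C =
     {w \<in> points (W0 A1 A2 L).
        \<forall>V\<in>form2_kernel (W0 A1 A2 L) (Omega_W0 A1 A2) w. differential (H_W0 A1 A2 L C) V = 0}"

text \<open>The manifold structure of \<open>W\<^sub>1\<close> is given by the coordinates
  \<open>(q\<^sup>i, v\<^sup>i, a\<^sup>a, p\<^sup>0\<^sub>i, p\<^sup>1\<^sub>\<alpha>)\<close>.\<close>

definition W1_chart ::
  "('x, real^'r) atlas \<Rightarrow> ('y, real^'s) atlas \<Rightarrow> (('x \<times> 'y) jet \<Rightarrow> real) \<Rightarrow>
   (('x, 'y) control_point \<Rightarrow> real) \<Rightarrow>
   ('x \<times> 'y, ('r::finite, 's::finite) coords) chart \<Rightarrow>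
   (('x, 'y) w_point,
    ('r, 's) coords \<times> ('r, 's) coords \<times> (real^'r) \<times> ('r, 's) coords \<times> (real^'s)) chart" where
  "W1_chart A1 A2 L C \<kappa> =
     (W1_points A1 A2 L C \<inter> fst (W0_chart A1 A2 L \<kappa>),
      \<lambda>w. let (q, v, p0, p1, a) = snd (W0_chart A1 A2 L \<kappa>) w in (q, v, a, p0, snd p1))"

definition W1 ::
  "('x, real^'r) atlas \<Rightarrow> ('y, real^'s) atlas \<Rightarrow> (('x \<times> 'y) jet \<Rightarrow> real) \<Rightarrow>
   (('x, 'y) control_point \<Rightarrow> real) \<Rightarrow>
   (('x, 'y) w_point,
    ('r::finite, 's::finite) coords \<times> ('r, 's) coords \<times> (real^'r) \<times> ('r, 's) coords \<times> (real^'s))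
   atlas" where
  "W1 A1 A2 L C = W1_chart A1 A2 L C ` prod_atlas A1 A2"

definition Omega_W1 ::
  "('x, real^'r::finite) atlas \<Rightarrow> ('y, real^'s::finite) atlas \<Rightarrow> (('x \<times> 'y) jet \<Rightarrow> real) \<Rightarrow>
   ('x, 'y) w_point form2" where
  "Omega_W1 A1 A2 L = pullback2 (W0 A1 A2 L) (\<lambda>w. w) (Omega_W0 A1 A2)"

definition R_matrix ::
  "('x, real^'r) atlas \<Rightarrow> ('y, real^'s) atlas \<Rightarrow> (('x \<times> 'y) jet \<Rightarrow> real) \<Rightarrow>
   (('x, 'y) control_point \<Rightarrow> real) \<Rightarrow>
   ('x \<times> 'y, ('r::finite, 's::finite) coords) chart \<Rightarrow>
   ('r, 's) coords \<times> ('r, 's) coords \<times> ('r, 's) coords \<times> ('r, 's) coords \<times> (real^'r) \<Rightarrow>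
   real^'r^'r" where
  "R_matrix A1 A2 L C \<kappa> = (\<lambda>(q, v, p0, p1, a). \<chi> i j.
     second_partial (local_constraint_lagrangian A1 A2 L C \<kappa>)
       (0, 0, axis i 1) (0, 0, axis j 1) (q, v, a)
     - (\<Sum>\<alpha>\<in>UNIV. snd p1 $ \<alpha> *
          second_partial (\<lambda>z. constraint_solution A1 A2 L \<kappa> z $ \<alpha>)
            (0, 0, axis i 1) (0, 0, axis j 1) (q, v, a)))"

end

theory Submission
  imports Defs
begin

text \<open>
  On \<open>T\<^sup>*(TQ)\<close> the tautological form is \<open>p\<^sub>i dx\<^sup>i\<close> in every chart, so \<open>\<Omega>\<close> on \<open>W\<^sub>0\<close> is
  \<open>dq \<and> dp\<^sup>0 + dv \<and> dp\<^sup>1\<close> in all natural coordinates; its kernel consists of the directions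
  \<open>\<partial>/\<partial>a\<^sup>a\<close>.  Hence \<open>W\<^sub>1\<close> is the graph of a function
  \<open>p\<^sup>1\<^sub>a = \<partial>L\<^sub>M/\<partial>a\<^sup>a - p\<^sup>1\<^sub>\<alpha> \<partial>G\<^sup>\<alpha>/\<partial>a\<^sup>a\<close>, whose partial derivatives in the directions \<open>a\<^sup>b\<close> are the
  entries of \<open>R\<close>.  The pullback of \<open>\<Omega>\<close> to this graph is automatically closed, and solving
  \<open>\<Omega>(u, \<cdot>) = 0\<close> componentwise shows that the kernel is trivial iff \<open>R\<close> is invertible: a vector \<open>h\<close> with
  \<open>h R = 0\<close> gives the kernel vector \<open>h \<partial>/\<partial>a\<close>.

  That the constraints and the control force do not depend on the chart rests on the covariance of the
  Euler--Lagrange expressions under product charts; \<open>G\<close> is smooth by Cramer's rule.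
\<close>

section \<open>Calculus of smooth maps\<close>

text \<open>Jets are sets of curves and \<open>rep\<close> picks an unspecified member, so nothing
  can be computed from a tangent vector directly. Every vector is therefore written as a
  \<open>coord_vector\<close>, and maps and forms are evaluated through their local expressions.
  Since \<open>frechet_derivative\<close> is a total function that says nothing where a map fails to
  be differentiable, each such evaluation presupposes smoothness of the local expression on an open
  coordinate domain; hence smoothness of \<open>G\<close>, of the restricted cost and of all
  transition maps is settled before the form on \<open>W1\<close> is touched. Second derivatives of
  transition maps enter in the canonical form, in the Euler-Lagrange expressions and in the change
  of acceleration coordinates; in the first two they cancel by symmetry. Admitting only product
  charts on \<open>Q\<close> makes every Jacobian block diagonal, so that the a-components and the
  \<alpha>-components of a covector can be separated.\<close>

abbreviation fderiv :: "('a::real_normed_vector \<Rightarrow> 'b::real_normed_vector) \<Rightarrow> 'a \<Rightarrow> 'a \<Rightarrow> 'b" where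
  "fderiv f x \<equiv> frechet_derivative f (at x)"

lemma fderiv_eqI: "(f has_derivative f') (at x) \<Longrightarrow> fderiv f x = f'"
  by (metis frechet_derivative_at)

section \<open>Closure properties of the classes of finite differentiability\<close>

lemma Ck_on_SucD: "Ck_on (Suc k) f S \<Longrightarrow> Ck_on k f S"
proof (induction k arbitrary: f)
  case 0
  then show ?case
    by (auto intro!: continuous_at_imp_continuous_on differentiable_imp_continuous_within)
next
  case (Suc k)
  then show ?case by (metis Ck_on.simps(2))
qed

text \<open>On an open set a derivative depends only on nearby values, so equality on
  \<open>S\<close> alone propagates through all orders.\<close>

lemma Ck_on_cong_imp:
  assumes "open S" "\<And>x. x \<in> S \<Longrightarrow> f x = g x" "Ck_on k f S"
  shows "Ck_on k g S"
  using assms(2,3)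
proof (induction k arbitrary: f g)
  case 0
  then show ?case by (simp cong: continuous_on_cong)
next
  case (Suc k)
  have d: "f differentiable (at x)" if "x \<in> S" for x using Suc.prems that by simp
  have hd: "(g has_derivative fderiv f x) (at x)" if "x \<in> S" for x
    using d[OF that] assms(1) that Suc.prems(1)
    by (metis frechet_derivative_works has_derivative_transform_within_open)
  have "Ck_on k (\<lambda>x. fderiv g x v) S" for v
    by (rule Suc.IH[where f="\<lambda>x. fderiv f x v"]) (use Suc.prems in \<open>simp_all add: fderiv_eqI[OF hd]\<close>)
  then show ?case using hd by (auto simp: differentiable_def)
qed

text \<open>Lets an explicit derivative formula stand in for \<open>frechet_derivative\<close>; the
  inductive closure proofs below apply it to the matching differentiation rule.\<close>

lemma Ck_on_SucI:
  assumes "open S" "\<And>x. x \<in> S \<Longrightarrow> (f has_derivative f' x) (at x)" "\<And>v. Ck_on k (\<lambda>x. f' x v) S"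
  shows "Ck_on (Suc k) f S"
proof -
  have "Ck_on k (\<lambda>x. fderiv f x v) S" for v
    by (rule Ck_on_cong_imp[OF assms(1) _ assms(3)[of v]]) (simp add: fderiv_eqI[OF assms(2)])
  then show ?thesis using assms(2) by (auto simp: differentiable_def)
qed

lemma Ck_on_has_derivative: "Ck_on (Suc k) f S \<Longrightarrow> x \<in> S \<Longrightarrow> (f has_derivative fderiv f x) (at x)"
  using frechet_derivative_works by fastforce

lemma Ck_on_subset: "Ck_on k f S \<Longrightarrow> T \<subseteq> S \<Longrightarrow> Ck_on k f T"
  by (induction k arbitrary: f) (auto intro: continuous_on_subset)

lemma Ck_on_const: "Ck_on k (\<lambda>x. c) S"
  by (induction k arbitrary: c) auto

lemma Ck_on_bounded_linear:
  assumes "open S" "bounded_linear l" "Ck_on k g S"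
  shows "Ck_on k (\<lambda>x. l (g x)) S"
  using assms(3)
proof (induction k arbitrary: g)
  case 0
  then show ?case
    using assms(2) by (auto intro: linear_continuous_on_compose bounded_linear.continuous_on)
next
  case (Suc k)
  show ?case
  proof (rule Ck_on_SucI[OF assms(1)])
    show "((\<lambda>x. l (g x)) has_derivative (\<lambda>v. l (fderiv g x v))) (at x)" if "x \<in> S" for x
      using bounded_linear.has_derivative[OF assms(2) Ck_on_has_derivative[OF Suc.prems that]] .
    show "Ck_on k (\<lambda>x. l (fderiv g x v)) S" for v
      using Suc by auto
  qed
qed

lemma Ck_on_add:
  assumes "open S" "Ck_on k f S" "Ck_on k g S"
  shows "Ck_on k (\<lambda>x. f x + g x) S"
  using assms(2,3)
proof (induction k arbitrary: f g)
  case 0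
  then show ?case by (auto intro: continuous_intros)
next
  case (Suc k)
  show ?case
    using Suc.prems
    by (intro Ck_on_SucI[OF assms(1) has_derivative_add[OF Ck_on_has_derivative Ck_on_has_derivative]])
      (auto intro!: Suc.IH)
qed

text \<open>The product rule leaves one factor undifferentiated; \<open>Ck_on_SucD\<close> lowers
  that factor to the order of the induction hypothesis.\<close>

lemma Ck_on_bounded_bilinear:
  assumes "open S" "bounded_bilinear p" "Ck_on k f S" "Ck_on k g S"
  shows "Ck_on k (\<lambda>x. p (f x) (g x)) S"
  using assms(3,4)
proof (induction k arbitrary: f g)
  case 0
  then show ?case using bounded_bilinear.continuous_on[OF assms(2)] by auto
next
  case (Suc k)
  show ?case
  proof (rule Ck_on_SucI[OF assms(1)])
    show "((\<lambda>x. p (f x) (g x)) has_derivative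
        (\<lambda>h. p (f x) (fderiv g x h) + p (fderiv f x h) (g x))) (at x)" if "x \<in> S" for x
      by (rule bounded_bilinear.FDERIV[OF assms(2) Ck_on_has_derivative[OF Suc.prems(1) that]
            Ck_on_has_derivative[OF Suc.prems(2) that]])
    show "Ck_on k (\<lambda>x. p (f x) (fderiv g x v) + p (fderiv f x v) (g x)) S" for v
      using Suc.prems Ck_on_SucD[OF Suc.prems(1)] Ck_on_SucD[OF Suc.prems(2)]
      by (intro Ck_on_add assms(1) Suc.IH) auto
  qed
qed

lemma Ck_on_sum:
  assumes "open S" "\<And>i. i \<in> I \<Longrightarrow> Ck_on k (f i) S"
  shows "Ck_on k (\<lambda>x. \<Sum>i\<in>I. f i x) S"
  using assms(2)
  by (induction I rule: infinite_finite_induct) (auto intro!: Ck_on_const Ck_on_add assms(1))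

text \<open>\<open>Ck_on\<close> speaks of derivatives in fixed directions only. Expanding the
  argument in \<open>Basis\<close> reduces a linear map applied to a varying vector to finitely many
  fixed directions.\<close>

lemma linear_eq_sum_Basis:
  fixes l :: "'a::euclidean_space \<Rightarrow> 'b::real_vector"
  assumes "linear l"
  shows "l w = (\<Sum>b\<in>Basis. (w \<bullet> b) *\<^sub>R l b)"
  by (subst (1) euclidean_representation[of w, symmetric]) (simp add: linear_sum[OF assms] linear_scale[OF
      assms])

text \<open>In the chain rule the direction \<open>fderiv f x v\<close> moves with \<open>x\<close>,
  so the outer derivative is expanded in \<open>Basis\<close>; this is why the middle space is
  Euclidean.\<close>

lemma Ck_on_compose:
  fixes f :: "'a::real_normed_vector \<Rightarrow> 'b::euclidean_space"
  assumes "open S" "open T" "f ` S \<subseteq> T" "Ck_on k f S" "Ck_on k g T"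
  shows "Ck_on k (\<lambda>x. g (f x)) S"
  using assms(4,5)
proof (induction k arbitrary: g)
  case 0
  then show ?case using assms(3) by (auto intro: continuous_on_compose2)
next
  case (Suc k)
  have lin: "linear (fderiv g (f x))" if "x \<in> S" for x
    using Suc.prems(2) assms(3) that by (auto intro!: linear_frechet_derivative)
  show ?case
  proof (rule Ck_on_SucI[OF assms(1)])
    show "((\<lambda>x. g (f x)) has_derivative
        (\<lambda>h. \<Sum>b\<in>Basis. (fderiv f x h \<bullet> b) *\<^sub>R fderiv g (f x) b)) (at x)" if "x \<in> S" for x
      using has_derivative_compose[OF Ck_on_has_derivative[OF Suc.prems(1) that]
          Ck_on_has_derivative[OF Suc.prems(2)]] assms(3) that
      by (subst linear_eq_sum_Basis[OF lin[OF that], symmetric]) auto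
    show "Ck_on k (\<lambda>x. \<Sum>b\<in>Basis. (fderiv f x v \<bullet> b) *\<^sub>R fderiv g (f x) b) S" for v
      using Suc.prems Ck_on_SucD[OF Suc.prems(1)]
      by (intro Ck_on_sum Ck_on_bounded_bilinear[OF _ bounded_bilinear_scaleR] assms(1)
          Ck_on_bounded_linear[OF _ bounded_linear_inner_left] Suc.IH) auto
  qed
qed

text \<open>The derivative of the reciprocal contains the reciprocal itself, which the induction
  hypothesis covers at the lower order.\<close>

lemma Ck_on_inverse:
  fixes f :: "'a::real_normed_vector \<Rightarrow> real"
  assumes "open S" "\<And>x. x \<in> S \<Longrightarrow> f x \<noteq> 0" "Ck_on k f S"
  shows "Ck_on k (\<lambda>x. inverse (f x)) S"
  using assms(3)
proof (induction k)
  case 0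
  then show ?case using assms(2) by (auto intro!: continuous_intros)
next
  case (Suc k)
  show ?case
  proof (rule Ck_on_SucI[OF assms(1)])
    show "((\<lambda>x. inverse (f x)) has_derivative
        (\<lambda>h. - (inverse (f x) * fderiv f x h * inverse (f x)))) (at x)" if "x \<in> S" for x
      by (rule Deriv.has_derivative_inverse[OF assms(2)[OF that] Ck_on_has_derivative[OF Suc.prems that]])
    show "Ck_on k (\<lambda>x. - (inverse (f x) * fderiv f x v * inverse (f x))) S" for v
      using Suc.prems Suc.IH[OF Ck_on_SucD[OF Suc.prems]]
      by (intro Ck_on_bounded_linear[OF _ bounded_linear_minus[OF bounded_linear_ident]] assms(1)
          Ck_on_bounded_bilinear[OF _ bounded_bilinear_mult]) auto
  qed
qed

section \<open>Closure properties of smooth maps\<close>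

lemma smooth_on_differentiable: "smooth_on f S \<Longrightarrow> x \<in> S \<Longrightarrow> f differentiable (at x)"
  unfolding smooth_on_def using Ck_on.simps(2) by blast

lemma smooth_on_has_derivative:
  "smooth_on f S \<Longrightarrow> x \<in> S \<Longrightarrow> (f has_derivative fderiv f x) (at x)"
  using smooth_on_differentiable frechet_derivative_works by blast

lemma linear_fderiv: "smooth_on f S \<Longrightarrow> x \<in> S \<Longrightarrow> linear (fderiv f x)"
  using smooth_on_differentiable linear_frechet_derivative by blast

lemma smooth_on_continuous_on: "smooth_on f S \<Longrightarrow> continuous_on S f"
  unfolding smooth_on_def using Ck_on.simps(1) by blast

lemma smooth_on_fderiv: "smooth_on f S \<Longrightarrow> smooth_on (\<lambda>x. fderiv f x v) S"
  unfolding smooth_on_def using Ck_on.simps(2) by blast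

lemma smooth_on_subset: "smooth_on f S \<Longrightarrow> T \<subseteq> S \<Longrightarrow> smooth_on f T"
  unfolding smooth_on_def using Ck_on_subset by blast

lemma smooth_on_cong_imp:
  "open S \<Longrightarrow> smooth_on f S \<Longrightarrow> (\<And>x. x \<in> S \<Longrightarrow> f x = g x) \<Longrightarrow> smooth_on g S"
  unfolding smooth_on_def using Ck_on_cong_imp by blast

lemma fderiv_cong:
  assumes "open S" "x \<in> S" "smooth_on f S" "\<And>y. y \<in> S \<Longrightarrow> f y = g y"
  shows "fderiv f x = fderiv g x"
  using frechet_derivative_transform_within_open[OF _ assms(1,2)] smooth_on_differentiable assms
  by blast

named_theorems smooth

lemma smooth_on_const [smooth]: "smooth_on (\<lambda>x. c) S"
  unfolding smooth_on_def by (simp add: Ck_on_const)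

lemma smooth_on_bounded_linear:
  "open S \<Longrightarrow> bounded_linear l \<Longrightarrow> smooth_on f S \<Longrightarrow> smooth_on (\<lambda>x. l (f x)) S"
  unfolding smooth_on_def by (simp add: Ck_on_bounded_linear)

lemma smooth_on_ident [smooth]: "smooth_on (\<lambda>x. x) S"
proof -
  have "Ck_on k (\<lambda>x. x) S" for k
    by (cases k) (auto simp: Ck_on_const)
  then show ?thesis unfolding smooth_on_def by blast
qed

lemma smooth_on_add [smooth]:
  "open S \<Longrightarrow> smooth_on f S \<Longrightarrow> smooth_on g S \<Longrightarrow> smooth_on (\<lambda>x. f x + g x) S"
  unfolding smooth_on_def by (simp add: Ck_on_add)

lemma smooth_on_bounded_bilinear:
  "open S \<Longrightarrow> bounded_bilinear p \<Longrightarrow> smooth_on f S \<Longrightarrow> smooth_on g S \<Longrightarrow> smooth_on (\<lambda>x. p (f x) (g x)) S"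
  unfolding smooth_on_def by (simp add: Ck_on_bounded_bilinear)

lemma smooth_on_sum [smooth]:
  "open S \<Longrightarrow> (\<And>i. i \<in> I \<Longrightarrow> smooth_on (f i) S) \<Longrightarrow> smooth_on (\<lambda>x. \<Sum>i\<in>I. f i x) S"
  unfolding smooth_on_def by (simp add: Ck_on_sum)

lemma smooth_on_compose:
  fixes f :: "'a::real_normed_vector \<Rightarrow> 'b::euclidean_space"
  shows "open S \<Longrightarrow> smooth_on g T \<Longrightarrow> open T \<Longrightarrow> smooth_on f S \<Longrightarrow> (\<And>x. x \<in> S \<Longrightarrow> f x \<in> T) \<Longrightarrow>
    smooth_on (\<lambda>x. g (f x)) S"
  unfolding smooth_on_def by (metis Ck_on_compose image_subsetI)

lemma smooth_on_inverse:
  fixes f :: "'a::real_normed_vector \<Rightarrow> real"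
  shows "open S \<Longrightarrow> smooth_on f S \<Longrightarrow> (\<And>x. x \<in> S \<Longrightarrow> f x \<noteq> 0) \<Longrightarrow> smooth_on (\<lambda>x. inverse (f x)) S"
  unfolding smooth_on_def by (metis Ck_on_inverse)

lemma smooth_on_uminus [smooth]: "open S \<Longrightarrow> smooth_on f S \<Longrightarrow> smooth_on (\<lambda>x. - f x) S"
  by (rule smooth_on_bounded_linear[OF _ bounded_linear_minus[OF bounded_linear_ident]])

lemma smooth_on_diff [smooth]:
  "open S \<Longrightarrow> smooth_on f S \<Longrightarrow> smooth_on g S \<Longrightarrow> smooth_on (\<lambda>x. f x - g x) S"
  using smooth_on_add[of S f "\<lambda>x. - g x"] smooth_on_uminus[of S g] by simp

lemmas smooth_on_scaleR [smooth] = smooth_on_bounded_bilinear[OF _ bounded_bilinear_scaleR]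
lemmas smooth_on_inner [smooth] = smooth_on_bounded_bilinear[OF _ bounded_bilinear_inner]
lemmas smooth_on_mult [smooth] = smooth_on_bounded_bilinear[OF _ bounded_bilinear_mult]
lemmas smooth_on_fst [smooth] = smooth_on_bounded_linear[OF _ bounded_linear_fst]
lemmas smooth_on_snd [smooth] = smooth_on_bounded_linear[OF _ bounded_linear_snd]
lemmas smooth_on_vec_nth [smooth] = smooth_on_bounded_linear[OF _ bounded_linear_vec_nth]

lemma smooth_on_Pair [smooth]:
  assumes "open S" "smooth_on f S" "smooth_on g S"
  shows "smooth_on (\<lambda>x. (f x, g x)) S"
proof -
  have "smooth_on (\<lambda>x. (f x, 0) + (0, g x)) S"
    using assms
    by (intro smooth_on_add smooth_on_bounded_linear[OF _ bounded_linear_Pair]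
        bounded_linear_ident bounded_linear_zero)
  then show ?thesis by simp
qed

lemma smooth_on_prod [smooth]:
  fixes f :: "'i \<Rightarrow> 'a::real_normed_vector \<Rightarrow> real"
  assumes "open S" "\<And>i. i \<in> I \<Longrightarrow> smooth_on (f i) S"
  shows "smooth_on (\<lambda>x. \<Prod>i\<in>I. f i x) S"
  using assms(2)
  by (induction I rule: infinite_finite_induct) (auto intro!: smooth assms(1))

section \<open>Determinants and linear systems with smooth coefficients\<close>

lemma smooth_on_vec_lambda:
  fixes f :: "'a::real_normed_vector \<Rightarrow> 'n::finite \<Rightarrow> real"
  assumes "open S" "\<And>i. smooth_on (\<lambda>x. f x i) S"
  shows "smooth_on (\<lambda>x. \<chi> i. f x i) S"
proof -
  have "smooth_on (\<lambda>x. \<Sum>i\<in>UNIV. f x i *\<^sub>R axis i (1::real)) S"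
    by (intro smooth assms)
  moreover have "(\<Sum>i\<in>UNIV. f x i *\<^sub>R axis i (1::real)) = (\<chi> i. f x i)" for x
    by (simp add: vec_eq_iff axis_def if_distrib cong: if_cong)
  ultimately show ?thesis by simp
qed

lemma smooth_on_det:
  fixes A :: "'a::real_normed_vector \<Rightarrow> real^'n::finite^'n"
  assumes "open S" "\<And>i j. smooth_on (\<lambda>x. A x $ i $ j) S"
  shows "smooth_on (\<lambda>x. det (A x)) S"
  unfolding det_def by (intro smooth assms)

text \<open>By Cramer's rule each component of the solution is a quotient of determinants of smooth
  entries. The solution enters only through the equation it satisfies at each point.\<close>

lemma smooth_on_linear_solution:
  fixes A :: "'a::real_normed_vector \<Rightarrow> real^'n::finite^'n" and b :: "'a \<Rightarrow> real^'n"
  assumes "open S" "\<And>i j. smooth_on (\<lambda>x. A x $ i $ j) S" "smooth_on b S"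
    and "\<And>x. x \<in> S \<Longrightarrow> invertible (A x)" "\<And>x. x \<in> S \<Longrightarrow> A x *v g x = b x"
  shows "smooth_on g S"
proof -
  have d: "det (A x) \<noteq> 0" if "x \<in> S" for x
    using assms(4)[OF that] by (simp add: invertible_det_nz)
  have "smooth_on (\<lambda>x. \<chi> k. det (\<chi> i j. if j = k then b x $ i else A x $ i $ j) * inverse (det (A x))) S"
  proof (intro smooth_on_vec_lambda smooth_on_mult assms(1) smooth_on_det smooth_on_inverse d assms(2))
    fix k i j :: 'n
    show "smooth_on (\<lambda>x. (\<chi> i j. if j = k then b x $ i else A x $ i $ j) $ i $ j) S"
      using assms by (cases "j = k") (auto intro: smooth)
  qed
  then show ?thesis
  proof (rule smooth_on_cong_imp[OF assms(1)])
    fix x assume "x \<in> S"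
    then show "(\<chi> k. det (\<chi> i j. if j = k then b x $ i else A x $ i $ j) * inverse (det (A x))) = g x"
      using cramer[OF d[of x], of "g x" "b x"] assms(5) by (simp add: divide_inverse)
  qed
qed

section \<open>Derivatives applied to a varying vector\<close>

lemma smooth_on_linear_apply:
  fixes w :: "'a::real_normed_vector \<Rightarrow> 'b::euclidean_space"
  assumes "open S" "\<And>x. x \<in> S \<Longrightarrow> linear (A x)" "\<And>b. b \<in> Basis \<Longrightarrow> smooth_on (\<lambda>x. A x b) S" "smooth_on w S"
  shows "smooth_on (\<lambda>x. A x (w x)) S"
proof -
  have "smooth_on (\<lambda>x. \<Sum>b\<in>Basis. (w x \<bullet> b) *\<^sub>R A x b) S"
    by (intro smooth assms)
  then show ?thesis
    by (rule smooth_on_cong_imp[OF assms(1)]) (simp flip: linear_eq_sum_Basis[OF assms(2)])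
qed

lemma smooth_on_fderiv_apply:
  fixes f :: "'a::real_normed_vector \<Rightarrow> 'b::euclidean_space"
  assumes "open S" "smooth_on g T" "open T" "smooth_on f S" "\<And>x. x \<in> S \<Longrightarrow> f x \<in> T" "smooth_on w S"
  shows "smooth_on (\<lambda>x. fderiv g (f x) (w x)) S"
  by (rule smooth_on_linear_apply[where A="\<lambda>x. fderiv g (f x)", OF assms(1) _ _ assms(6)])
    (simp_all add: linear_fderiv[OF assms(2)] assms(5)
      smooth_on_compose[OF assms(1) smooth_on_fderiv[OF assms(2)] assms(3,4,5)])

text \<open>A product rule for the pairing of the linear map \<open>fderiv g (f x)\<close> with the
  vector \<open>w x\<close>. In the first summand \<open>w x\<close> is frozen, so it is a second
  derivative of \<open>g\<close>. It supplies the second-order terms for curves, Euler-Lagrange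
  expressions and accelerations.\<close>

lemma has_derivative_fderiv_apply:
  fixes g :: "'b::euclidean_space \<Rightarrow> 'c::real_normed_vector"
  assumes "smooth_on g T" "open T" "f x \<in> T"
    and f: "(f has_derivative f') (at x)" and w: "(w has_derivative w') (at x)"
  shows "((\<lambda>x. fderiv g (f x) (w x)) has_derivative
     (\<lambda>h. fderiv (\<lambda>y. fderiv g y (w x)) (f x) (f' h) + fderiv g (f x) (w' h))) (at x)"
proof -
  let ?A = "\<lambda>b y. fderiv g y b"
  have A: "(?A b has_derivative fderiv (?A b) (f x)) (at (f x))" for b
    by (rule smooth_on_has_derivative[OF smooth_on_fderiv[OF assms(1)] assms(3)])
  have lin: "y \<in> T \<Longrightarrow> linear (fderiv g y)" for y
    by (rule linear_fderiv[OF assms(1)])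
  have sum: "fderiv g y u = (\<Sum>b\<in>Basis. (u \<bullet> b) *\<^sub>R ?A b y)" if "y \<in> T" for y u
    by (rule linear_eq_sum_Basis[OF lin[OF that]])
  have 1: "fderiv (\<lambda>y. fderiv g y (w x)) (f x) = (\<lambda>h. \<Sum>b\<in>Basis. (w x \<bullet> b) *\<^sub>R fderiv (?A b) (f x) h)"
  proof (rule fderiv_eqI)
    have "((\<lambda>y. \<Sum>b\<in>Basis. (w x \<bullet> b) *\<^sub>R ?A b y) has_derivative
        (\<lambda>h. \<Sum>b\<in>Basis. (w x \<bullet> b) *\<^sub>R fderiv (?A b) (f x) h)) (at (f x))"
      by (intro has_derivative_sum has_derivative_scaleR_right A)
    then show "((\<lambda>y. fderiv g y (w x)) has_derivative
        (\<lambda>h. \<Sum>b\<in>Basis. (w x \<bullet> b) *\<^sub>R fderiv (?A b) (f x) h)) (at (f x))"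
      by (rule has_derivative_transform_within_open[OF _ assms(2,3)]) (simp flip: sum)
  qed
  have "((\<lambda>x. \<Sum>b\<in>Basis. (w x \<bullet> b) *\<^sub>R ?A b (f x)) has_derivative
     (\<lambda>h. \<Sum>b\<in>Basis. (w x \<bullet> b) *\<^sub>R fderiv (?A b) (f x) (f' h) + (w' h \<bullet> b) *\<^sub>R ?A b (f x))) (at x)"
    by (intro has_derivative_sum has_derivative_scaleR has_derivative_inner_left w
        has_derivative_compose[OF f A])
  also have "(\<lambda>h. \<Sum>b\<in>Basis. (w x \<bullet> b) *\<^sub>R fderiv (?A b) (f x) (f' h) + (w' h \<bullet> b) *\<^sub>R ?A b (f x))
      = (\<lambda>h. fderiv (\<lambda>y. fderiv g y (w x)) (f x) (f' h) + fderiv g (f x) (w' h))"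
    unfolding 1 by (simp add: sum.distrib flip: sum[OF assms(3)])
  finally have *: "((\<lambda>x. \<Sum>b\<in>Basis. (w x \<bullet> b) *\<^sub>R ?A b (f x)) has_derivative
      (\<lambda>h. fderiv (\<lambda>y. fderiv g y (w x)) (f x) (f' h) + fderiv g (f x) (w' h))) (at x)" .
  have "\<forall>\<^sub>F y in at x. f y \<in> T"
    using has_derivative_continuous[OF f] by (intro topological_tendstoD[OF _ assms(2,3)]) (simp add:
        continuous_at)
  then have "\<forall>\<^sub>F y in at x. (\<Sum>b\<in>Basis. (w y \<bullet> b) *\<^sub>R ?A b (f y)) = fderiv g (f y) (w y)"
    by eventually_elim (simp flip: sum)
  then show ?thesis
    by (rule has_derivative_transform_eventually[OF *]) (simp_all flip: sum[OF assms(3)])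
qed

text \<open>The mean value theorem is applied twice: in the direction \<open>u\<close> to a
  difference taken along \<open>v\<close>, and then in the direction \<open>v\<close>. The bound on
  \<open>h\<close> keeps the whole parallelogram inside the ball.\<close>

lemma second_difference:
  fixes f :: "'a::real_normed_vector \<Rightarrow> real"
  assumes "smooth_on f (ball x r)" "0 < h" "h * (norm u + norm v) < r"
  obtains s t where "0 < s" "s < h" "0 < t" "t < h"
    "f (x + h *\<^sub>R u + h *\<^sub>R v) - f (x + h *\<^sub>R u) - f (x + h *\<^sub>R v) + f x
      = h * h * fderiv (\<lambda>y. fderiv f y u) (x + s *\<^sub>R u + t *\<^sub>R v) v"
proof -
  have inb: "x + s *\<^sub>R u + t *\<^sub>R v \<in> ball x r" if "0 \<le> s" "s \<le> h" "0 \<le> t" "t \<le> h" for s t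
  proof -
    have "norm (s *\<^sub>R u + t *\<^sub>R v) \<le> s * norm u + t * norm v"
      using norm_triangle_ineq[of "s *\<^sub>R u" "t *\<^sub>R v"] that by simp
    also have "\<dots> \<le> h * norm u + h * norm v"
      using that by (intro add_mono mult_right_mono) auto
    finally have "norm (s *\<^sub>R u + t *\<^sub>R v) < r" using assms(3) by (simp add: algebra_simps)
    moreover have "dist (x + s *\<^sub>R u + t *\<^sub>R v) x = norm (s *\<^sub>R u + t *\<^sub>R v)"
      by (simp add: dist_norm add.assoc)
    ultimately show ?thesis by (simp add: dist_commute)
  qed
  have lin: "linear (fderiv f y)" if "y \<in> ball x r" for y
    by (rule linear_fderiv[OF assms(1) that])
  have lin2: "linear (fderiv (\<lambda>y. fderiv f y u) y)" if "y \<in> ball x r" for y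
    by (rule linear_fderiv[OF smooth_on_fderiv[OF assms(1)] that])
  \<comment> \<open>The idle summand \<open>0 *\<^sub>R v\<close> gives both terms the same form
    with a parameter \<open>t\<close>, so that one derivative computation serves
    \<open>t = h\<close> and \<open>t = 0\<close>.\<close>
  let ?\<phi> = "\<lambda>s. f (x + s *\<^sub>R u + h *\<^sub>R v) - f (x + s *\<^sub>R u + 0 *\<^sub>R v)"
  have \<phi>': "DERIV ?\<phi> s :> fderiv f (x + s *\<^sub>R u + h *\<^sub>R v) u
      - fderiv f (x + s *\<^sub>R u + 0 *\<^sub>R v) u"
    if "0 \<le> s" "s \<le> h" for s
  proof -
    have d: "((\<lambda>s. f (x + s *\<^sub>R u + t *\<^sub>R v)) has_derivative (\<lambda>k. fderiv f (x + s *\<^sub>R u + t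
        *\<^sub>R v) (k *\<^sub>R u))) (at s)"
      if "0 \<le> t" "t \<le> h" for t
      by (rule has_derivative_compose[OF _ smooth_on_has_derivative[OF assms(1)]])
        (use inb that \<open>0 \<le> s\<close> \<open>s \<le> h\<close> in \<open>auto intro!: derivative_eq_intros\<close>)
    have "DERIV (\<lambda>s. f (x + s *\<^sub>R u + t *\<^sub>R v)) s :> fderiv f (x + s *\<^sub>R u + t *\<^sub>R v) u"
      if "0 \<le> t" "t \<le> h" for t
      using d[OF that] linear_scale[OF lin[OF inb[OF \<open>0 \<le> s\<close> \<open>s \<le> h\<close> that]]]
      by (simp add: has_field_derivative_def mult_commute_abs)
    from DERIV_diff[OF this[of h] this[of 0]] show ?thesis using assms(2) by simp
  qed
  obtain s where s: "0 < s" "s < h" "?\<phi> h - ?\<phi> 0 = (h - 0) *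
      (fderiv f (x + s *\<^sub>R u + h *\<^sub>R v) u - fderiv f (x + s *\<^sub>R u + 0 *\<^sub>R v) u)"
    using MVT2[OF assms(2) \<phi>'] by blast
  let ?\<psi> = "\<lambda>t. fderiv f (x + s *\<^sub>R u + t *\<^sub>R v) u"
  have \<psi>': "DERIV ?\<psi> t :> fderiv (\<lambda>y. fderiv f y u) (x + s *\<^sub>R u + t *\<^sub>R v) v"
    if "0 \<le> t" "t \<le> h" for t
  proof -
    have "(?\<psi> has_derivative (\<lambda>k. fderiv (\<lambda>y. fderiv f y u) (x + s *\<^sub>R u + t *\<^sub>R v) (k *\<^sub>R
        v))) (at t)"
      by (rule has_derivative_compose[OF _ smooth_on_has_derivative[OF smooth_on_fderiv[OF assms(1)]]])
        (use inb that s in \<open>auto intro!: derivative_eq_intros\<close>)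
    then show ?thesis
      using linear_scale[OF lin2[OF inb[of s t]]] that s
      by (simp add: has_field_derivative_def mult_commute_abs)
  qed
  obtain t where t: "0 < t" "t < h" "?\<psi> h - ?\<psi> 0 = (h - 0) *
      fderiv (\<lambda>y. fderiv f y u) (x + s *\<^sub>R u + t *\<^sub>R v) v"
    using MVT2[OF assms(2) \<psi>'] by blast
  show ?thesis
    by (rule that[OF s(1,2) t(1,2)]) (use s(3) t(3) in simp)
qed

text \<open>The second difference is symmetric in \<open>u\<close> and \<open>v\<close>. Evaluated
  in both orders it equals \<open>h * h\<close> times the two mixed derivatives at points close to
  \<open>x\<close>; by continuity these cannot stay apart.\<close>

lemma fderiv_symmetric_real:
  fixes f :: "'a::real_normed_vector \<Rightarrow> real"
  assumes "smooth_on f S" "open S" "x \<in> S"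
  shows "fderiv (\<lambda>y. fderiv f y u) x v = fderiv (\<lambda>y. fderiv f y v) x u"
proof (rule ccontr)
  let ?B = "\<lambda>u v y. fderiv (\<lambda>y. fderiv f y u) y v"
  assume "?B u v x \<noteq> ?B v u x"
  then have e: "0 < dist (?B u v x) (?B v u x) / 2" (is "0 < ?e") by simp
  have cont: "continuous (at x) (?B u v)" for u v
    using smooth_on_continuous_on[OF smooth_on_fderiv[OF smooth_on_fderiv[OF assms(1)]]] assms
    by (simp add: continuous_on_eq_continuous_at)
  obtain d1 where d1: "0 < d1" "\<And>y. dist y x < d1 \<Longrightarrow> dist (?B u v y) (?B u v x) < ?e"
    using cont[of u v] e unfolding continuous_at_eps_delta by (metis (no_types, lifting))
  obtain d2 where d2: "0 < d2" "\<And>y. dist y x < d2 \<Longrightarrow> dist (?B v u y) (?B v u x) < ?e"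
    using cont[of v u] e unfolding continuous_at_eps_delta by (metis (no_types, lifting))
  obtain r0 where r0: "0 < r0" "ball x r0 \<subseteq> S" using assms open_contains_ball by blast
  define r where "r = min r0 (min d1 d2)"
  have r: "0 < r" "smooth_on f (ball x r)"
    using d1(1) d2(1) r0 by (auto simp: r_def intro!: smooth_on_subset[OF assms(1)])
  \<comment> \<open>The summand 1 keeps \<open>m\<close> positive even when both directions vanish,
    and the factor 2 in \<open>h\<close> makes the bound by \<open>r\<close> strict.\<close>
  define m where "m = norm u + norm v + 1"
  define h where "h = r / (2 * m)"
  have p: "0 < m" unfolding m_def by (smt (verit) norm_ge_zero)
  have h: "0 < h" using r(1) p by (simp add: h_def)
  have hr: "h * (norm u + norm v) < r"
  proof -
    have "h * (norm u + norm v) \<le> h * m" using h by (simp add: m_def)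
    also have "\<dots> = r / 2" using p by (simp add: h_def)
    finally show ?thesis using r(1) by simp
  qed
  have near: "dist (x + s *\<^sub>R u + t *\<^sub>R v) x < r" if "0 < s" "s < h" "0 < t" "t < h" for s t
  proof -
    have "dist (x + s *\<^sub>R u + t *\<^sub>R v) x = norm (s *\<^sub>R u + t *\<^sub>R v)"
      by (simp add: dist_norm add.assoc)
    also have "\<dots> \<le> s * norm u + t * norm v"
      using norm_triangle_ineq[of "s *\<^sub>R u" "t *\<^sub>R v"] that by simp
    also have "\<dots> \<le> h * norm u + h * norm v"
      using that by (intro add_mono mult_right_mono) auto
    finally show ?thesis using hr by (simp add: algebra_simps)
  qed
  obtain s t where st: "0 < s" "s < h" "0 < t" "t < h"
    "f (x + h *\<^sub>R u + h *\<^sub>R v) - f (x + h *\<^sub>R u) - f (x + h *\<^sub>R v) + f x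
        = h * h * ?B u v (x + s *\<^sub>R u + t *\<^sub>R v)"
    using second_difference[OF r(2) h hr] by metis
  obtain s' t' where st': "0 < s'" "s' < h" "0 < t'" "t' < h"
    "f (x + h *\<^sub>R v + h *\<^sub>R u) - f (x + h *\<^sub>R v) - f (x + h *\<^sub>R u) + f x
        = h * h * ?B v u (x + s' *\<^sub>R v + t' *\<^sub>R u)"
    using second_difference[OF r(2) h, of v u] hr by (metis add.commute)
  have "h * h * ?B u v (x + s *\<^sub>R u + t *\<^sub>R v)
      = h * h * ?B v u (x + s' *\<^sub>R v + t' *\<^sub>R u)"
    using st(5) st'(5) by (simp add: algebra_simps)
  then have "?B u v (x + s *\<^sub>R u + t *\<^sub>R v) = ?B v u (x + t' *\<^sub>R u + s' *\<^sub>R v)"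
    using h by (simp add: add_ac)
  moreover have "dist (?B u v (x + s *\<^sub>R u + t *\<^sub>R v)) (?B u v x) < ?e"
    using near[OF st(1-4)] by (intro d1(2)) (simp add: r_def)
  moreover have "dist (?B v u (x + t' *\<^sub>R u + s' *\<^sub>R v)) (?B v u x) < ?e"
    using near[OF st'(3,4,1,2)] by (intro d2(2)) (simp add: r_def)
  ultimately show False
    using dist_triangle_half_r[of "?B u v (x + s *\<^sub>R u + t *\<^sub>R v)" "?B u v x"
        "dist (?B u v x) (?B v u x)" "?B v u x"] by simp
qed

text \<open>Reduced to real values by pairing with basis vectors, which commutes with both
  derivatives.\<close>

lemma fderiv_symmetric:
  fixes f :: "'a::real_normed_vector \<Rightarrow> 'b::euclidean_space"
  assumes "smooth_on f S" "open S" "x \<in> S"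
  shows "fderiv (\<lambda>y. fderiv f y u) x v = fderiv (\<lambda>y. fderiv f y v) x u"
proof (rule euclidean_eqI)
  fix b :: 'b assume "b \<in> Basis"
  have inner1: "fderiv (\<lambda>y. g y \<bullet> b) y = (\<lambda>h. fderiv g y h \<bullet> b)" if "smooth_on g S" "y \<in> S" for g y
    by (intro fderiv_eqI has_derivative_inner_left smooth_on_has_derivative[OF that])
  have sm: "smooth_on (\<lambda>y. f y \<bullet> b) S" by (intro smooth assms)
  have *: "fderiv (\<lambda>y. fderiv f y u) x v \<bullet> b = fderiv (\<lambda>y. fderiv (\<lambda>y. f y \<bullet> b) y u) x v" for u v
  proof -
    have "fderiv (\<lambda>y. fderiv f y u \<bullet> b) x v = fderiv (\<lambda>y. fderiv f y u) x v \<bullet> b"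
      using inner1[OF smooth_on_fderiv[OF assms(1)] assms(3)] by metis
    moreover have "fderiv (\<lambda>y. fderiv f y u \<bullet> b) x = fderiv (\<lambda>y. fderiv (\<lambda>y. f y \<bullet> b) y u) x"
      by (rule fderiv_cong[OF assms(2,3)]) (auto simp: inner1[OF assms(1)] intro!: smooth assms
          smooth_on_fderiv)
    ultimately show ?thesis by simp
  qed
  show "fderiv (\<lambda>y. fderiv f y u) x v \<bullet> b = fderiv (\<lambda>y. fderiv f y v) x u \<bullet> b"
    unfolding * by (rule fderiv_symmetric_real[OF sm assms(2,3)])
qed

section \<open>Curves\<close>

lemma curve_deriv_0: "curve_deriv 0 \<gamma> = \<gamma> 0"
  by (simp add: curve_deriv_def)

lemma curve_deriv_1: "curve_deriv 1 \<gamma> = vector_derivative \<gamma> (at 0)"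
  by (simp add: curve_deriv_def)

lemma curve_deriv_2: "curve_deriv 2 \<gamma> = vector_derivative (\<lambda>t. vector_derivative \<gamma> (at t)) (at 0)"
  by (simp add: curve_deriv_def numeral_2_eq_2)

text \<open>Iterated derivatives at 0 see only the germ of the curve, which matters because a chart
  controls a curve only near 0.\<close>

lemma curve_deriv_cong:
  assumes "open S" "0 \<in> S" "\<And>t. t \<in> S \<Longrightarrow> f t = g t"
  shows "curve_deriv n f = curve_deriv n g"
proof -
  let ?V = "\<lambda>g t. vector_derivative g (at t)"
  have "\<forall>t\<in>S. (?V ^^ n) f t = (?V ^^ n) g t"
  proof (induction n)
    case (Suc n)
    have "vector_derivative ((?V ^^ n) f) (at t) = vector_derivative ((?V ^^ n) g) (at t)" if "t \<in> S" for t
      using Suc assms(1) that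
      by (intro vector_derivative_cong_eq) (auto simp: eventually_nhds)
    then show ?case by simp
  qed (use assms in simp)
  then show ?thesis using assms(2) by (simp add: curve_deriv_def)
qed

lemma vector_derivative_eq_fderiv:
  "smooth_on \<gamma> S \<Longrightarrow> t \<in> S \<Longrightarrow> vector_derivative \<gamma> (at t) = fderiv \<gamma> t 1"
  using frechet_derivative_eq_vector_derivative[OF smooth_on_differentiable, of \<gamma> S t] by simp

lemma smooth_on_has_derivative_scaleR:
  "smooth_on \<gamma> S \<Longrightarrow> t \<in> S \<Longrightarrow> (\<gamma> has_derivative (\<lambda>h. h *\<^sub>R vector_derivative \<gamma> (at t))) (at t)"
  using smooth_on_has_derivative[of \<gamma> S t]
    frechet_derivative_eq_vector_derivative[OF smooth_on_differentiable, of \<gamma> S t] by simp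

lemma smooth_on_vector_derivative:
  "open S \<Longrightarrow> smooth_on \<gamma> S \<Longrightarrow> smooth_on (\<lambda>t. vector_derivative \<gamma> (at t)) S"
  by (rule smooth_on_cong_imp[OF _ smooth_on_fderiv[of \<gamma> S 1]]) (simp_all add: vector_derivative_eq_fderiv)

lemma vector_derivative_compose:
  assumes "smooth_on \<gamma> S" "t \<in> S" "smooth_on \<phi> T" "\<gamma> t \<in> T"
  shows "vector_derivative (\<phi> \<circ> \<gamma>) (at t) = fderiv \<phi> (\<gamma> t) (vector_derivative \<gamma> (at t))"
proof -
  have "((\<phi> \<circ> \<gamma>) has_derivative (\<lambda>h. fderiv \<phi> (\<gamma> t) (h *\<^sub>R vector_derivative \<gamma> (at t)))) (at t)"
    unfolding o_def
    by (rule has_derivative_compose[OF smooth_on_has_derivative_scaleR[OF assms(1,2)]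
          smooth_on_has_derivative[OF assms(3,4)]])
  then show ?thesis
    by (intro vector_derivative_at)
      (simp add: has_vector_derivative_def linear_scale[OF linear_fderiv[OF assms(3,4)]])
qed

lemma curve_deriv_1_compose:
  assumes "smooth_on \<gamma> S" "0 \<in> S" "smooth_on \<phi> T" "\<gamma> 0 \<in> T"
  shows "curve_deriv 1 (\<phi> \<circ> \<gamma>) = fderiv \<phi> (\<gamma> 0) (curve_deriv 1 \<gamma>)"
  unfolding curve_deriv_1 by (rule vector_derivative_compose[OF assms])

text \<open>The first summand is the inhomogeneous term by which accelerations fail to transform as
  vectors.\<close>

lemma curve_deriv_2_compose:
  fixes \<gamma> :: "real \<Rightarrow> 'a::euclidean_space"
  assumes "smooth_on \<gamma> S" "open S" "0 \<in> S" "smooth_on \<phi> T" "open T" "\<And>t. t \<in> S \<Longrightarrow> \<gamma> t \<in> T"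
  shows "curve_deriv 2 (\<phi> \<circ> \<gamma>) =
    fderiv (\<lambda>y. fderiv \<phi> y (curve_deriv 1 \<gamma>)) (\<gamma> 0) (curve_deriv 1 \<gamma>) + fderiv \<phi> (\<gamma> 0) (curve_deriv 2 \<gamma>)"
proof -
  let ?v = "\<lambda>t. vector_derivative \<gamma> (at t)"
  have "vector_derivative (\<lambda>t. vector_derivative (\<phi> \<circ> \<gamma>) (at t)) (at 0)
      = vector_derivative (\<lambda>t. fderiv \<phi> (\<gamma> t) (?v t)) (at 0)"
    using assms(2,3) vector_derivative_compose[OF assms(1) _ assms(4,6)]
    by (intro vector_derivative_cong_eq) (auto simp: eventually_nhds)
  also have "\<dots> = fderiv (\<lambda>y. fderiv \<phi> y (?v 0)) (\<gamma> 0) (?v 0) + fderiv \<phi> (\<gamma> 0) (vector_derivative ?v (at 0))"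
  proof (rule vector_derivative_at)
    have "((\<lambda>t. fderiv \<phi> (\<gamma> t) (?v t)) has_derivative
        (\<lambda>h. fderiv (\<lambda>y. fderiv \<phi> y (?v 0)) (\<gamma> 0) (h *\<^sub>R ?v 0)
           + fderiv \<phi> (\<gamma> 0) (h *\<^sub>R vector_derivative ?v (at 0)))) (at 0)"
      using assms
      by (intro has_derivative_fderiv_apply[OF assms(4,5)] smooth_on_has_derivative_scaleR[of _ S]
          smooth_on_vector_derivative) auto
    then show "((\<lambda>t. fderiv \<phi> (\<gamma> t) (?v t)) has_vector_derivative
        fderiv (\<lambda>y. fderiv \<phi> y (?v 0)) (\<gamma> 0) (?v 0) + fderiv \<phi> (\<gamma> 0) (vector_derivative ?v (at 0))) (at 0)"
      using linear_fderiv[OF assms(4) assms(6)[OF assms(3)]]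
        linear_fderiv[OF smooth_on_fderiv[OF assms(4)] assms(6)[OF assms(3)]]
      by (simp add: has_vector_derivative_def linear_scale scaleR_add_right)
  qed
  finally show ?thesis unfolding curve_deriv_1 curve_deriv_2 .
qed

text \<open>The polynomial curve with value \<open>q\<close>, velocity \<open>v\<close> and
  acceleration \<open>a\<close> at 0. It is the standard representative of a 2-jet, and with
  \<open>a = 0\<close> it is the straight line in \<open>coord_vector\<close>.\<close>

definition quadratic :: "'e::real_normed_vector \<Rightarrow> 'e \<Rightarrow> 'e \<Rightarrow> real \<Rightarrow> 'e" where
  "quadratic q v a t = q + t *\<^sub>R v + (t\<^sup>2 / 2) *\<^sub>R a"

lemma vector_derivative_quadratic: "vector_derivative (quadratic q v a) (at t) = v + t *\<^sub>R a"
  unfolding quadratic_def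
  by (rule vector_derivative_at) (auto intro!: derivative_eq_intros)

lemma curve_deriv_quadratic:
  "curve_deriv 0 (quadratic q v a) = q" "curve_deriv 1 (quadratic q v a) = v"
  "curve_deriv 2 (quadratic q v a) = a"
proof -
  have "vector_derivative (\<lambda>t. v + t *\<^sub>R a) (at 0) = a"
    by (rule vector_derivative_at) (auto intro!: derivative_eq_intros)
  then show "curve_deriv 2 (quadratic q v a) = a"
    by (simp add: curve_deriv_2 vector_derivative_quadratic)
qed (simp_all add: curve_deriv_0 curve_deriv_1[unfolded One_nat_def] vector_derivative_quadratic, simp add:
    quadratic_def)

lemma smooth_on_quadratic: "smooth_on (quadratic q v a) UNIV"
  unfolding quadratic_def[abs_def] power2_eq_square divide_inverse by (intro smooth open_UNIV)


section \<open>Charts, curves and tangent vectors\<close>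

definition transition :: "('p, 'e) chart \<Rightarrow> ('p, 'e) chart \<Rightarrow> 'e \<Rightarrow> 'e" where
  "transition k k' = snd k' \<circ> chart_inv k"

text \<open>The part of the coordinate image of \<open>k\<close> on which
  \<open>transition k k'\<close> is a coordinate change; elsewhere the values of that function carry
  no meaning.\<close>

definition overlap :: "('p, 'e) chart \<Rightarrow> ('p, 'e) chart \<Rightarrow> 'e set" where
  "overlap k k' = snd k ` (fst k \<inter> fst k')"

lemma chart_inv_in: "y \<in> snd k ` fst k \<Longrightarrow> chart_inv k y \<in> fst k"
  unfolding chart_inv_def by (rule inv_into_into)

lemma chart_of_inv: "y \<in> snd k ` fst k \<Longrightarrow> snd k (chart_inv k y) = y"
  unfolding chart_inv_def by (rule f_inv_into_f)

text \<open>Kept apart from the version for atlases because chart inverses are needed before an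
  atlas is established, and because the constraint and control charts are handled through
  injectivity alone.\<close>

lemma inv_of_chart': "inj_on (snd k) (fst k) \<Longrightarrow> x \<in> fst k \<Longrightarrow> chart_inv k (snd k x) = x"
  unfolding chart_inv_def by simp

lemma inv_of_chart: "smooth_atlas A \<Longrightarrow> k \<in> A \<Longrightarrow> x \<in> fst k \<Longrightarrow> chart_inv k (snd k x) = x"
  unfolding smooth_atlas_def is_chart_def by (auto intro: inv_of_chart')

lemma open_chart: "smooth_atlas A \<Longrightarrow> k \<in> A \<Longrightarrow> open (snd k ` fst k)"
  unfolding smooth_atlas_def is_chart_def by auto

lemma open_overlap: "smooth_atlas A \<Longrightarrow> k \<in> A \<Longrightarrow> k' \<in> A \<Longrightarrow> open (overlap k k')"
  unfolding smooth_atlas_def smooth_transition_def overlap_def by auto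

lemma smooth_on_transition:
  "smooth_atlas A \<Longrightarrow> k \<in> A \<Longrightarrow> k' \<in> A \<Longrightarrow> smooth_on (transition k k') (overlap k k')"
  unfolding smooth_atlas_def smooth_transition_def overlap_def transition_def by auto

lemma overlap_subset: "overlap k k' \<subseteq> snd k ` fst k"
  by (auto simp: overlap_def)

lemma overlap_self: "overlap k k = snd k ` fst k"
  by (simp add: overlap_def)

lemma overlapI: "x \<in> fst k \<Longrightarrow> x \<in> fst k' \<Longrightarrow> snd k x \<in> overlap k k'"
  by (auto simp: overlap_def)

lemma transition_chart:
  "smooth_atlas A \<Longrightarrow> k \<in> A \<Longrightarrow> x \<in> fst k \<Longrightarrow> transition k k' (snd k x) = snd k' x"
  by (simp add: transition_def inv_of_chart)

lemma overlapE:
  assumes "smooth_atlas A" "k \<in> A" "y \<in> overlap k k'"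
  obtains x where "x \<in> fst k" "x \<in> fst k'" "y = snd k x" "chart_inv k y = x" "transition k k' y = snd k' x"
  using assms by (auto simp: overlap_def transition_chart inv_of_chart)

text \<open>It is enough to exhibit a smooth formula that carries \<open>k\<close>-coordinates to
  \<open>k'\<close>-coordinates point by point; the abstract inverse \<open>chart_inv\<close> never
  has to be computed.\<close>

lemma smooth_transitionI:
  assumes "inj_on (snd k) (fst k)" "open S" "overlap k k' = S" "smooth_on \<psi> S"
    and "\<And>x. x \<in> fst k \<Longrightarrow> x \<in> fst k' \<Longrightarrow> snd k' x = \<psi> (snd k x)"
  shows "smooth_transition k k'"
  unfolding smooth_transition_def
proof
  show "open (snd k ` (fst k \<inter> fst k'))" using assms(2,3) by (simp add: overlap_def)
  show "smooth_on (snd k' \<circ> chart_inv k) (snd k ` (fst k \<inter> fst k'))"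
    using assms by (intro smooth_on_cong_imp[OF _ smooth_on_subset[OF assms(4)]])
      (auto simp: overlap_def inv_of_chart')
qed

text \<open>A smooth curve is smooth in some chart. Continuity there makes the preimage of the
  overlap a neighbourhood of 0, and the transition map carries smoothness over to the given
  chart.\<close>

lemma smooth_curve_in_chart:
  fixes A :: "('p, 'e::euclidean_space) atlas"
  assumes A: "smooth_atlas A" and c: "smooth_curve A c" and k: "k \<in> A" "c 0 \<in> fst k"
  obtains \<epsilon> where "\<epsilon> > 0" "\<And>t. t \<in> {-\<epsilon><..<\<epsilon>} \<Longrightarrow> c t \<in> fst k" "smooth_on (snd k \<circ> c) {-\<epsilon><..<\<epsilon>}"
proof -
  obtain k' \<delta> where k': "k' \<in> A" and \<delta>: "\<delta> > 0" "c ` {-\<delta><..<\<delta>} \<subseteq> fst k'" "smooth_on (snd k' \<circ> c) {-\<delta><..<\<delta>}"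
    using c unfolding smooth_curve_def by blast
  let ?J = "{-\<delta><..<\<delta>} \<inter> (snd k' \<circ> c) -` overlap k' k"
  have "open ?J"
    by (rule continuous_open_preimage[OF smooth_on_continuous_on[OF \<delta>(3)] _ open_overlap[OF A k' k(1)]]) auto
  moreover have "0 \<in> ?J" using \<delta> k by (auto intro!: overlapI)
  ultimately obtain \<epsilon> where \<epsilon>: "\<epsilon> > 0" "ball 0 \<epsilon> \<subseteq> ?J"
    using open_contains_ball by blast
  have sub: "{-\<epsilon><..<\<epsilon>} \<subseteq> ?J" using \<epsilon>(2) by (auto simp: dist_norm subset_eq)
  have in_k': "c t \<in> fst k'" if "t \<in> {-\<epsilon><..<\<epsilon>}" for t using sub \<delta>(2) that by blast
  have in_k: "c t \<in> fst k" if "t \<in> {-\<epsilon><..<\<epsilon>}" for t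
  proof -
    \<comment> \<open>Membership in the overlap yields only a point with the same coordinates;
      injectivity of the chart identifies it with \<open>c t\<close>.\<close>
    have "snd k' (c t) \<in> overlap k' k" using sub that by auto
    then show ?thesis
      using overlapE[OF A k'] inv_of_chart[OF A k' in_k'[OF that]] by metis
  qed
  have "smooth_on (\<lambda>t. transition k' k ((snd k' \<circ> c) t)) {-\<epsilon><..<\<epsilon>}"
    using sub
    by (intro smooth_on_compose[OF _ smooth_on_transition[OF A k' k(1)] open_overlap[OF A k' k(1)]
          smooth_on_subset[OF \<delta>(3)]]) auto
  then have "smooth_on (snd k \<circ> c) {-\<epsilon><..<\<epsilon>}"
    by (rule smooth_on_cong_imp[rotated]) (auto simp: transition_chart[OF A k' in_k'])
  then show ?thesis using that \<epsilon>(1) in_k by blast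
qed

lemma smooth_curveI:
  assumes "k \<in> A" "open S" "0 \<in> S" "\<And>t. t \<in> S \<Longrightarrow> c t \<in> fst k" "smooth_on (snd k \<circ> c) S"
  shows "smooth_curve A c"
proof -
  obtain \<epsilon> where \<epsilon>: "\<epsilon> > 0" "ball 0 \<epsilon> \<subseteq> S" using assms(2,3) open_contains_ball by blast
  have "{-\<epsilon><..<\<epsilon>} \<subseteq> S" using \<epsilon>(2) by (auto simp: dist_norm subset_eq)
  then show ?thesis
    unfolding smooth_curve_def using assms \<epsilon>(1)
    by (intro bexI[of _ k] exI[of _ \<epsilon>]) (auto intro: smooth_on_subset)
qed

lemma curve_deriv_change:
  fixes A :: "('p, 'e::euclidean_space) atlas"
  assumes A: "smooth_atlas A" and c: "smooth_curve A c" and k: "k \<in> A" "c 0 \<in> fst k" and k': "k' \<in> A"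
      "c 0 \<in> fst k'"
  defines "v \<equiv> curve_deriv 1 (snd k \<circ> c)" and "y \<equiv> snd k (c 0)" and "\<phi> \<equiv> transition k k'"
  shows "curve_deriv 1 (snd k' \<circ> c) = fderiv \<phi> y v"
    and "curve_deriv 2 (snd k' \<circ> c) = fderiv (\<lambda>z. fderiv \<phi> z v) y v + fderiv \<phi> y (curve_deriv 2 (snd k \<circ> c))"
proof -
  obtain \<epsilon> where \<epsilon>: "\<epsilon> > 0" "\<And>t. t \<in> {-\<epsilon><..<\<epsilon>} \<Longrightarrow> c t \<in> fst k" "smooth_on (snd k \<circ> c) {-\<epsilon><..<\<epsilon>}"
    using smooth_curve_in_chart[OF A c k] by blast
  obtain \<epsilon>' where \<epsilon>': "\<epsilon>' > 0" "\<And>t. t \<in> {-\<epsilon>'<..<\<epsilon>'} \<Longrightarrow> c t \<in> fst k'"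
    using smooth_curve_in_chart[OF A c k'] by blast
  \<comment> \<open>Each chart contains the curve only on an interval of its own, so the comparison
    takes place on the intersection.\<close>
  define S where "S = {-\<epsilon><..<\<epsilon>} \<inter> {-\<epsilon>'<..<\<epsilon>'}"
  have S: "open S" "0 \<in> S" "smooth_on (snd k \<circ> c) S"
    using \<epsilon> \<epsilon>' by (auto simp: S_def intro: smooth_on_subset)
  have in_ov: "(snd k \<circ> c) t \<in> overlap k k'" if "t \<in> S" for t
    using that \<epsilon>(2) \<epsilon>'(2) by (auto simp: S_def intro!: overlapI)
  have eq: "(snd k' \<circ> c) t = (\<phi> \<circ> (snd k \<circ> c)) t" if "t \<in> S" for t
    using that \<epsilon>(2) by (auto simp: S_def \<phi>_def transition_chart[OF A k(1)])
  note sm = smooth_on_transition[OF A k(1) k'(1), folded \<phi>_def]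
  have "curve_deriv 1 (snd k' \<circ> c) = curve_deriv 1 (\<phi> \<circ> (snd k \<circ> c))"
    by (rule curve_deriv_cong[OF S(1,2) eq])
  also have "\<dots> = fderiv \<phi> y v"
    using curve_deriv_1_compose[where \<gamma>="snd k \<circ> c", OF S(3,2) sm in_ov[OF S(2)]]
    by (simp only: y_def v_def o_apply)
  finally show "curve_deriv 1 (snd k' \<circ> c) = fderiv \<phi> y v" .
  have "curve_deriv 2 (snd k' \<circ> c) = curve_deriv 2 (\<phi> \<circ> (snd k \<circ> c))"
    by (rule curve_deriv_cong[OF S(1,2) eq])
  also have "\<dots> = fderiv (\<lambda>z. fderiv \<phi> z v) y v + fderiv \<phi> y (curve_deriv 2 (snd k \<circ> c))"
    using curve_deriv_2_compose[where \<gamma>="snd k \<circ> c", OF S(3,1,2) sm open_overlap[OF A k(1) k'(1)] in_ov]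
        by (simp only: y_def v_def o_apply)
  finally show "curve_deriv 2 (snd k' \<circ> c) = \<dots>" .
qed

section \<open>Jets as classes of curves\<close>

lemma jet_self: "smooth_curve A c \<Longrightarrow> c \<in> jet n A c"
  by (simp add: jet_def)

lemma jet_eqI: "c' \<in> jet n A c \<Longrightarrow> jet n A c' = jet n A c"
  by (auto simp: jet_def)

lemma rep_in_jet: "smooth_curve A c \<Longrightarrow> rep (jet n A c) \<in> jet n A c"
  unfolding rep_def by (metis jet_self someI)

lemma smooth_curve_rep: "smooth_curve A c \<Longrightarrow> smooth_curve A (rep (jet n A c))"
  using rep_in_jet[of A c n] by (simp add: jet_def)

lemma rep_0: "smooth_curve A c \<Longrightarrow> rep (jet n A c) 0 = c 0"
  using rep_in_jet[of A c n] by (simp add: jet_def)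

lemma jet_base_jet: "smooth_curve A c \<Longrightarrow> jet_base (jet n A c) = c 0"
  by (simp add: jet_base_def rep_0)

lemma jet_rep: "smooth_curve A c \<Longrightarrow> jet n A (rep (jet n A c)) = jet n A c"
  by (simp add: jet_eqI rep_in_jet)

lemma curve_deriv_rep:
  "smooth_curve A c \<Longrightarrow> k \<in> A \<Longrightarrow> c 0 \<in> fst k \<Longrightarrow> i \<le> n \<Longrightarrow>
    curve_deriv i (snd k \<circ> rep (jet n A c)) = curve_deriv i (snd k \<circ> c)"
  using rep_in_jet[of A c n] by (simp add: jet_def)

lemma jets_overE:
  assumes "j \<in> jets_over n A U"
  obtains c where "smooth_curve A c" "c 0 \<in> U" "j = jet n A c"
  using assms by (auto simp: jets_over_def)

lemma jets_over_jet: "smooth_curve A c \<Longrightarrow> jet n A c \<in> jets_over n A U \<longleftrightarrow> c 0 \<in> U"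
  by (auto simp: jets_over_def) (metis jet_base_jet)

lemma jets_over_jet_base: "j \<in> jets_over n A U \<Longrightarrow> j \<in> jets_over n A U' \<longleftrightarrow> jet_base j \<in> U'"
  using jets_overE[of j n A U] jets_over_jet jet_base_jet by metis

text \<open>A jet compares derivatives in all charts at once; by the chain rule agreement in a
  single chart suffices.\<close>

lemma jet_1_eq_in_chart:
  fixes A :: "('p, 'e::euclidean_space) atlas"
  assumes "smooth_atlas A" "smooth_curve A c" "smooth_curve A c'" "k \<in> A" "c 0 \<in> fst k" "c' 0 = c 0"
    and "curve_deriv 1 (snd k \<circ> c') = curve_deriv 1 (snd k \<circ> c)"
  shows "jet 1 A c' = jet 1 A c"
proof (rule jet_eqI)
  have "curve_deriv i (snd k' \<circ> c') = curve_deriv i (snd k' \<circ> c)" if i: "k' \<in> A" "c 0 \<in> fst k'" "i \<le> 1" for k' i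
  proof -
    consider "i = 0" | "i = 1" using i(3) by linarith
    then show ?thesis
      using curve_deriv_change(1)[OF assms(1,2,4,5) i(1,2)]
        curve_deriv_change(1)[OF assms(1,3,4) _ i(1)] assms(5-) i(2)
      by cases (simp_all add: curve_deriv_0 del: One_nat_def)
  qed
  then show "c' \<in> jet 1 A c"
    using assms by (simp add: jet_def)
qed

text \<open>The second derivative in another chart depends only on the first two derivatives in the
  given one, so a single chart decides here as well.\<close>

lemma jet_2_eq_in_chart:
  fixes A :: "('p, 'e::euclidean_space) atlas"
  assumes "smooth_atlas A" "smooth_curve A c" "smooth_curve A c'" "k \<in> A" "c 0 \<in> fst k" "c' 0 = c 0"
    and "curve_deriv 1 (snd k \<circ> c') = curve_deriv 1 (snd k \<circ> c)"
    and "curve_deriv 2 (snd k \<circ> c') = curve_deriv 2 (snd k \<circ> c)"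
  shows "jet 2 A c' = jet 2 A c"
proof (rule jet_eqI)
  have "curve_deriv i (snd k' \<circ> c') = curve_deriv i (snd k' \<circ> c)" if i: "k' \<in> A" "c 0 \<in> fst k'" "i \<le> 2" for k' i
  proof -
    consider "i = 0" | "i = 1" | "i = 2" using i(3) by linarith
    then show ?thesis
      using curve_deriv_change[OF assms(1,2,4,5) i(1,2)]
        curve_deriv_change[OF assms(1,3,4) _ i(1)] assms(5-) i(2)
      by cases (simp_all add: curve_deriv_0 del: One_nat_def)
  qed
  then show "c' \<in> jet 2 A c"
    using assms by (simp add: jet_def)
qed

text \<open>A curve prescribed in coordinates may leave the image of the chart; the preimage of that
  open image is a neighbourhood of 0 on which the curve lifts.\<close>

lemma chart_curve:
  fixes A :: "('p, 'e::euclidean_space) atlas"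
  assumes A: "smooth_atlas A" and k: "k \<in> A" and \<gamma>: "smooth_on \<gamma> S" "open S" "0 \<in> S" "\<gamma> 0 \<in> snd k ` fst k"
  shows "smooth_curve A (chart_inv k \<circ> \<gamma>)"
    and "curve_deriv n (snd k \<circ> (chart_inv k \<circ> \<gamma>)) = curve_deriv n \<gamma>"
proof -
  let ?J = "S \<inter> \<gamma> -` (snd k ` fst k)"
  have J: "open ?J" "0 \<in> ?J"
    using \<gamma> continuous_open_preimage[OF smooth_on_continuous_on[OF \<gamma>(1)] \<gamma>(2) open_chart[OF A k]] by auto
  have eq: "\<gamma> t = (snd k \<circ> (chart_inv k \<circ> \<gamma>)) t" if "t \<in> ?J" for t
    using that by (simp add: chart_of_inv)
  show "smooth_curve A (chart_inv k \<circ> \<gamma>)"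
    by (rule smooth_curveI[OF k J _ smooth_on_cong_imp[OF J(1) smooth_on_subset[OF \<gamma>(1)] eq]])
      (auto intro: chart_inv_in)
  show "curve_deriv n (snd k \<circ> (chart_inv k \<circ> \<gamma>)) = curve_deriv n \<gamma>"
    by (rule curve_deriv_cong[OF J]) (simp add: chart_of_inv)
qed

section \<open>Tangent vectors in coordinates\<close>

lemma coord_vector_eq_quadratic:
  "coord_vector A k v x = jet 1 A (chart_inv k \<circ> quadratic (snd k x) v 0)"
  by (simp add: coord_vector_def quadratic_def[abs_def] o_def)

context
  fixes A :: "('p, 'e::euclidean_space) atlas" and k
  assumes A: "smooth_atlas A" and k: "k \<in> A"
begin

lemma quadratic_curve:
  assumes "q \<in> snd k ` fst k"
  shows "smooth_curve A (chart_inv k \<circ> quadratic q v a)"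
    and "(chart_inv k \<circ> quadratic q v a) 0 = chart_inv k q"
    and "curve_deriv 1 (snd k \<circ> (chart_inv k \<circ> quadratic q v a)) = v"
    and "curve_deriv 2 (snd k \<circ> (chart_inv k \<circ> quadratic q v a)) = a"
proof -
  have 0: "quadratic q v a 0 \<in> snd k ` fst k" using assms by (simp add: quadratic_def)
  note c = chart_curve[OF A k smooth_on_quadratic open_UNIV UNIV_I 0]
  show "smooth_curve A (chart_inv k \<circ> quadratic q v a)" by (rule c)
  show "(chart_inv k \<circ> quadratic q v a) 0 = chart_inv k q" by (simp add: quadratic_def)
  show "curve_deriv 1 (snd k \<circ> (chart_inv k \<circ> quadratic q v a)) = v"
    unfolding c(2) by (rule curve_deriv_quadratic)
  show "curve_deriv 2 (snd k \<circ> (chart_inv k \<circ> quadratic q v a)) = a"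
    unfolding c(2) by (rule curve_deriv_quadratic)
qed

lemma jet_1_eq_coord_vector:
  assumes "smooth_curve A c" "c 0 \<in> fst k"
  shows "jet 1 A c = coord_vector A k (curve_deriv 1 (snd k \<circ> c)) (c 0)"
  unfolding coord_vector_eq_quadratic
  using assms quadratic_curve[of "snd k (c 0)" "curve_deriv 1 (snd k \<circ> c)" 0]
  by (intro jet_1_eq_in_chart[OF A _ _ k]) (simp_all add: inv_of_chart[OF A k] del: One_nat_def)

end

context
  fixes A :: "('p, 'e::euclidean_space) atlas" and k
  assumes A: "smooth_atlas A" and k: "k \<in> A"
begin

lemma coord_vector_in: "x \<in> fst k \<Longrightarrow> coord_vector A k v x \<in> tangent_space A x"
  using quadratic_curve(1,2)[OF A k, of "snd k x" v 0]
  by (auto simp: tangent_space_def coord_vector_eq_quadratic jets_over_jet inv_of_chart[OF A k] simp del: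
      One_nat_def)

lemma coord_vector_change:
  assumes "x \<in> fst k" "k' \<in> A" "x \<in> fst k'"
  shows "components k' (coord_vector A k v x) = fderiv (transition k k') (snd k x) v"
    and "coord_vector A k v x = coord_vector A k' (fderiv (transition k k') (snd k x) v) x"
proof -
  note c = quadratic_curve[OF A k, of "snd k x" v 0]
  have eq: "curve_deriv 1 (snd k' \<circ> (chart_inv k \<circ> quadratic (snd k x) v 0))
      = fderiv (transition k k') (snd k x) v"
    using curve_deriv_change(1)[OF A c(1) k _ assms(2)] c assms
        by (simp add: inv_of_chart[OF A k] del: One_nat_def)
  show "components k' (coord_vector A k v x) = fderiv (transition k k') (snd k x) v"
    unfolding components_def coord_vector_eq_quadratic
    using curve_deriv_rep[OF c(1) assms(2), of 1 1] assms c(2) eq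
        by (simp add: inv_of_chart[OF A k] del: One_nat_def)
  show "coord_vector A k v x = coord_vector A k' (fderiv (transition k k') (snd k x) v) x"
    unfolding coord_vector_eq_quadratic[of A k]
    using jet_1_eq_coord_vector[OF A assms(2) c(1)] c(2) assms eq
    by (simp add: inv_of_chart[OF A k] del: One_nat_def)
qed

lemma jet_base_coord_vector: "x \<in> fst k \<Longrightarrow> jet_base (coord_vector A k v x) = x"
  using quadratic_curve(1,2)[OF A k, of "snd k x" v 0]
  by (simp add: coord_vector_eq_quadratic jet_base_jet inv_of_chart[OF A k] del: One_nat_def)

lemma components_coord_vector: "x \<in> fst k \<Longrightarrow> components k (coord_vector A k v x) = v"
  using quadratic_curve[OF A k, of "snd k x" v 0]
  by (simp add: coord_vector_eq_quadratic components_def curve_deriv_rep[OF _ k] inv_of_chart[OF A k] del: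
      One_nat_def)

lemma coord_vector_inj: "x \<in> fst k \<Longrightarrow> coord_vector A k v x = coord_vector A k w x \<longleftrightarrow> v = w"
  using components_coord_vector by metis

lemma tangent_space_components:
  assumes "V \<in> tangent_space A x" "x \<in> fst k"
  shows "coord_vector A k (components k V) x = V"
proof -
  obtain c where "smooth_curve A c" "c 0 = x" "V = jet 1 A c"
    using assms(1) unfolding tangent_space_def by (auto elim: jets_overE)
  then show ?thesis
    using jet_1_eq_coord_vector[OF A k] components_coord_vector assms(2) by metis
qed

lemma tangent_space_eq: "x \<in> fst k \<Longrightarrow> tangent_space A x = range (\<lambda>v. coord_vector A k v x)"
  using tangent_space_components coord_vector_in
      by (metis (no_types, lifting) image_subset_iff rangeI subsetI subset_antisym)

lemma zero_vector_eq: "x \<in> fst k \<Longrightarrow> zero_vector A x = coord_vector A k 0 x"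
  by (simp add: zero_vector_def coord_vector_def inv_of_chart[OF A k])

end

context
  fixes A :: "('p, 'e::euclidean_space) atlas" and k
  assumes A: "smooth_atlas A" and k: "k \<in> A"
begin

text \<open>\<open>differential\<close> and \<open>tangent_map\<close> follow \<open>rep\<close>,
  which may be any member of the jet rather than the straight line defining it. Smoothness near 0,
  base point and velocity are what first-order computations require of it.\<close>

lemma rep_coord_vector:
  assumes "x \<in> fst k"
  obtains S where "open S" "0 \<in> S" "\<And>t. t \<in> S \<Longrightarrow> rep (coord_vector A k v x) t \<in> fst k"
    "smooth_on (snd k \<circ> rep (coord_vector A k v x)) S"
    "rep (coord_vector A k v x) 0 = x" "curve_deriv 1 (snd k \<circ> rep (coord_vector A k v x)) = v"
proof -
  note c = quadratic_curve[OF A k, of "snd k x" v 0]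
  let ?r = "rep (coord_vector A k v x)"
  have r: "smooth_curve A ?r" "?r 0 = x"
    using c assms by (simp_all add: coord_vector_eq_quadratic smooth_curve_rep rep_0 inv_of_chart[OF A k] del:
        One_nat_def)
  obtain \<epsilon> where "\<epsilon> > 0" "\<And>t. t \<in> {-\<epsilon><..<\<epsilon>} \<Longrightarrow> ?r t \<in> fst k" "smooth_on (snd k \<circ> ?r) {-\<epsilon><..<\<epsilon>}"
    using smooth_curve_in_chart[OF A r(1) k] r(2) assms by metis
  then show ?thesis
    using that[of "{-\<epsilon><..<\<epsilon>}"] r components_coord_vector[OF A k assms, of v] by (auto simp: components_def)
qed

lemma differential_coord_vector:
  assumes "x \<in> fst k" "smooth_on F (snd k ` fst k)" "\<And>p. p \<in> fst k \<Longrightarrow> f p = F (snd k p)"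
  shows "differential f (coord_vector A k v x) = fderiv F (snd k x) v"
proof -
  let ?r = "rep (coord_vector A k v x)"
  obtain S where S: "open S" "0 \<in> S" "\<And>t. t \<in> S \<Longrightarrow> ?r t \<in> fst k" "smooth_on (snd k \<circ> ?r) S"
    "?r 0 = x" "curve_deriv 1 (snd k \<circ> ?r) = v"
    using rep_coord_vector[OF assms(1)] by metis
  have "curve_deriv 1 (f \<circ> ?r) = curve_deriv 1 (F \<circ> (snd k \<circ> ?r))"
    by (rule curve_deriv_cong[OF S(1,2)]) (simp add: S(3) assms(3))
  also have "\<dots> = fderiv F (snd k x) v"
    using curve_deriv_1_compose[OF S(4,2) assms(2)] S assms(1) by (simp del: One_nat_def)
  finally show ?thesis by (simp add: differential_def)
qed

text \<open>The image of \<open>rep\<close> has to be a smooth curve in the target before its jet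
  can be named by components; the local expression \<open>F\<close> provides both this and the
  velocity.\<close>

lemma tangent_map_coord_vector:
  fixes B :: "('q, 'f::euclidean_space) atlas"
  assumes B: "smooth_atlas B" "l \<in> B"
    and "x \<in> fst k" "smooth_on F (snd k ` fst k)"
    and "\<And>p. p \<in> fst k \<Longrightarrow> f p \<in> fst l" "\<And>p. p \<in> fst k \<Longrightarrow> snd l (f p) = F (snd k p)"
  shows "tangent_map B f (coord_vector A k v x) = coord_vector B l (fderiv F (snd k x) v) (f x)"
proof -
  let ?r = "rep (coord_vector A k v x)"
  obtain S where S: "open S" "0 \<in> S" "\<And>t. t \<in> S \<Longrightarrow> ?r t \<in> fst k" "smooth_on (snd k \<circ> ?r) S"
    "?r 0 = x" "curve_deriv 1 (snd k \<circ> ?r) = v"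
    using rep_coord_vector[OF assms(3)] by metis
  have eq: "F ((snd k \<circ> ?r) t) = (snd l \<circ> (f \<circ> ?r)) t" if "t \<in> S" for t
    using S(3)[OF that] assms(6) by simp
  have "smooth_on (\<lambda>t. F ((snd k \<circ> ?r) t)) S"
    by (rule smooth_on_compose[OF S(1) assms(4) open_chart[OF A k] S(4)]) (use S(3) in auto)
  then have "smooth_on (snd l \<circ> (f \<circ> ?r)) S"
    by (rule smooth_on_cong_imp[OF S(1)]) (rule eq)
  then have sm: "smooth_curve B (f \<circ> ?r)"
    by (intro smooth_curveI[OF B(2) S(1,2)]) (use S(3) assms(5) in auto)
  have "curve_deriv 1 (snd l \<circ> (f \<circ> ?r)) = curve_deriv 1 (F \<circ> (snd k \<circ> ?r))"
    by (rule curve_deriv_cong[OF S(1,2)]) (simp add: S(3) assms(6))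
  also have "\<dots> = fderiv F (snd k x) v"
    using curve_deriv_1_compose[OF S(4,2) assms(4)] S assms(3) by (simp del: One_nat_def)
  finally have cd: "curve_deriv 1 (snd l \<circ> (f \<circ> ?r)) = fderiv F (snd k x) v" .
  have "jet 1 B (f \<circ> ?r) = coord_vector B l (curve_deriv 1 (snd l \<circ> (f \<circ> ?r))) ((f \<circ> ?r) 0)"
    by (rule jet_1_eq_coord_vector[OF B sm]) (use S assms in auto)
  then show ?thesis unfolding tangent_map_def cd using S(5) by simp
qed

end

section \<open>Product, tangent and cotangent atlases\<close>

lemma smooth_atlasI:
  assumes "\<And>k. k \<in> A \<Longrightarrow> inj_on (snd k) (fst k)" "\<And>k. k \<in> A \<Longrightarrow> open (snd k ` fst k)"
    and "\<And>k k'. k \<in> A \<Longrightarrow> k' \<in> A \<Longrightarrow> open (overlap k k')"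
    and "\<And>k k'. k \<in> A \<Longrightarrow> k' \<in> A \<Longrightarrow> \<exists>\<psi>. smooth_on \<psi> (overlap k k') \<and>
      (\<forall>x\<in>fst k \<inter> fst k'. snd k' x = \<psi> (snd k x))"
  shows "smooth_atlas A"
  unfolding smooth_atlas_def is_chart_def
  using assms smooth_transitionI by (metis IntI)

section \<open>Products of atlases\<close>

lemma prod_chart_sel: "fst (prod_chart k1 k2) = fst k1 \<times> fst k2"
    "snd (prod_chart k1 k2) = map_prod (snd k1) (snd k2)"
  by (simp_all add: prod_chart_def)

lemma prod_atlasE:
  assumes "k \<in> prod_atlas A1 A2"
  obtains k1 k2 where "k1 \<in> A1" "k2 \<in> A2" "k = prod_chart k1 k2"
  using assms by (auto simp: prod_atlas_def)

lemma prod_atlasI: "k1 \<in> A1 \<Longrightarrow> k2 \<in> A2 \<Longrightarrow> prod_chart k1 k2 \<in> prod_atlas A1 A2"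
  by (auto simp: prod_atlas_def)

lemma overlap_prod_chart: "overlap (prod_chart k1 k2) (prod_chart k1' k2') = overlap k1 k1' \<times> overlap k2 k2'"
  by (force simp: overlap_def prod_chart_sel)

context
  fixes A1 :: "('x, 'e::euclidean_space) atlas" and A2 :: "('y, 'f::euclidean_space) atlas"
  assumes A: "smooth_atlas A1" "smooth_atlas A2"
begin

lemma smooth_atlas_prod: "smooth_atlas (prod_atlas A1 A2)"
proof (rule smooth_atlasI)
  fix k assume "k \<in> prod_atlas A1 A2"
  then obtain k1 k2 where k: "k1 \<in> A1" "k2 \<in> A2" "k = prod_chart k1 k2" by (rule prod_atlasE)
  show "inj_on (snd k) (fst k)"
    using A k by (auto simp: prod_chart_sel smooth_atlas_def is_chart_def intro!: map_prod_inj_on)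
  show "open (snd k ` fst k)"
    using open_chart[OF A(1) k(1)] open_chart[OF A(2) k(2)] overlap_prod_chart[of k1 k2 k1 k2]
    by (simp add: overlap_self k(3) open_Times)
  fix k' assume "k' \<in> prod_atlas A1 A2"
  then obtain k1' k2' where k': "k1' \<in> A1" "k2' \<in> A2" "k' = prod_chart k1' k2'" by (rule prod_atlasE)
  note o1 = open_overlap[OF A(1) k(1) k'(1)] and o2 = open_overlap[OF A(2) k(2) k'(2)]
  show op: "open (overlap k k')"
    by (simp add: k(3) k'(3) overlap_prod_chart o1 o2 open_Times)
  let ?\<psi> = "\<lambda>y. (transition k1 k1' (fst y), transition k2 k2' (snd y))"
  have "smooth_on ?\<psi> (overlap k k')"
    by (intro smooth op smooth_on_compose[OF _ smooth_on_transition[OF A(1) k(1) k'(1)]]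
        smooth_on_compose[OF _ smooth_on_transition[OF A(2) k(2) k'(2)]] o1 o2)
      (auto simp: k(3) k'(3) overlap_prod_chart)
  moreover have "\<forall>x\<in>fst k \<inter> fst k'. snd k' x = ?\<psi> (snd k x)"
    by (auto simp: k(3) k'(3) prod_chart_sel transition_chart[OF A(1) k(1)] transition_chart[OF A(2) k(2)])
  ultimately show "\<exists>\<psi>. smooth_on \<psi> (overlap k k') \<and> (\<forall>x\<in>fst k \<inter> fst k'. snd k' x = \<psi> (snd k x))" by blast
qed

text \<open>Product charts have block diagonal Jacobians. Since \<open>chart_inv\<close> of a
  product chart is an abstract choice, the product form of the transition is established only on the
  overlap.\<close>

lemma fderiv_transition_prod:
  assumes k: "k1 \<in> A1" "k2 \<in> A2" and k': "k1' \<in> A1" "k2' \<in> A2"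
    and y: "y \<in> overlap (prod_chart k1 k2) (prod_chart k1' k2')"
  shows "fderiv (transition (prod_chart k1 k2) (prod_chart k1' k2')) y =
    (\<lambda>h. (fderiv (transition k1 k1') (fst y) (fst h), fderiv (transition k2 k2') (snd y) (snd h)))"
    (is "fderiv ?\<phi> y = ?D")
proof (rule fderiv_eqI)
  have "((\<lambda>y. (transition k1 k1' (fst y), transition k2 k2' (snd y))) has_derivative ?D) (at y)"
    using y[unfolded overlap_prod_chart]
    by (intro has_derivative_Pair
        has_derivative_compose[OF _ smooth_on_has_derivative[OF smooth_on_transition[OF A(1) k(1) k'(1)]]]
        has_derivative_compose[OF _ smooth_on_has_derivative[OF smooth_on_transition[OF A(2) k(2) k'(2)]]]
        has_derivative_fst has_derivative_snd has_derivative_ident) auto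
  then show "(?\<phi> has_derivative ?D) (at y)"
  proof (rule has_derivative_transform_within_open[OF _ _ y])
    show "open (overlap (prod_chart k1 k2) (prod_chart k1' k2'))"
      by (rule open_overlap[OF smooth_atlas_prod prod_atlasI[OF k] prod_atlasI[OF k']])
    fix z assume z: "z \<in> overlap (prod_chart k1 k2) (prod_chart k1' k2')"
    show "(transition k1 k1' (fst z), transition k2 k2' (snd z)) = ?\<phi> z"
      by (rule overlapE[OF smooth_atlas_prod prod_atlasI[OF k] z])
        (auto simp: prod_chart_sel transition_chart[OF A(1) k(1)] transition_chart[OF A(2) k(2)])
  qed
qed

end

section \<open>Tangent and cotangent bundles\<close>

context
  fixes A :: "('p, 'e::euclidean_space) atlas"
  assumes A: "smooth_atlas A"
begin

abbreviation "tch \<equiv> tangent_chart A"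
abbreviation "cch \<equiv> cotangent_chart A"

lemma tangent_chart_jet:
  assumes "k \<in> A" "smooth_curve A c" "c 0 \<in> fst k"
  shows "snd (tch k) (jet 1 A c) = (snd k (c 0), curve_deriv 1 (snd k \<circ> c))"
  using assms by (simp add: tangent_chart_def curve_deriv_rep rep_0 curve_deriv_0 del: One_nat_def)

lemma coord_vector_in_tangent_chart:
  assumes "k \<in> A" "x \<in> fst k"
  shows "coord_vector A k v x \<in> fst (tch k)"
    and "snd (tch k) (coord_vector A k v x) = (snd k x, v)"
  using quadratic_curve[OF A assms(1), of "snd k x" v 0] assms
    tangent_chart_jet[OF assms(1), of "chart_inv k \<circ> quadratic (snd k x) v 0"]
  by (simp_all add: coord_vector_eq_quadratic tangent_chart_def jets_over_jet inv_of_chart[OF A assms(1)] del: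
      One_nat_def)

lemma tangent_chartE:
  assumes "k \<in> A" "j \<in> fst (tch k)"
  obtains x v where "x \<in> fst k" "j = coord_vector A k v x" "jet_base j = x"
    "snd (tch k) j = (snd k x, v)"
proof -
  obtain c where c: "smooth_curve A c" "c 0 \<in> fst k" "j = jet 1 A c"
    using assms(2) by (auto simp: tangent_chart_def elim: jets_overE)
  have "jet_base j = c 0" using jet_base_jet[OF c(1)] c(3) by simp
  then show ?thesis
    using that[of "c 0" "curve_deriv 1 (snd k \<circ> c)"] c(2,3)
      jet_1_eq_coord_vector[OF A assms(1) c(1,2)] tangent_chart_jet[OF assms(1) c(1,2)] by simp
qed

lemma tangent_chart_mem_iff:
  "j \<in> fst (tch k) \<Longrightarrow> j \<in> fst (tch k') \<longleftrightarrow> jet_base j \<in> fst k'"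
  unfolding tangent_chart_def fst_conv by (rule jets_over_jet_base)

lemma overlap_tangent_chart:
  assumes "k \<in> A" "k' \<in> A"
  shows "overlap (tch k) (tch k') = overlap k k' \<times> UNIV"
proof -
  have "y \<in> overlap k k' \<times> UNIV" if y: "y \<in> overlap (tch k) (tch k')" for y
  proof -
    obtain j where j: "j \<in> fst (tch k)" "j \<in> fst (tch k')" "y = snd (tch k) j"
      using y by (auto simp: overlap_def)
    obtain x v where x: "x \<in> fst k" "jet_base j = x" "snd (tch k) j = (snd k x, v)"
      by (rule tangent_chartE[OF assms(1) j(1)])
    then have "x \<in> fst k'" using j(2) tangent_chart_mem_iff[OF j(1)] by simp
    then show ?thesis using x j(3) by (auto intro: overlapI)
  qed
  moreover have "(q, v) \<in> overlap (tch k) (tch k')" if q: "q \<in> overlap k k'" for q v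
  proof -
    obtain x where x: "x \<in> fst k" "x \<in> fst k'" "q = snd k x" using overlapE[OF A assms(1) q] by metis
    note j = coord_vector_in_tangent_chart[OF assms(1) x(1), of v]
    have "coord_vector A k v x \<in> fst (tch k')"
      using tangent_chart_mem_iff[OF j(1)] jet_base_coord_vector[OF A assms(1) x(1)] x(2) by simp
    from overlapI[OF j(1) this] show ?thesis by (simp add: j(2) x(3))
  qed
  ultimately show ?thesis by auto
qed

lemma tangent_chart_image: "k \<in> A \<Longrightarrow> snd (tch k) ` fst (tch k) = snd k ` fst k \<times> UNIV"
  using overlap_tangent_chart[of k k] by (simp add: overlap_self)

lemma tangent_chart_change:
  assumes "k \<in> A" "k' \<in> A" "j \<in> fst (tch k)" "j \<in> fst (tch k')"
  shows "snd (tch k') j = (\<lambda>(q, v). (transition k k' q, fderiv (transition k k') q v)) (snd (tch k) j)"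
proof -
  obtain x v where x: "x \<in> fst k" "j = coord_vector A k v x" "jet_base j = x"
    "snd (tch k) j = (snd k x, v)"
    by (rule tangent_chartE[OF assms(1,3)])
  then have "x \<in> fst k'" using assms(4) tangent_chart_mem_iff[OF assms(3), of k'] by simp
  then show ?thesis
    using x coord_vector_change(2)[OF A assms(1) x(1) assms(2)] coord_vector_in_tangent_chart(2)[OF assms(2)]
    by (simp add: transition_chart[OF A assms(1)])
qed

lemma inj_on_tangent_chart:
  assumes "k \<in> A"
  shows "inj_on (snd (tch k)) (fst (tch k))"
proof (rule inj_onI)
  fix i j assume ij: "i \<in> fst (tch k)" "j \<in> fst (tch k)"
    "snd (tch k) i = snd (tch k) j"
  obtain x v where x: "x \<in> fst k" "i = coord_vector A k v x" "snd (tch k) i = (snd k x, v)"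
    by (rule tangent_chartE[OF assms ij(1)])
  obtain y w where y: "y \<in> fst k" "j = coord_vector A k w y" "snd (tch k) j = (snd k y, w)"
    by (rule tangent_chartE[OF assms ij(2)])
  have "x = y" "v = w" using ij(3) x(3) y(3) inv_of_chart[OF A assms] x(1) y(1) by (auto, metis)
  then show "i = j" using x(2) y(2) by simp
qed

text \<open>The transition is the tangent map of the base transition; its fibre part is a derivative
  applied to a varying vector.\<close>

lemma smooth_atlas_tangent: "smooth_atlas (tangent_atlas A)"
proof (rule smooth_atlasI; unfold tangent_atlas_def; elim imageE; hypsubst)
  fix k assume k: "k \<in> A"
  show "inj_on (snd (tch k)) (fst (tch k))" by (rule inj_on_tangent_chart[OF k])
  show "open (snd (tch k) ` fst (tch k))"
    using open_chart[OF A k] tangent_chart_image[OF k] by (simp add: open_Times)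
  fix k' assume k': "k' \<in> A"
  show op: "open (overlap (tch k) (tch k'))"
    using open_overlap[OF A k k'] overlap_tangent_chart[OF k k'] by (simp add: open_Times)
  let ?\<psi> = "\<lambda>(q, v). (transition k k' q, fderiv (transition k k') q v)"
  have "smooth_on ?\<psi> (overlap (tch k) (tch k'))"
    unfolding split_beta
    by (intro smooth op smooth_on_compose[OF _ smooth_on_transition[OF A k k']] open_overlap[OF A k k']
        smooth_on_fderiv_apply[OF _ smooth_on_transition[OF A k k']])
      (auto simp: overlap_tangent_chart[OF k k'])
  then show "\<exists>\<psi>. smooth_on \<psi> (overlap (tch k) (tch k')) \<and>
      (\<forall>x\<in>fst (tch k) \<inter> fst (tch k'). snd (tch k') x = \<psi> (snd (tch k) x))"
    using tangent_chart_change[OF k k'] by blast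
qed

lemma tangent_chart_in: "k \<in> A \<Longrightarrow> tch k \<in> tangent_atlas A"
  by (simp add: tangent_atlas_def)

lemma chart_inv_tangent_chart:
  "k \<in> A \<Longrightarrow> q \<in> snd k ` fst k \<Longrightarrow> chart_inv (tch k) (q, v) = coord_vector A k v (chart_inv k q)"
  using inv_of_chart[OF smooth_atlas_tangent tangent_chart_in coord_vector_in_tangent_chart(1)]
    coord_vector_in_tangent_chart(2) chart_inv_in chart_of_inv by metis

text \<open>The covector with components \<open>p\<close> in the chart \<open>k\<close>.
  \<open>restrict\<close> makes it extensional, as \<open>cotangent_space\<close> demands, so that
  covectors agreeing on the tangent space are equal.\<close>

definition covector :: "('p, 'e) chart \<Rightarrow> 'e \<Rightarrow> 'p \<Rightarrow> 'p jet \<Rightarrow> real" where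
  "covector k p x = restrict (\<lambda>V. p \<bullet> components k V) (tangent_space A x)"

lemma covector_apply: "k \<in> A \<Longrightarrow> x \<in> fst k \<Longrightarrow> covector k p x (coord_vector A k v x) = p \<bullet> v"
  by (simp add: covector_def coord_vector_in[OF A] components_coord_vector[OF A])

lemma covector_in:
  assumes "k \<in> A" "x \<in> fst k"
  shows "covector k p x \<in> cotangent_space A x"
proof -
  have "linear (\<lambda>v. covector k p x (coord_vector A k' v x))" if "k' \<in> A" "x \<in> fst k'" for k'
  proof -
    have "covector k p x (coord_vector A k' v x) = p \<bullet> fderiv (transition k' k) (snd k' x) v" for v
      using coord_vector_change(1)[OF A that assms] coord_vector_in[OF A that] by (simp add: covector_def)
    then show ?thesis
      using linear_fderiv[OF smooth_on_transition[OF A that(1) assms(1)] overlapI[OF that(2) assms(2)]]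
      by (auto intro!: linearI simp: linear_add linear_scale inner_add_right)
  qed
  then show ?thesis by (auto simp: cotangent_space_def covector_def)
qed

lemma cotangent_apply:
  assumes "k \<in> A" "x \<in> fst k" "\<alpha> \<in> cotangent_space A x"
  shows "\<alpha> (coord_vector A k v x) = snd (snd (cch k) (x, \<alpha>)) \<bullet> v"
proof -
  have "linear (\<lambda>v. \<alpha> (coord_vector A k v x))" using assms by (simp add: cotangent_space_def)
  then have "\<alpha> (coord_vector A k v x) = (\<Sum>b\<in>Basis. (v \<bullet> b) *\<^sub>R \<alpha> (coord_vector A k b x))"
    by (rule linear_eq_sum_Basis)
  also have "\<dots> = snd (snd (cch k) (x, \<alpha>)) \<bullet> v"
    unfolding cotangent_chart_def snd_conv prod.case inner_sum_left inner_scaleR_left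
    by (intro sum.cong) (simp_all add: inner_commute)
  finally show ?thesis .
qed

lemma covector_of_chart:
  assumes "k \<in> A" "x \<in> fst k" "\<alpha> \<in> cotangent_space A x"
  shows "covector k (snd (snd (cch k) (x, \<alpha>))) x = \<alpha>"
proof (rule extensionalityI)
  show "covector k (snd (snd (cch k) (x, \<alpha>))) x \<in> extensional (tangent_space A x)"
    by (simp add: covector_def)
  show "\<alpha> \<in> extensional (tangent_space A x)" using assms by (simp add: cotangent_space_def)
  fix V assume "V \<in> tangent_space A x"
  then show "covector k (snd (snd (cch k) (x, \<alpha>))) x V = \<alpha> V"
    using tangent_space_components[OF A assms(1) _ assms(2)] covector_apply[OF assms(1,2)] cotangent_apply[OF
        assms] by metis
qed

lemma cotangent_chart_covector:
  assumes "k \<in> A" "x \<in> fst k"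
  shows "snd (cch k) (x, covector k p x) = (snd k x, p)"
  by (simp add: cotangent_chart_def covector_apply[OF assms] euclidean_representation)

lemma cotangent_chart_mem_iff: "m \<in> fst (cch k) \<longleftrightarrow> fst m \<in> fst k \<and> snd m \<in> cotangent_space A (fst m)"
  by (auto simp: cotangent_chart_def)

lemma fst_cotangent_chart: "fst (snd (cch k) m) = snd k (fst m)"
  by (simp add: cotangent_chart_def split_beta)

lemma inj_on_cotangent_chart:
  assumes "k \<in> A"
  shows "inj_on (snd (cch k)) (fst (cch k))"
proof (rule inj_onI)
  fix m n assume mn: "m \<in> fst (cch k)" "n \<in> fst (cch k)"
    "snd (cch k) m = snd (cch k) n"
  have *: "fst m = fst n"
    using mn fst_cotangent_chart[of k m] fst_cotangent_chart[of k n] inv_of_chart[OF A assms]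
    by (metis cotangent_chart_mem_iff)
  have "snd m = snd n"
    using covector_of_chart[OF assms, of "fst m" "snd m"] covector_of_chart[OF assms, of "fst n" "snd n"] mn *
    by (metis cotangent_chart_mem_iff prod.collapse)
  with * show "m = n" by (simp add: prod_eq_iff)
qed

lemma overlap_cotangent_chart:
  assumes "k \<in> A"
  shows "overlap (cch k) (cch k') = overlap k k' \<times> UNIV"
proof -
  have "y \<in> overlap k k' \<times> UNIV" if "y \<in> overlap (cch k) (cch k')" for y
    using that unfolding overlap_def[of "cch k"]
    by (auto simp: cotangent_chart_mem_iff fst_cotangent_chart mem_Times_iff intro!: overlapI)
  moreover have "(q, p) \<in> overlap (cch k) (cch k')" if q: "q \<in> overlap k k'" for q p
  proof -
    obtain x where x: "x \<in> fst k" "x \<in> fst k'" "q = snd k x" using overlapE[OF A assms q] by metis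
    have "(x, covector k p x) \<in> fst (cch k)" "(x, covector k p x) \<in> fst (cch k')"
      using covector_in[OF assms x(1)] x by (simp_all add: cotangent_chart_mem_iff)
    from overlapI[OF this] show ?thesis by (simp add: cotangent_chart_covector[OF assms x(1)] x(3))
  qed
  ultimately show ?thesis by auto
qed

text \<open>Stated as invariance of the pairing, covariance of momenta involves only the forward
  Jacobian and no inverse matrix.\<close>

lemma cotangent_chart_change:
  assumes "k \<in> A" "k' \<in> A" "m \<in> fst (cch k)" "m \<in> fst (cch k')"
  shows "snd (snd (cch k) m) \<bullet> v =
    snd (snd (cch k') m) \<bullet> fderiv (transition k k') (snd k (fst m)) v"
  using assms cotangent_apply[OF assms(1), of "fst m" "snd m" v]
    cotangent_apply[OF assms(2), of "fst m" "snd m" "fderiv (transition k k') (snd k (fst m)) v"]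
    coord_vector_change(2)[OF A assms(1) _ assms(2), of "fst m" v]
  by (simp add: cotangent_chart_mem_iff)

lemma smooth_atlas_cotangent: "smooth_atlas (cotangent_atlas A)"
proof (rule smooth_atlasI; unfold cotangent_atlas_def; elim imageE; hypsubst)
  fix k assume k: "k \<in> A"
  show "inj_on (snd (cch k)) (fst (cch k))" by (rule inj_on_cotangent_chart[OF k])
  show "open (snd (cch k) ` fst (cch k))"
    using open_chart[OF A k] overlap_cotangent_chart[OF k, of k] by (simp add: overlap_self open_Times)
  fix k' assume k': "k' \<in> A"
  show op: "open (overlap (cch k) (cch k'))"
    using open_overlap[OF A k k'] overlap_cotangent_chart[OF k] by (simp add: open_Times)
  \<comment> \<open>The components in \<open>k'\<close> arise by pairing the old ones with the
    columns of the Jacobian of the reverse transition, taken at the transformed point.\<close>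
  let ?\<psi> = "\<lambda>y. (transition k k' (fst y), \<Sum>b\<in>Basis.
    (snd y \<bullet> fderiv (transition k' k) (transition k k' (fst y)) b) *\<^sub>R b)"
  let ?O = "overlap (cch k) (cch k')"
  have 1: "smooth_on (\<lambda>y. transition k k' (fst y)) ?O"
    by (rule smooth_on_compose[OF op smooth_on_transition[OF A k k'] open_overlap[OF A k k'] smooth_on_fst[OF
        op smooth_on_ident]])
      (auto simp: overlap_cotangent_chart[OF k])
  have in_ov: "transition k k' (fst y) \<in> overlap k' k" if "y \<in> ?O" for y
  proof -
    have "fst y \<in> overlap k k'" using that by (auto simp: overlap_cotangent_chart[OF k])
    then show ?thesis by (rule overlapE[OF A k]) (auto intro: overlapI)
  qed
  have 2: "smooth_on (\<lambda>y. fderiv (transition k' k) (transition k k' (fst y)) b) ?O" for b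
    by (rule smooth_on_compose[OF op smooth_on_fderiv[OF smooth_on_transition[OF A k' k]] open_overlap[OF A k'
        k] 1 in_ov])
  have "smooth_on ?\<psi> ?O"
    by (intro smooth op 1 2)
  moreover have "snd (cch k') m = ?\<psi> (snd (cch k) m)"
    if m: "m \<in> fst (cch k)" "m \<in> fst (cch k')" for m
  proof (rule prod_eqI)
    have x: "fst m \<in> fst k" using m by (simp add: cotangent_chart_mem_iff)
    then show "fst (snd (cch k') m) = fst (?\<psi> (snd (cch k) m))"
      by (simp add: fst_cotangent_chart transition_chart[OF A k])
    have "snd (snd (cch k') m) \<bullet> b =
        snd (snd (cch k) m) \<bullet> fderiv (transition k' k) (snd k' (fst m)) b" for b
      by (rule cotangent_chart_change[OF k' k m(2,1)])
    then show "snd (snd (cch k') m) = snd (?\<psi> (snd (cch k) m))"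
      using euclidean_representation[of "snd (snd (cch k') m)"]
      by (simp add: fst_cotangent_chart transition_chart[OF A k x])
  qed
  ultimately show "\<exists>\<psi>. smooth_on \<psi> (overlap (cch k) (cch k')) \<and>
      (\<forall>x\<in>fst (cch k) \<inter> fst (cch k'). snd (cch k') x = \<psi> (snd (cch k) x))"
    by (intro exI[of _ ?\<psi>]) blast
qed

lemma cotangent_chart_in: "k \<in> A \<Longrightarrow> cch k \<in> cotangent_atlas A"
  by (simp add: cotangent_atlas_def)

text \<open>The bundle projection is the linear map \<open>fst\<close> in coordinates, so it sends
  \<open>w\<close> to the base vector \<open>fst w\<close>, with which the momentum is
  paired.\<close>

lemma tautological_form_coord_vector:
  assumes "k \<in> A" "m \<in> fst (cch k)"
  shows "tautological_form A (coord_vector (cotangent_atlas A) (cch k) w m) =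
    snd (snd (cch k) m) \<bullet> fst w"
proof -
  note T = smooth_atlas_cotangent cotangent_chart_in[OF assms(1)]
  have "smooth_on fst (snd (cch k) ` fst (cch k))"
    by (rule smooth_on_fst[OF open_chart[OF T] smooth_on_ident])
  moreover have "fderiv fst y = fst" for y :: "'e \<times> 'e"
    by (rule fderiv_eqI[OF has_derivative_fst[OF has_derivative_ident]])
  ultimately have "tangent_map A fst (coord_vector (cotangent_atlas A) (cch k) w m)
      = coord_vector A k (fst w) (fst m)"
    using tangent_map_coord_vector[OF T A assms, of fst fst w]
    by (simp add: fst_cotangent_chart cotangent_chart_mem_iff)
  then show ?thesis
    using assms cotangent_apply[OF assms(1), of "fst m" "snd m"]
    by (simp add: tautological_form_def jet_base_coord_vector[OF T] cotangent_chart_mem_iff)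
qed

text \<open>The tautological form is \<open>p\<^sub>i dx\<^sup>i\<close> in every chart, so the two sides agree in the chart selected by
  \<^const>\<open>exterior_derivative1\<close>; the change to the chart \<open>k\<close> uses the symmetry of the second
  derivative of the transition map.\<close>

lemma canonical_form_coord_vector:
  fixes u u' p p' :: 'e
  assumes k: "k \<in> A" and m: "m \<in> fst (cch k)"
  defines "V \<equiv> coord_vector (cotangent_atlas A) (cch k) (u, p) m"
    and "W \<equiv> coord_vector (cotangent_atlas A) (cch k) (u', p') m"
  shows "canonical_form A V W = u \<bullet> p' - u' \<bullet> p"
proof -
  let ?T = "cotangent_atlas A"
  \<comment> \<open>The unspecified chart in which \<open>exterior_derivative1\<close> evaluates; it
    need not be \<open>cch k\<close>.\<close>
  define l where "l = (SOME k. k \<in> ?T \<and> jet_base V \<in> fst k)"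
  note T = smooth_atlas_cotangent cotangent_chart_in
  have base: "jet_base V = m"
    unfolding V_def by (rule jet_base_coord_vector[OF T(1) T(2)[OF k] m])
  have "l \<in> ?T \<and> jet_base V \<in> fst l"
    unfolding l_def by (rule someI[of _ "cch k"]) (simp add: base T(2)[OF k] m)
  then obtain k' where k': "k' \<in> A" and l: "l = cch k'" and m': "m \<in> fst (cch k')"
    by (auto simp: cotangent_atlas_def base)
  define x \<phi> \<tau> y v w where "x = snd k (fst m)" and "\<phi> = transition k k'"
    and "\<tau> = transition (cch k) (cch k')"
    and "y = snd (cch k) m" and "v = components l V" and "w = components l W"
  have vw: "v = fderiv \<tau> y (u, p)" "w = fderiv \<tau> y (u', p')"
    unfolding v_def w_def l V_def W_def \<tau>_def y_def
    by (rule coord_vector_change(1)[OF T(1) T(2)[OF k] m T(2)[OF k'] m'])+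
  have form: "fderiv (\<lambda>z. form1_in_chart ?T l (tautological_form A) z a) (snd l m) b = snd b \<bullet> fst a" for a b
  proof -
    have op: "open (snd l ` fst l)" unfolding l by (rule open_chart[OF T(1) T(2)[OF k']])
    have "form1_in_chart ?T l (tautological_form A) z a = snd z \<bullet> fst a" if z: "z \<in> snd l ` fst l" for z
    proof -
      obtain n where n: "n \<in> fst (cch k')" "z = snd (cch k') n"
        using z by (auto simp: l)
      then show ?thesis
        by (simp add: form1_in_chart_def l inv_of_chart[OF T(1) T(2)[OF k'] n(1)]
            tautological_form_coord_vector[OF k' n(1)])
    qed
    moreover have "smooth_on (\<lambda>z. snd z \<bullet> fst a) (snd l ` fst l)" by (intro smooth op)
    ultimately have "fderiv (\<lambda>z. snd z \<bullet> fst a) (snd l m)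
        = fderiv (\<lambda>z. form1_in_chart ?T l (tautological_form A) z a) (snd l m)"
      using m' by (intro fderiv_cong[OF op]) (auto simp: l)
    moreover have "fderiv (\<lambda>z. snd z \<bullet> fst a) (snd l m) = (\<lambda>b. snd b \<bullet> fst a)"
      by (intro fderiv_eqI has_derivative_inner_left has_derivative_snd has_derivative_ident)
    ultimately show ?thesis by metis
  qed
  have "canonical_form A V W = snd w \<bullet> fst v - snd v \<bullet> fst w"
    unfolding canonical_form_def exterior_derivative1_def Let_def
    by (fold l_def, fold v_def w_def) (simp add: base form)
  moreover
  note op = open_overlap[OF T(1) T(2)[OF k] T(2)[OF k'], of]
  have y: "y \<in> overlap (cch k) (cch k')"
    unfolding y_def by (rule overlapI[OF m m'])
  have fy: "fst y = x" by (simp add: y_def x_def fst_cotangent_chart)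
  have xo: "x \<in> overlap k k'" using m m' unfolding x_def
      by (intro overlapI) (auto simp: cotangent_chart_mem_iff)
  have \<tau>: "(\<tau> has_derivative fderiv \<tau> y) (at y)"
    unfolding \<tau>_def by (rule smooth_on_has_derivative[OF smooth_on_transition[OF T(1) T(2)[OF k] T(2)[OF k']]
        y])
  have \<phi>: "smooth_on \<phi> (overlap k k')" unfolding \<phi>_def by (rule smooth_on_transition[OF A k k'])
  \<comment> \<open>The momentum part of \<tau> is described implicitly, by invariance of the
    pairing on the whole overlap. Differentiating this identity avoids a formula for the inverse
    Jacobian.\<close>
  have pt: "fst (\<tau> z) = \<phi> (fst z) \<and> snd z \<bullet> a = snd (\<tau> z) \<bullet> fderiv \<phi> (fst z) a"
    if z: "z \<in> overlap (cch k) (cch k')" for z a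
  proof -
    obtain n where n: "n \<in> fst (cch k)" "n \<in> fst (cch k')"
      "z = snd (cch k) n" "\<tau> z = snd (cch k') n"
      unfolding \<tau>_def by (rule overlapE[OF T(1) T(2)[OF k] z])
    then show ?thesis
      using cotangent_chart_change[OF k k' n(1,2), of a]
      by (simp add: \<phi>_def fst_cotangent_chart cotangent_chart_mem_iff transition_chart[OF A k])
  qed
  have 1: "fst (fderiv \<tau> y h) = fderiv \<phi> x (fst h)" for h
  proof -
    have "((\<lambda>z. \<phi> (fst z)) has_derivative (\<lambda>h. fderiv \<phi> (fst y) (fst h))) (at y)"
      by (rule has_derivative_compose[OF has_derivative_fst[OF has_derivative_ident]])
        (use fy xo in \<open>simp add: smooth_on_has_derivative[OF \<phi>]\<close>)
    then have "((\<lambda>z. fst (\<tau> z)) has_derivative (\<lambda>h. fderiv \<phi> (fst y) (fst h))) (at y)"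
      by (rule has_derivative_transform_within_open[OF _ op y]) (use pt in auto)
    then have "(\<lambda>h. fst (fderiv \<tau> y h)) = (\<lambda>h. fderiv \<phi> (fst y) (fst h))"
      by (rule has_derivative_unique[OF has_derivative_fst[OF \<tau>]])
    then show ?thesis using fy by metis
  qed
  have 2: "snd h \<bullet> a = snd (\<tau> y) \<bullet> fderiv (\<lambda>z. fderiv \<phi> z a) x (fst h) + snd (fderiv \<tau> y h) \<bullet> fderiv \<phi> x a"
      for h a
  proof -
    have "((\<lambda>z. snd (\<tau> z) \<bullet> fderiv \<phi> (fst z) a) has_derivative
        (\<lambda>h. snd (\<tau> y) \<bullet> fderiv (\<lambda>z. fderiv \<phi> z a) (fst y) (fst h) + snd (fderiv \<tau> y h)
            \<bullet> fderiv \<phi> (fst y) a)) (at y)"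
      by (intro has_derivative_inner has_derivative_snd[OF \<tau>] has_derivative_compose[OF has_derivative_fst[OF
          has_derivative_ident]])
        (use fy xo in \<open>simp add: smooth_on_has_derivative[OF smooth_on_fderiv[OF \<phi>]]\<close>)
    then have "((\<lambda>z. snd z \<bullet> a) has_derivative
        (\<lambda>h. snd (\<tau> y) \<bullet> fderiv (\<lambda>z. fderiv \<phi> z a) (fst y) (fst h) + snd (fderiv \<tau> y h)
            \<bullet> fderiv \<phi> (fst y) a)) (at y)"
      by (rule has_derivative_transform_within_open[OF _ op y]) (use pt in metis)
    then have "(\<lambda>h. snd h \<bullet> a) =
        (\<lambda>h. snd (\<tau> y) \<bullet> fderiv (\<lambda>z. fderiv \<phi> z a) (fst y) (fst h) + snd (fderiv \<tau> y h) \<bullet> fderiv \<phi> (fst y) a)"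
      by (rule has_derivative_unique[OF has_derivative_inner_left[OF has_derivative_snd[OF
          has_derivative_ident]]])
    then show ?thesis using fy by metis
  qed
  have "fderiv (\<lambda>z. fderiv \<phi> z u) x u' = fderiv (\<lambda>z. fderiv \<phi> z u') x u"
    by (rule fderiv_symmetric[OF \<phi> open_overlap[OF A k k'] xo])
  \<comment> \<open>The differentiated identity is used for each of the two vectors, paired with the
    base part of the other one; subtraction removes the second derivatives.\<close>
  then have "snd w \<bullet> fst v - snd v \<bullet> fst w = u \<bullet> p' - u' \<bullet> p"
    using 2[of "(u', p')" u] 2[of "(u, p)" u'] by (simp add: vw 1 inner_commute)
  ultimately show ?thesis by simp
qed

end

section \<open>Second-order jets\<close>

context
  fixes A :: "('p, 'e::euclidean_space) atlas" and k
  assumes A: "smooth_atlas A" and k: "k \<in> A"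
begin

lemma jet2_chart_quadratic:
  assumes "q \<in> snd k ` fst k"
  shows "jet 2 A (chart_inv k \<circ> quadratic q v a) \<in> fst (jet2_chart A k)"
    and "snd (jet2_chart A k) (jet 2 A (chart_inv k \<circ> quadratic q v a)) = (q, v, a)"
    and "jet_base (jet 2 A (chart_inv k \<circ> quadratic q v a)) = chart_inv k q"
proof -
  note c = quadratic_curve[OF A k assms, of v a]
  have 0: "(chart_inv k \<circ> quadratic q v a) 0 \<in> fst k" using c(2) chart_inv_in[OF assms] by metis
  show "jet 2 A (chart_inv k \<circ> quadratic q v a) \<in> fst (jet2_chart A k)"
    using 0 c(1) by (simp add: jet2_chart_def jets_over_jet del: o_apply)
  show "snd (jet2_chart A k) (jet 2 A (chart_inv k \<circ> quadratic q v a)) = (q, v, a)"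
    using curve_deriv_rep[where c="chart_inv k \<circ> quadratic q v a" and n=2, OF c(1) k 0] c
      rep_0[where n=2, OF c(1)] chart_of_inv[OF assms]
    by (simp add: jet2_chart_def curve_deriv_0 del: One_nat_def)
  show "jet_base (jet 2 A (chart_inv k \<circ> quadratic q v a)) = chart_inv k q"
    using jet_base_jet[OF c(1)] c(2) by simp
qed

lemma jet2_chart_rep:
  assumes "j \<in> fst (jet2_chart A k)"
  shows "smooth_curve A (rep j)" "rep j 0 \<in> fst k" "jet 2 A (rep j) = j" "jet_base j = rep j 0"
    and "snd (jet2_chart A k) j = (snd k (jet_base j), curve_deriv 1 (snd k \<circ> rep j), curve_deriv 2 (snd k \<circ>
        rep j))"
proof -
  obtain c where c: "smooth_curve A c" "c 0 \<in> fst k" "j = jet 2 A c"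
    using assms by (auto simp: jet2_chart_def elim: jets_overE)
  show "smooth_curve A (rep j)" "rep j 0 \<in> fst k" "jet 2 A (rep j) = j" "jet_base j = rep j 0"
    using c by (simp_all add: smooth_curve_rep rep_0 jet_rep jet_base_def)
  show "snd (jet2_chart A k) j = (snd k (jet_base j), curve_deriv 1 (snd k \<circ> rep j), curve_deriv 2 (snd k \<circ> rep
      j))"
    by (simp add: jet2_chart_def curve_deriv_0 jet_base_def)
qed

lemma inj_on_jet2_chart: "inj_on (snd (jet2_chart A k)) (fst (jet2_chart A k))"
proof (rule inj_onI)
  fix i j assume i: "i \<in> fst (jet2_chart A k)" and j: "j \<in> fst (jet2_chart A k)"
    and eq: "snd (jet2_chart A k) i = snd (jet2_chart A k) j"
  have base: "rep i 0 = rep j 0"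
    using eq jet2_chart_rep[OF i] jet2_chart_rep[OF j] inv_of_chart[OF A k] by (metis prod.inject)
  have "jet 2 A (rep i) = jet 2 A (rep j)"
    using eq jet2_chart_rep[OF i] jet2_chart_rep[OF j] base
    by (intro jet_2_eq_in_chart[OF A _ _ k]) simp_all
  then show "i = j" using jet2_chart_rep(3)[OF i] jet2_chart_rep(3)[OF j] by simp
qed

lemma jet2_chart_mem_iff:
  "j \<in> fst (jet2_chart A k) \<Longrightarrow> j \<in> fst (jet2_chart A k') \<longleftrightarrow> jet_base j \<in> fst k'"
  unfolding jet2_chart_def fst_conv by (rule jets_over_jet_base)

lemma jet21_coord_vector:
  assumes "j \<in> fst (jet2_chart A k)" "snd (jet2_chart A k) j = (q, v, a)"
  shows "jet21 A j = coord_vector A k v (jet_base j)"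
  using jet2_chart_rep[OF assms(1)] assms(2) jet_1_eq_coord_vector[OF A k, of "rep j"]
  by (simp add: jet21_def del: One_nat_def)

lemma jet21_chart:
  assumes "j \<in> fst (jet2_chart A k)" "snd (jet2_chart A k) j = (q, v, a)"
  shows "jet21 A j \<in> fst (tangent_chart A k)" "snd (tangent_chart A k) (jet21 A j) = (q, v)"
    "jet_base (jet21 A j) = jet_base j"
  using jet2_chart_rep[OF assms(1)] assms(2) jet21_coord_vector[OF assms]
    coord_vector_in_tangent_chart[OF A k, of "jet_base j" v] jet_base_coord_vector[OF A k, of "jet_base j" v]
  by (simp_all del: One_nat_def)

lemma jet2_chart_change:
  assumes "j \<in> fst (jet2_chart A k)" "k' \<in> A" "jet_base j \<in> fst k'" "snd (jet2_chart A k) j = (q, v, a)"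
  shows "snd (jet2_chart A k') j = (transition k k' q, fderiv (transition k k') q v,
      fderiv (\<lambda>z. fderiv (transition k k') z v) q v + fderiv (transition k k') q a)"
proof -
  have j': "j \<in> fst (jet2_chart A k')" using assms jet2_chart_mem_iff by blast
  note r = jet2_chart_rep[OF assms(1)]
  have "snd (jet2_chart A k') j = (snd k' (jet_base j), curve_deriv 1 (snd k' \<circ> rep j), curve_deriv 2 (snd k' \<circ>
      rep j))"
    by (simp add: jet2_chart_def curve_deriv_0 jet_base_def)
  then show ?thesis
    using curve_deriv_change[OF A r(1) k r(2) assms(2)] assms(3,4) r transition_chart[OF A k r(2), of k']
    by (simp del: One_nat_def)
qed

text \<open>The curve of 1-jets along the representative has position and velocity as coordinates;
  its own velocity at 0 is therefore the pair of velocity and acceleration.\<close>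

lemma jet2_embed_coord_vector:
  assumes "j \<in> fst (jet2_chart A k)" "snd (jet2_chart A k) j = (q, v, a)"
  shows "jet2_embed A j = coord_vector (tangent_atlas A) (tangent_chart A k) (v, a) (jet21 A j)"
proof -
  note r = jet2_chart_rep[OF assms(1)]
  define c where "c = rep j"
  obtain \<epsilon> where \<epsilon>: "\<epsilon> > 0" "\<And>t. t \<in> {-\<epsilon><..<\<epsilon>} \<Longrightarrow> c t \<in> fst k" "smooth_on (snd k \<circ> c) {-\<epsilon><..<\<epsilon>}"
    using smooth_curve_in_chart[OF A r(1) k r(2)] unfolding c_def by blast
  let ?I = "{-\<epsilon><..<\<epsilon>}" and ?v = "\<lambda>t. vector_derivative (snd k \<circ> c) (at t)"
  let ?d = "\<lambda>t. jet 1 A (\<lambda>s. c (t + s))"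
  have d: "?d t \<in> fst (tangent_chart A k) \<and> snd (tangent_chart A k) (?d t) = ((snd k \<circ> c) t, ?v t)" if t: "t
      \<in> ?I" for t
  proof -
    \<comment> \<open>The translated interval: \<open>t + s\<close> lies in \<open>?I\<close>
      exactly when \<open>s\<close> lies in \<open>?S\<close>, so the shifted curve is smooth near
      \<open>s = 0\<close>.\<close>
    let ?S = "{-\<epsilon> - t<..<\<epsilon> - t}"
    have "smooth_on (\<lambda>s. t + s) ?S" by (intro smooth) simp
    then have sm: "smooth_on (snd k \<circ> (\<lambda>s. c (t + s))) ?S"
      unfolding o_def
      by (intro smooth_on_compose[OF _ \<epsilon>(3)[unfolded o_def], where f="\<lambda>s. t + s"]) auto
    have cu: "smooth_curve A (\<lambda>s. c (t + s))"
      by (rule smooth_curveI[OF k _ _ _ sm]) (use t \<epsilon> in auto)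
    have "curve_deriv 1 (snd k \<circ> (\<lambda>s. c (t + s))) = ?v t"
    proof -
      have "((\<lambda>s. t + s) has_vector_derivative 1) (at 0)"
        by (auto intro!: derivative_eq_intros)
      moreover have "((snd k \<circ> c) has_vector_derivative ?v t) (at (t + 0))"
        using smooth_on_has_derivative_scaleR[OF \<epsilon>(3) t] by (simp add: has_vector_derivative_def)
      ultimately have "((snd k \<circ> c) \<circ> (\<lambda>s. t + s) has_vector_derivative 1 *\<^sub>R ?v t) (at 0)"
        by (rule vector_diff_chain_at)
      then show ?thesis unfolding curve_deriv_1 by (intro vector_derivative_at) (simp add: o_def)
    qed
    then show ?thesis
      using tangent_chart_jet[OF A k cu] \<epsilon>(2)[OF t] cu
      by (simp add: tangent_chart_def jets_over_jet del: One_nat_def)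
  qed
  have sm: "smooth_on (\<lambda>t. ((snd k \<circ> c) t, ?v t)) ?I"
    by (intro smooth \<epsilon>(3) smooth_on_vector_derivative) auto
  have cu: "smooth_curve (tangent_atlas A) ?d"
  proof (rule smooth_curveI[OF tangent_chart_in[OF A k], of ?I])
    show "smooth_on (snd (tangent_chart A k) \<circ> ?d) ?I"
      by (rule smooth_on_cong_imp[OF _ sm]) (use d in auto)
  qed (use d \<epsilon> in auto)
  have 0: "?d 0 = jet21 A j" by (simp add: jet21_def c_def)
  have I0: "open ?I" "0 \<in> ?I" using \<epsilon>(1) by auto
  have "curve_deriv 1 (snd (tangent_chart A k) \<circ> ?d) = curve_deriv 1 (\<lambda>t. ((snd k \<circ> c) t, ?v t))"
    by (rule curve_deriv_cong[OF I0]) (use d in auto)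
  also have "\<dots> = (?v 0, vector_derivative ?v (at 0))"
    unfolding curve_deriv_1
    using smooth_on_has_derivative_scaleR[OF \<epsilon>(3) I0(2)]
      smooth_on_has_derivative_scaleR[OF smooth_on_vector_derivative[OF I0(1) \<epsilon>(3)] I0(2)]
    by (intro vector_derivative_at has_vector_derivative_Pair) (simp_all add: has_vector_derivative_def o_def)
  also have "\<dots> = (v, a)" using r(5)[unfolded curve_deriv_1 curve_deriv_2] assms(2) by (simp add: c_def)
  finally have "jet 1 (tangent_atlas A) ?d = coord_vector (tangent_atlas A) (tangent_chart A k) (v, a) (jet21 A
      j)"
    using jet_1_eq_coord_vector[OF smooth_atlas_tangent[OF A] tangent_chart_in[OF A k] cu] d[OF I0(2)] 0 by simp
  then show ?thesis by (simp add: jet2_embed_def c_def)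
qed

end


section \<open>The Euler--Lagrange operator\<close>

text \<open>Linearity in \<open>b\<close> is hidden because \<open>b\<close> sits in the inner
  derivative. Symmetry of second derivatives moves it to the outer one, so that arbitrary vectors
  may replace basis vectors in the pairing.\<close>

lemma euler_lagrange_inner:
  fixes l :: "'e::euclidean_space \<times> 'e \<Rightarrow> real"
  assumes l: "smooth_on l (U \<times> UNIV)" and U: "open U" "q \<in> U"
  shows "euler_lagrange l (q, v, a) \<bullet> b =
    fderiv (\<lambda>y. fderiv l y (0, b)) (q, v) (v, a) - fderiv l (q, v) (b, 0)"
proof -
  have op: "open (U \<times> (UNIV :: 'e set))" and qv: "(q, v) \<in> U \<times> UNIV" using U by (simp_all add: open_Times)
  let ?f = "\<lambda>b. fderiv (\<lambda>y. fderiv l y (0, b)) (q, v) (v, a) - fderiv l (q, v) (b, 0)"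
  have sym: "fderiv (\<lambda>y. fderiv l y (0, b)) (q, v) (v, a) = fderiv (\<lambda>y. fderiv l y (v, a)) (q, v) (0, b)" for b
    by (rule fderiv_symmetric[OF l op qv])
  have 1: "linear (\<lambda>b. (0 :: 'e, b :: 'e))" "linear (\<lambda>b. (b :: 'e, 0 :: 'e))"
    by (auto intro!: linearI)
  have "linear ?f"
    unfolding sym
    by (intro linear_compose_sub linear_compose[OF 1(1), unfolded o_def] linear_compose[OF 1(2), unfolded o_def]
        linear_fderiv[OF l qv] linear_fderiv[OF smooth_on_fderiv[OF l] qv])
  then have "?f b = (\<Sum>c\<in>Basis. (b \<bullet> c) *\<^sub>R ?f c)" by (rule linear_eq_sum_Basis)
  also have "\<dots> = euler_lagrange l (q, v, a) \<bullet> b"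
    unfolding euler_lagrange_def total_derivative_def prod.case inner_sum_left inner_scaleR_left
    by (intro sum.cong) (simp_all add: inner_commute)
  finally show ?thesis by simp
qed

text \<open>The total derivative and the position derivative each produce the velocity derivative of
  \<open>l'\<close> applied to the second derivative of \<phi> in the directions \<open>v\<close>
  and \<open>b\<close>. These terms agree by symmetry and cancel, so the expressions transform as
  covector components.\<close>

lemma euler_lagrange_change:
  fixes l l' :: "'e::euclidean_space \<times> 'e \<Rightarrow> real"
  assumes l: "smooth_on l (U \<times> UNIV)" "open U" and l': "smooth_on l' (U' \<times> UNIV)" "open U'"
    and \<phi>: "smooth_on \<phi> U" "\<And>y. y \<in> U \<Longrightarrow> \<phi> y \<in> U'"
    and eq: "\<And>q v. q \<in> U \<Longrightarrow> l (q, v) = l' (\<phi> q, fderiv \<phi> q v)" and q: "q \<in> U"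
  shows "euler_lagrange l (q, v, a) \<bullet> b =
    euler_lagrange l' (\<phi> q, fderiv \<phi> q v, fderiv (\<lambda>z. fderiv \<phi> z v) q v + fderiv \<phi> q a) \<bullet> fderiv \<phi> q b"
proof -
  let ?\<Psi> = "\<lambda>y. (\<phi> (fst y), fderiv \<phi> (fst y) (snd y))"
  let ?\<Psi>' = "\<lambda>y h. (fderiv \<phi> (fst y) (fst h), fderiv (\<lambda>z. fderiv \<phi> z (snd y)) (fst y) (fst h) + fderiv \<phi> (fst
      y) (snd h))"
  have op: "open (U \<times> (UNIV :: 'e set))" using l(2) by (simp add: open_Times)
  have op': "open (U' \<times> (UNIV :: 'e set))" using l'(2) by (simp add: open_Times)
  have \<Psi>: "(?\<Psi> has_derivative ?\<Psi>' y) (at y)" if "y \<in> U \<times> UNIV" for y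
    using that
    by (intro has_derivative_Pair has_derivative_compose[OF has_derivative_fst[OF has_derivative_ident]
        smooth_on_has_derivative[OF \<phi>(1)]]
        has_derivative_fderiv_apply[OF \<phi>(1) l(2) _ has_derivative_fst[OF has_derivative_ident]
            has_derivative_snd[OF has_derivative_ident]]) auto
  have \<Psi>_in: "?\<Psi> y \<in> U' \<times> UNIV" if "y \<in> U \<times> UNIV" for y using that \<phi>(2) by auto
  have lin0: "fderiv (\<lambda>z. fderiv \<phi> z w) x 0 = 0" "fderiv \<phi> x 0 = 0" if "x \<in> U" for x w
    using linear_fderiv[OF \<phi>(1) that] linear_fderiv[OF smooth_on_fderiv[OF \<phi>(1)] that] linear_0 by blast+
  have Dl: "fderiv l y h = fderiv l' (?\<Psi> y) (?\<Psi>' y h)" if y: "y \<in> U \<times> UNIV" for y h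
  proof -
    have "((\<lambda>y. l' (?\<Psi> y)) has_derivative (\<lambda>h. fderiv l' (?\<Psi> y) (?\<Psi>' y h))) (at y)"
      by (rule has_derivative_compose[OF \<Psi>[OF y] smooth_on_has_derivative[OF l'(1) \<Psi>_in[OF y]]])
    then have "(l has_derivative (\<lambda>h. fderiv l' (?\<Psi> y) (?\<Psi>' y h))) (at y)"
      by (rule has_derivative_transform_within_open[OF _ op y]) (auto simp: eq)
    then show ?thesis by (simp add: fderiv_eqI)
  qed
  have y: "(q, v) \<in> U \<times> UNIV" using q by simp
  \<comment> \<open>On the open domain this function equals \<open>fderiv l y (0, b)\<close>,
    because vertical vectors go to vertical vectors; its derivative therefore computes the total
    time derivative of the momentum.\<close>
  have "((\<lambda>y. fderiv l' (?\<Psi> y) (0, fderiv \<phi> (fst y) b)) has_derivative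
      (\<lambda>h. fderiv (\<lambda>z. fderiv l' z (0, fderiv \<phi> (fst (q, v)) b)) (?\<Psi> (q, v)) (?\<Psi>' (q, v) h)
         + fderiv l' (?\<Psi> (q, v)) (0, fderiv (\<lambda>z. fderiv \<phi> z b) (fst (q, v)) (fst h)))) (at (q, v))"
    by (rule has_derivative_fderiv_apply[OF l'(1) op' \<Psi>_in[OF y] \<Psi>[OF y]])
      (use q in \<open>intro has_derivative_Pair has_derivative_const has_derivative_compose[OF has_derivative_fst[OF
          has_derivative_ident]],
        simp add: smooth_on_has_derivative[OF smooth_on_fderiv[OF \<phi>(1)]]\<close>)
  then have "((\<lambda>y. fderiv l y (0, b)) has_derivative
      (\<lambda>h. fderiv (\<lambda>z. fderiv l' z (0, fderiv \<phi> (fst (q, v)) b)) (?\<Psi> (q, v)) (?\<Psi>' (q, v) h)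
         + fderiv l' (?\<Psi> (q, v)) (0, fderiv (\<lambda>z. fderiv \<phi> z b) (fst (q, v)) (fst h)))) (at (q, v))"
    by (rule has_derivative_transform_within_open[OF _ op y]) (auto simp: Dl lin0)
  from fderiv_eqI[OF this]
  have 1: "fderiv (\<lambda>y. fderiv l y (0, b)) (q, v) (v, a) =
      fderiv (\<lambda>z. fderiv l' z (0, fderiv \<phi> q b)) (?\<Psi> (q, v)) (?\<Psi>' (q, v) (v, a))
      + fderiv l' (?\<Psi> (q, v)) (0, fderiv (\<lambda>z. fderiv \<phi> z b) q v)" by simp
  have sym: "fderiv (\<lambda>z. fderiv \<phi> z b) q v = fderiv (\<lambda>z. fderiv \<phi> z v) q b"
    by (rule fderiv_symmetric[OF \<phi>(1) l(2) q])
  have lin: "linear (fderiv l' (?\<Psi> (q, v)))" by (rule linear_fderiv[OF l'(1) \<Psi>_in[OF y]])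
  have "fderiv l (q, v) (b, 0) = fderiv l' (?\<Psi> (q, v)) (fderiv \<phi> q b, fderiv (\<lambda>z. fderiv \<phi> z v) q b)"
    using q by (simp add: Dl lin0)
  also have "\<dots> = fderiv l' (?\<Psi> (q, v)) (fderiv \<phi> q b, 0) + fderiv l' (?\<Psi> (q, v)) (0, fderiv (\<lambda>z. fderiv \<phi> z v)
      q b)"
    using linear_add[OF lin, of "(fderiv \<phi> q b, 0)" "(0, fderiv (\<lambda>z. fderiv \<phi> z v) q b)"] by simp
  finally show ?thesis
    using 1 by (simp add: euler_lagrange_inner[OF l q] euler_lagrange_inner[OF l' \<phi>(2)[OF q]] sym)
qed

text \<open>The arguments are functions of a parameter so that accelerations can later be
  substituted, with \<open>G\<close> in the place of the dependent ones.\<close>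

lemma smooth_on_euler_lagrange:
  fixes l :: "'e::euclidean_space \<times> 'e \<Rightarrow> real"
  assumes l: "smooth_on l (U \<times> UNIV)" and U: "open U" and S: "open S"
    and fgh: "smooth_on f S" "smooth_on g S" "smooth_on h S" and f_in: "\<And>x. x \<in> S \<Longrightarrow> f x \<in> U"
  shows "smooth_on (\<lambda>x. euler_lagrange l (f x, g x, h x)) S"
proof -
  have op: "open (U \<times> (UNIV :: 'e set))" using U by (simp add: open_Times)
  have "smooth_on (\<lambda>x. \<Sum>b\<in>Basis. (fderiv (\<lambda>y. fderiv l y (0, b)) (f x, g x) (g x, h x)
      - fderiv l (f x, g x) (b, 0)) *\<^sub>R b) S"
    by (intro smooth S fgh smooth_on_fderiv_apply[OF S smooth_on_fderiv[OF l] op] smooth_on_fderiv_apply[OF S l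
        op])
      (use f_in in auto)
  then show ?thesis by (simp add: euler_lagrange_def total_derivative_def)
qed

section \<open>The constraint submanifold\<close>

locale control_system =
  fixes A1 :: "('x, real^'r::finite) atlas"
    and A2 :: "('y, real^'s::finite) atlas"
    and L :: "('x \<times> 'y) jet \<Rightarrow> real"
    and C :: "('x, 'y) control_point \<Rightarrow> real"
  assumes A1: "smooth_atlas A1" and A2: "smooth_atlas A2"
    and L: "smooth_function (TQ A1 A2) L"
    and reg: "regular_lagrangian A1 A2 L"
    and C: "smooth_function (control_atlas A1 A2) C"
begin

abbreviation "Q \<equiv> prod_atlas A1 A2"
abbreviation "loc \<equiv> local_lagrangian A1 A2 L"
abbreviation "EL \<equiv> local_euler_lagrange A1 A2 L"
abbreviation "cdom k \<equiv> snd k ` fst k"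
abbreviation "M \<equiv> constraint_submanifold A1 A2 L"
abbreviation "G \<equiv> constraint_solution A1 A2 L"
abbreviation "LM \<equiv> local_constraint_lagrangian A1 A2 L C"
abbreviation "Mc \<equiv> constraint_chart A1 A2 L"
abbreviation "jc \<equiv> jet2_chart Q"

lemma Q: "smooth_atlas Q"
  by (rule smooth_atlas_prod[OF A1 A2])

section \<open>Local Lagrangians, the constraint and its solution\<close>

lemma smooth_on_loc:
  assumes "k \<in> Q"
  shows "smooth_on (loc k) (cdom k \<times> UNIV)"
proof -
  have "tangent_chart Q k \<in> TQ A1 A2" using assms by (simp add: TQ_def tangent_chart_in[OF Q])
  then have "smooth_on (L \<circ> chart_inv (tangent_chart Q k)) (snd (tangent_chart Q k) ` fst (tangent_chart Q k))"
    using L by (simp add: smooth_function_def)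
  then show ?thesis
    by (simp only: tangent_chart_image[OF Q assms] local_lagrangian_def local_function_def)
qed

lemma loc_change:
  assumes "k \<in> Q" "k' \<in> Q" "q \<in> overlap k k'"
  shows "loc k (q, v) = loc k' (transition k k' q, fderiv (transition k k') q v)"
proof -
  obtain x where x: "x \<in> fst k" "x \<in> fst k'" "q = snd k x" "transition k k' q = snd k' x"
    by (rule overlapE[OF Q assms(1,3)])
  show ?thesis
    using coord_vector_change(2)[OF Q assms(1) x(1) assms(2) x(2), of v] x inv_of_chart[OF Q]
    by (simp add: local_lagrangian_def local_function_def chart_inv_tangent_chart[OF Q] assms)
qed

lemma EL_change:
  assumes k: "k \<in> Q" "k' \<in> Q" and j: "j \<in> fst (jc k)" "jet_base j \<in> fst k'"
  shows "EL k (snd (jc k) j) \<bullet> b =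
    EL k' (snd (jc k') j) \<bullet> fderiv (transition k k') (snd k (jet_base j)) b"
proof -
  obtain q v a where c: "snd (jc k) j = (q, v, a)" by (metis prod_cases3)
  have q: "q = snd k (jet_base j)" and x: "jet_base j \<in> fst k"
    using jet2_chart_rep[OF Q k(1) j(1)] c by auto
  have ov: "overlap k k' \<times> UNIV \<subseteq> cdom k \<times> UNIV" by (intro Sigma_mono overlap_subset) simp
  have "EL k (q, v, a) \<bullet> b = EL k' (transition k k' q, fderiv (transition k k') q v,
      fderiv (\<lambda>z. fderiv (transition k k') z v) q v + fderiv (transition k k') q a)
          \<bullet> fderiv (transition k k') q b"
    unfolding local_euler_lagrange_def
  proof (rule euler_lagrange_change[OF smooth_on_subset[OF smooth_on_loc[OF k(1)] ov] open_overlap[OF Q k]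
        smooth_on_loc[OF k(2)] open_chart[OF Q k(2)] smooth_on_transition[OF Q k]])
    show "transition k k' y \<in> cdom k'" if "y \<in> overlap k k'" for y
      by (rule overlapE[OF Q k(1) that]) auto
    show "loc k (q, v) = loc k' (transition k k' q, fderiv (transition k k') q v)" if "q \<in> overlap k k'" for q v
      by (rule loc_change[OF k that])
    show "q \<in> overlap k k'" using q x j(2) by (simp add: overlapI)
  qed
  then show ?thesis
    using jet2_chart_change[OF Q k(1) j(1) k(2) j(2) c] c q by simp
qed

text \<open>Testing against \<open>(0, b)\<close> isolates the second factor. Block diagonal
  Jacobians keep vectors of this form, so vanishing in one product chart implies vanishing in every
  other one around the base point.\<close>

lemma constraint_iff:
  assumes k: "k \<in> Q" and j: "j \<in> fst (jc k)"
  shows "j \<in> M \<longleftrightarrow> snd (EL k (snd (jc k) j)) = 0"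
proof
  have x: "jet_base j \<in> fst k" using jet2_chart_rep[OF Q k j] by simp
  show "snd (EL k (snd (jc k) j)) = 0" if "j \<in> M"
    using that k x by (simp add: constraint_submanifold_def)
  assume 0: "snd (EL k (snd (jc k) j)) = 0"
  have "snd (EL k' (snd (jc k') j)) = 0" if k': "k' \<in> Q" and x': "jet_base j \<in> fst k'" for k'
  proof -
    have j': "j \<in> fst (jc k')" using j x' jet2_chart_mem_iff[OF Q k j] by simp
    obtain k1 k2 k1' k2' where prod: "k1 \<in> A1" "k2 \<in> A2" "k = prod_chart k1 k2"
      "k1' \<in> A1" "k2' \<in> A2" "k' = prod_chart k1' k2'"
      using k k' by (elim prod_atlasE)
    have ov: "snd k' (jet_base j) \<in> overlap k' k" using x x' by (rule overlapI[rotated])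
    have lin: "linear (fderiv (transition k1' k1) (fst (snd k' (jet_base j))))"
      using ov unfolding prod(3,6) overlap_prod_chart
      by (intro linear_fderiv[OF smooth_on_transition[OF A1 prod(4,1)]]) auto
    have "snd (EL k' (snd (jc k') j)) \<bullet> b = 0" for b
    proof -
      have "EL k' (snd (jc k') j) \<bullet> (0, b) =
          EL k (snd (jc k) j) \<bullet> fderiv (transition k' k) (snd k' (jet_base j)) (0, b)"
        by (rule EL_change[OF k' k j' x])
      also have "\<dots> = 0"
        using fderiv_transition_prod[OF A1 A2 prod(4,5,1,2)] ov 0 linear_0[OF lin]
        by (simp add: prod(3,6) inner_prod_def)
      finally show ?thesis by (simp add: inner_prod_def)
    qed
    then show ?thesis by (metis inner_eq_zero_iff)
  qed
  moreover have "j \<in> points (jet2_atlas Q)" using k j by (auto simp: points_def jet2_atlas_def)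
  ultimately show "j \<in> M" by (simp add: constraint_submanifold_def)
qed

text \<open>Accelerations occur only linearly, multiplied by second derivatives of the Lagrangian,
  so solving the constraint is linear algebra and calls for no implicit function theorem. The
  transpose reflects the index order in \<open>vertical_hessian\<close>, whose second index is the
  component of the equation.\<close>

lemma snd_EL_affine:
  assumes k: "k \<in> Q" and q: "q \<in> cdom k"
  shows "snd (EL k (q, v, (a, g))) = snd (EL k (q, v, (a, 0))) + transpose (vertical_hessian A1 A2 L k (q, v))
      *v g"
proof (rule vec_eq_iff[THEN iffD2], rule allI)
  fix \<beta>
  note l = smooth_on_loc[OF k] open_chart[OF Q k] q
  let ?F = "fderiv (\<lambda>y. fderiv (loc k) y (0, (0, axis \<beta> 1))) (q, v)"
  have lin: "linear ?F" using l by (intro linear_fderiv[OF smooth_on_fderiv[OF l(1)]]) simp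
  have comp: "snd w $ \<beta> = w \<bullet> (0, axis \<beta> 1)" for w :: "(real^'r) \<times> (real^'s)"
    by (simp add: inner_prod_def inner_axis)
  have g: "(0, (0, g)) = (\<Sum>\<alpha>\<in>UNIV. (g $ \<alpha>) *\<^sub>R ((0, (0, axis \<alpha> 1)) :: ((real^'r) \<times> (real^'s)) \<times>
      ((real^'r) \<times> (real^'s))))"
    by (simp add: prod_eq_iff fst_sum snd_sum vec_eq_iff axis_def if_distrib cong: if_cong)
  have "?F (0, (0, g)) = (\<Sum>\<alpha>\<in>UNIV. g $ \<alpha> * ?F (0, (0, axis \<alpha> 1)))"
    by (simp only: g linear_sum[OF lin] linear_scale[OF lin] real_scaleR_def)
  moreover have "?F (v, (a, g)) = ?F (v, (a, 0)) + ?F (0, (0, g))"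
    using linear_add[OF lin, of "(v, (a, 0))" "(0, (0, g))"] by simp
  moreover have "second_partial (loc k) (0, 0, axis \<alpha> 1) (0, 0, axis \<beta> 1) (q, v) = ?F (0, (0, axis \<alpha> 1))" for \<alpha>
    by (simp add: second_partial_def)
  ultimately show "snd (EL k (q, v, (a, g))) $ \<beta> =
      (snd (EL k (q, v, (a, 0))) + transpose (vertical_hessian A1 A2 L k (q, v)) *v g) $ \<beta>"
    by (simp add: comp local_euler_lagrange_def euler_lagrange_inner[OF l] matrix_vector_mult_def
        transpose_def vertical_hessian_def mult.commute)
qed

lemma invertible_hessian:
  assumes k: "k \<in> Q" and q: "q \<in> cdom k"
  shows "invertible (transpose (vertical_hessian A1 A2 L k (q, v)))"
proof -
  have "coord_vector Q k v (chart_inv k q) \<in> fst (tangent_chart Q k)"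
    "snd (tangent_chart Q k) (coord_vector Q k v (chart_inv k q)) = (q, v)"
    using coord_vector_in_tangent_chart[OF Q k chart_inv_in[OF q], of v] by (simp_all add: chart_of_inv[OF q])
  then show ?thesis
    using reg k unfolding regular_lagrangian_def by (metis transpose_invertible)
qed

text \<open>Invertibility makes the affine equation uniquely solvable, which gives the definite
  description in \<open>constraint_solution\<close> its meaning.\<close>

lemma G_iff:
  assumes k: "k \<in> Q" and q: "q \<in> cdom k"
  shows "snd (EL k (q, v, (a, g))) = 0 \<longleftrightarrow> g = G k (q, v, a)"
proof -
  define H e where "H = transpose (vertical_hessian A1 A2 L k (q, v))" and "e = snd (EL k (q, v, (a, 0)))"
  obtain B where B: "H ** B = mat 1" "B ** H = mat 1"
    using invertible_hessian[OF k q, of v] unfolding invertible_def H_def by blast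
  have *: "snd (EL k (q, v, (a, g))) = 0 \<longleftrightarrow> g = B *v (- e)" for g
  proof -
    have 1: "H *v (B *v (- e)) = - e" "B *v (H *v g) = g"
      using B by (simp_all add: matrix_vector_mul_assoc)
    have "snd (EL k (q, v, (a, g))) = e + H *v g"
      unfolding H_def e_def by (rule snd_EL_affine[OF k q])
    then show ?thesis using 1 by (metis add_eq_0_iff)
  qed
  then have "(THE g. snd (EL k (q, v, (a, g))) = 0) = B *v (- e)" by (intro the_equality) auto
  then show ?thesis using * by (simp add: constraint_solution_def)
qed

lemma open_coords: "k \<in> Q \<Longrightarrow> open (cdom k \<times> (UNIV :: ('r, 's) coords set) \<times> (UNIV :: (real^'r) set))"
  by (intro open_Times open_chart[OF Q] open_UNIV)

lemma smooth_on_EL: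
  assumes k: "k \<in> Q" and S: "open S" and "smooth_on f S" "smooth_on g S" "smooth_on h S"
      "\<And>x. x \<in> S \<Longrightarrow> f x \<in> cdom k"
  shows "smooth_on (\<lambda>x. EL k (f x, g x, h x)) S"
  unfolding local_euler_lagrange_def
  by (rule smooth_on_euler_lagrange[OF smooth_on_loc[OF k] open_chart[OF Q k] assms(2-)])

text \<open>The linear system is solvable at every point over the chart, so smoothness holds for all
  velocities and all free accelerations.\<close>

lemma smooth_on_G:
  assumes k: "k \<in> Q"
  shows "smooth_on (G k) (cdom k \<times> UNIV \<times> UNIV)"
proof (rule smooth_on_linear_solution[OF open_coords[OF k]])
  let ?S = "cdom k \<times> (UNIV :: ('r, 's) coords set) \<times> (UNIV :: (real^'r) set)"
  let ?H = "\<lambda>(q, v, a). transpose (vertical_hessian A1 A2 L k (q, v))"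
  let ?b = "\<lambda>(q, v, a). - snd (EL k (q, v, (a, 0)))"
  note op = open_coords[OF k]
  show "smooth_on (\<lambda>x. ?H x $ i $ j) ?S" for i j
  proof -
    have "smooth_on (\<lambda>x. fderiv (\<lambda>y. fderiv (loc k) y (0, 0, axis i 1)) (fst x, fst (snd x)) (0, 0, axis j 1))
        ?S"
      by (intro smooth_on_fderiv_apply[OF op smooth_on_fderiv[OF smooth_on_loc[OF k]]] smooth op open_Times
          open_chart[OF Q k] open_UNIV) auto
    then show ?thesis by (simp add: split_beta transpose_def vertical_hessian_def second_partial_def)
  qed
  show "smooth_on ?b ?S"
    unfolding split_beta by (intro smooth op smooth_on_EL[OF k]) auto
  fix x :: "('r, 's) coords \<times> ('r, 's) coords \<times> (real^'r)" assume x: "x \<in> ?S"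
  obtain q v a where xq: "x = (q, v, a)" "q \<in> cdom k" using x by (metis mem_Sigma_iff prod_cases3)
  show "invertible (?H x)" using invertible_hessian[OF k xq(2)] by (simp add: xq(1))
  \<comment> \<open>The constraint at \<open>G k\<close> in affine form, ready to be read as the
    linear system of \<open>smooth_on_linear_solution\<close>.\<close>
  have "snd (EL k (q, v, (a, 0))) + transpose (vertical_hessian A1 A2 L k (q, v)) *v G k (q, v, a) = 0"
    using G_iff[OF k xq(2)] snd_EL_affine[OF k xq(2)] by metis
  then show "?H x *v G k x = ?b x" unfolding xq(1) prod.case by (simp only: add_eq_0_iff)
qed

section \<open>Charts of the constraint submanifold, the control force and the cost\<close>

lemma constraint_chartD:
  assumes k: "k \<in> Q" and j: "j \<in> fst (Mc k)" and c: "snd (Mc k) j = (q, v, a)"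
  shows "j \<in> M" "j \<in> fst (jc k)" "snd (jc k) j = (q, v, (a, G k (q, v, a)))" "q \<in> cdom k"
    "jet_base j = chart_inv k q"
proof -
  show M: "j \<in> M" and j2: "j \<in> fst (jc k)" using j by (auto simp: constraint_chart_def)
  obtain g where g: "snd (jc k) j = (q, v, (a, g))"
    using c by (auto simp: constraint_chart_def split: prod.splits)
  have x: "jet_base j \<in> fst k" "q = snd k (jet_base j)" using jet2_chart_rep[OF Q k j2] g by auto
  then show q: "q \<in> cdom k" and "jet_base j = chart_inv k q" using inv_of_chart[OF Q k] by auto
  show "snd (jc k) j = (q, v, (a, G k (q, v, a)))"
    using M constraint_iff[OF k j2] g G_iff[OF k q] by simp
qed

lemma constraint_chartI:
  assumes k: "k \<in> Q" and q: "q \<in> cdom k"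
  obtains j where "j \<in> fst (Mc k)" "snd (Mc k) j = (q, v, a)"
proof -
  note j = jet2_chart_quadratic[OF Q k q, of v "(a, G k (q, v, a))"]
  have "snd (EL k (q, v, (a, G k (q, v, a)))) = 0" using G_iff[OF k q] by blast
  then have "jet 2 Q (chart_inv k \<circ> quadratic q v (a, G k (q, v, a))) \<in> M"
    using constraint_iff[OF k j(1)] j(2) by simp
  then show ?thesis
    using that[of "jet 2 Q (chart_inv k \<circ> quadratic q v (a, G k (q, v, a)))"] j
        by (simp add: constraint_chart_def)
qed

lemma inj_on_constraint_chart:
  assumes k: "k \<in> Q"
  shows "inj_on (snd (Mc k)) (fst (Mc k))"
proof (rule inj_onI)
  fix i j assume i: "i \<in> fst (Mc k)" and j: "j \<in> fst (Mc k)"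
    and eq: "snd (Mc k) i = snd (Mc k) j"
  obtain q v a where c: "snd (Mc k) j = (q, v, a)" by (metis prod_cases3)
  show "i = j"
    using constraint_chartD[OF k i, of q v a] constraint_chartD[OF k j c] eq c
    by (intro inj_onD[OF inj_on_jet2_chart[OF Q k]]) simp_all
qed

text \<open>Existence: the covector with the right components in one chart has them in all, by
  covariance. Uniqueness: its components in \<open>k1\<close> determine it. Together they resolve
  the definite description.\<close>

lemma control_force:
  assumes k: "k1 \<in> A1" "k2 \<in> A2" and j: "j \<in> fst (jet2_chart Q (prod_chart k1 k2))"
  shows "control_force A1 A2 L j \<in> fst (cotangent_chart A1 k1)"
    and "fst (control_force A1 A2 L j) = fst (jet_base j)"
    and "snd (snd (cotangent_chart A1 k1) (control_force A1 A2 L j)) =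
      fst (EL (prod_chart k1 k2) (snd (jet2_chart Q (prod_chart k1 k2)) j))"
proof -
  let ?k = "prod_chart k1 k2" and ?x = "fst (jet_base j)"
  let ?E = "\<lambda>k. EL k (snd (jc k) j)"
  have kQ: "?k \<in> Q" by (rule prod_atlasI[OF k])
  have x: "jet_base j \<in> fst ?k" using jet2_chart_rep[OF Q kQ j] by simp
  then have x1: "?x \<in> fst k1" by (auto simp: prod_chart_sel)
  define \<mu> where "\<mu> = (?x, covector A1 k1 (fst (?E ?k)) ?x)"
  have \<mu>: "\<mu> \<in> fst (cotangent_chart A1 k1)" "fst \<mu> = ?x" "snd (snd (cotangent_chart A1 k1) \<mu>) = fst (?E ?k)"
    using covector_in[OF A1 k(1) x1] cotangent_chart_covector[OF A1 k(1) x1] x1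
    by (simp_all add: \<mu>_def cotangent_chart_mem_iff[OF A1])
  define P where "P \<mu> \<longleftrightarrow> \<mu> \<in> points (cotangent_atlas A1) \<and> fst \<mu> = ?x \<and>
      (\<forall>k1'\<in>A1. \<forall>k2'\<in>A2. jet_base j \<in> fst (prod_chart k1' k2') \<longrightarrow>
         snd (snd (cotangent_chart A1 k1') \<mu>) = fst (?E (prod_chart k1' k2')))" for \<mu>
  have "P \<mu>"
    unfolding P_def
  proof (intro conjI ballI impI)
    show "\<mu> \<in> points (cotangent_atlas A1)" using \<mu>(1) k(1) by (auto simp: points_def cotangent_atlas_def)
    fix k1' k2' assume k': "k1' \<in> A1" "k2' \<in> A2" and x': "jet_base j \<in> fst (prod_chart k1' k2')"
    let ?k' = "prod_chart k1' k2'"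
    have kQ': "?k' \<in> Q" by (rule prod_atlasI[OF k'])
    have x1': "?x \<in> fst k1'" using x' by (auto simp: prod_chart_sel)
    have j': "j \<in> fst (jet2_chart Q ?k')" using j x' jet2_chart_mem_iff[OF Q kQ j] by simp
    have \<mu>': "\<mu> \<in> fst (cotangent_chart A1 k1')" using \<mu>(1) x1'
        by (simp add: cotangent_chart_mem_iff[OF A1] \<mu>_def)
    have ov: "snd ?k' (jet_base j) \<in> overlap ?k' ?k" using x x' by (rule overlapI[rotated])
    have lin: "linear (fderiv (transition k2' k2) (snd (snd ?k' (jet_base j))))"
      using ov unfolding overlap_prod_chart
      by (intro linear_fderiv[OF smooth_on_transition[OF A2 k'(2) k(2)]]) auto
    have fs: "fst (snd ?k' (jet_base j)) = snd k1' ?x" by (simp add: prod_chart_sel)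
    have "snd (snd (cotangent_chart A1 k1') \<mu>) \<bullet> b = fst (?E ?k') \<bullet> b" for b
    proof -
      \<comment> \<open>Vectors \<open>(b, 0)\<close> isolate the first factor; the block of the
        second factor sends 0 to 0, so the chart chosen on the second factor has no
        influence.\<close>
      have "fst (?E ?k') \<bullet> b = ?E ?k' \<bullet> (b, 0)" by (simp add: inner_prod_def)
      also have "\<dots> = ?E ?k \<bullet> fderiv (transition ?k' ?k) (snd ?k' (jet_base j)) (b, 0)"
        by (rule EL_change[OF kQ' kQ j' x])
      also have "\<dots> = fst (?E ?k) \<bullet> fderiv (transition k1' k1) (snd k1' ?x) b"
        using fderiv_transition_prod[OF A1 A2 k' k ov] linear_0[OF lin] fs by (simp add: inner_prod_def)
      also have "\<dots> = snd (snd (cotangent_chart A1 k1') \<mu>) \<bullet> b"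
        using cotangent_chart_change[OF A1 k'(1) k(1) \<mu>' \<mu>(1), of b] \<mu>(2,3) by simp
      finally show ?thesis by simp
    qed
    then show "snd (snd (cotangent_chart A1 k1') \<mu>) = fst (?E ?k')"
      by (metis vector_eq_rdot)
  qed (rule \<mu>(2))
  moreover have "\<nu> = \<mu>" if P: "P \<nu>" for \<nu>
  proof (rule inj_onD[OF inj_on_cotangent_chart[OF A1 k(1)] _ _ \<mu>(1)])
    obtain k1' where "k1' \<in> A1" "\<nu> \<in> fst (cotangent_chart A1 k1')"
      using P unfolding P_def points_def cotangent_atlas_def by blast
    then show "\<nu> \<in> fst (cotangent_chart A1 k1)" using P x1 by (simp add: P_def cotangent_chart_mem_iff[OF A1])
    show "snd (cotangent_chart A1 k1) \<nu> = snd (cotangent_chart A1 k1) \<mu>"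
      using P \<mu> k x by (intro prod_eqI) (simp_all add: P_def fst_cotangent_chart[OF A1])
  qed
  ultimately have "control_force A1 A2 L j = \<mu>"
    unfolding control_force_def P_def[symmetric] by (rule the_equality)
  then show "control_force A1 A2 L j \<in> fst (cotangent_chart A1 k1)"
    and "fst (control_force A1 A2 L j) = ?x"
    and "snd (snd (cotangent_chart A1 k1) (control_force A1 A2 L j)) = fst (?E ?k)"
    using \<mu> by simp_all
qed

lemma inj_on_control_chart:
  assumes k: "k1 \<in> A1" "k2 \<in> A2"
  shows "inj_on (snd (control_chart A1 A2 k1 k2)) (fst (control_chart A1 A2 k1 k2))"
proof (rule inj_onI)
  fix m n assume m: "m \<in> fst (control_chart A1 A2 k1 k2)" and n: "n \<in> fst (control_chart A1 A2 k1 k2)"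
    and eq: "snd (control_chart A1 A2 k1 k2) m = snd (control_chart A1 A2 k1 k2) n"
  obtain i \<mu> j \<nu> where mn: "m = (i, \<mu>)" "n = (j, \<nu>)" by (metis prod.collapse)
  have "i = j"
    using m n eq by (intro inj_onD[OF inj_on_tangent_chart[OF Q prod_atlasI[OF k]]])
      (auto simp: control_chart_def mn split: prod.splits)
  moreover have "\<mu> = \<nu>"
    using m n eq \<open>i = j\<close> by (intro inj_onD[OF inj_on_cotangent_chart[OF A1 k(1)]] prod_eqI)
      (auto simp: control_chart_def mn fst_cotangent_chart[OF A1] split: prod.splits)
  ultimately show "m = n" by (simp add: mn)
qed

text \<open>All control values occur in the chart, so the local cost is smooth wherever the
  Euler-Lagrange force is substituted for \<open>u\<close>.\<close>

lemma control_chart_image: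
  assumes k: "k1 \<in> A1" "k2 \<in> A2" and q: "q \<in> cdom (prod_chart k1 k2)"
  shows "(q, v, u) \<in> snd (control_chart A1 A2 k1 k2) ` fst (control_chart A1 A2 k1 k2)"
proof -
  let ?k = "prod_chart k1 k2" and ?x = "chart_inv (prod_chart k1 k2) q"
  note kQ = prod_atlasI[OF k]
  have x: "?x \<in> fst ?k" "snd ?k ?x = q" by (rule chart_inv_in[OF q], rule chart_of_inv[OF q])
  have x1: "fst ?x \<in> fst k1" using x(1) by (auto simp: prod_chart_sel)
  let ?m = "(coord_vector Q ?k v ?x, (fst ?x, covector A1 k1 u (fst ?x)))"
  have "?m \<in> fst (control_chart A1 A2 k1 k2)"
    using coord_vector_in_tangent_chart(1)[OF Q kQ x(1)] covector_in[OF A1 k(1) x1] x1 jet_base_coord_vector[OF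
        Q kQ x(1)]
    by (simp add: control_chart_def cotangent_chart_mem_iff[OF A1])
  moreover have "snd (control_chart A1 A2 k1 k2) ?m = (q, v, u)"
    using coord_vector_in_tangent_chart(2)[OF Q kQ x(1)] cotangent_chart_covector[OF A1 k(1) x1] x(2)
    by (simp add: control_chart_def)
  ultimately show ?thesis by (metis imageI)
qed

lemma cost_in_chart:
  assumes k: "k1 \<in> A1" "k2 \<in> A2" and j: "j \<in> fst (jet2_chart Q (prod_chart k1 k2))"
    and c: "snd (jet2_chart Q (prod_chart k1 k2)) j = (q, v, a)"
  shows "cost_lagrangian A1 A2 L C j =
    (C \<circ> chart_inv (control_chart A1 A2 k1 k2)) (q, v, fst (EL (prod_chart k1 k2) (q, v, a)))"
proof -
  note kQ = prod_atlasI[OF k]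
  note f = control_force[OF k j] and t = jet21_chart[OF Q kQ j c]
  let ?m = "(jet21 Q j, control_force A1 A2 L j)"
  have "?m \<in> fst (control_chart A1 A2 k1 k2)"
    using f t by (simp add: control_chart_def)
  moreover have "snd (control_chart A1 A2 k1 k2) ?m = (q, v, fst (EL (prod_chart k1 k2) (q, v, a)))"
    using f(3) t(2) c by (simp add: control_chart_def)
  ultimately show ?thesis
    using inv_of_chart'[OF inj_on_control_chart[OF k], of ?m] by (simp add: cost_lagrangian_def)
qed

lemma LM_eq_cost:
  assumes k: "k \<in> Q" and j: "j \<in> fst (Mc k)"
  shows "LM k (snd (Mc k) j) = cost_lagrangian A1 A2 L C j"
  using inv_of_chart'[OF inj_on_constraint_chart[OF k] j]
  by (simp add: local_constraint_lagrangian_def local_function_def)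

text \<open>The restricted cost is the local cost with \<open>u\<close> replaced by the force whose
  dependent accelerations are given by \<open>G k\<close>, hence a composition of smooth
  maps.\<close>

lemma smooth_on_LM:
  assumes k: "k \<in> Q"
  shows "smooth_on (LM k) (cdom k \<times> UNIV \<times> UNIV)"
proof -
  obtain k1 k2 where k12: "k1 \<in> A1" "k2 \<in> A2" "k = prod_chart k1 k2" using k by (rule prod_atlasE)
  let ?S = "cdom k \<times> (UNIV :: ('r, 's) coords set) \<times> (UNIV :: (real^'r) set)"
  note op = open_coords[OF k]
  let ?c = "C \<circ> chart_inv (control_chart A1 A2 k1 k2)"
  have "control_chart A1 A2 k1 k2 \<in> control_atlas A1 A2" using k12 by (auto simp: control_atlas_def)
  then have "smooth_on ?c (snd (control_chart A1 A2 k1 k2) ` fst (control_chart A1 A2 k1 k2))"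
    using C by (simp add: smooth_function_def)
  then have c: "smooth_on ?c ?S"
  proof (rule smooth_on_subset, intro subsetI)
    fix x assume x: "x \<in> ?S"
    obtain q v u where "x = (q, v, u)" by (metis prod_cases3)
    then show "x \<in> snd (control_chart A1 A2 k1 k2) ` fst (control_chart A1 A2 k1 k2)"
      using control_chart_image[OF k12(1,2), of q v u] x by (simp add: k12(3))
  qed
  have id: "smooth_on (\<lambda>x. x) ?S" by (rule smooth_on_ident)
  have "smooth_on (\<lambda>x. ?c (fst x, fst (snd x), fst (EL k (fst x, fst (snd x), (snd (snd x), G k x))))) ?S"
    by (rule smooth_on_compose[OF op c op])
      (intro smooth op smooth_on_EL[OF k] smooth_on_G[OF k], auto)
  then show ?thesis
  proof (rule smooth_on_cong_imp[OF op])
    fix x assume x: "x \<in> ?S"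
    obtain q v a where xq: "x = (q, v, a)" "q \<in> cdom k" using x by (metis mem_Sigma_iff prod_cases3)
    obtain j where j: "j \<in> fst (Mc k)" "snd (Mc k) j = (q, v, a)"
      by (rule constraint_chartI[OF k xq(2)])
    note d = constraint_chartD[OF k j]
    show "?c (fst x, fst (snd x), fst (EL k (fst x, fst (snd x), (snd (snd x), G k x)))) = LM k x"
      using cost_in_chart[OF k12(1,2) d(2,3)[unfolded k12(3)]] LM_eq_cost[OF k j(1)] j(2)
      by (simp add: xq(1) k12(3))
  qed
qed


section \<open>The presymplectic system\<close>

abbreviation "T \<equiv> cotangent_atlas (TQ A1 A2)"
abbreviation "tc \<equiv> tangent_chart Q"
abbreviation "cc k \<equiv> cotangent_chart (TQ A1 A2) (tangent_chart Q k)"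
abbreviation "Wc \<equiv> W0_chart A1 A2 L"
abbreviation "W \<equiv> W0 A1 A2 L"

lemma TQ: "smooth_atlas (TQ A1 A2)"
  unfolding TQ_def by (rule smooth_atlas_tangent[OF Q])

lemma tc_in: "k \<in> Q \<Longrightarrow> tc k \<in> TQ A1 A2"
  unfolding TQ_def by (rule tangent_chart_in[OF Q])

lemmas T = smooth_atlas_cotangent[OF TQ]

lemma cc_in: "k \<in> Q \<Longrightarrow> cc k \<in> T"
  by (rule cotangent_chart_in[OF TQ tc_in])

text \<open>The chart domain places only the covector over \<open>k\<close>. That \<open>j\<close>
  lies over \<open>k\<close> as well and shares the coordinates \<open>q\<close> and
  \<open>v\<close> follows from \<open>fst \<mu> = jet21 Q j\<close>.\<close>

lemma W0_chartE:
  assumes k: "k \<in> Q" and w: "w \<in> fst (Wc k)"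
  obtains \<mu> j q v p0 p1 a where "w = (\<mu>, j)" "\<mu> \<in> fst (cc k)" "j \<in> fst (Mc k)"
    "fst \<mu> = jet21 Q j" "snd (cc k) \<mu> = ((q, v), (p0, p1))" "snd (Mc k) j = (q, v, a)"
    "q \<in> cdom k" "snd (Wc k) w = (q, v, p0, p1, a)"
proof -
  obtain \<mu> j where wj: "w = (\<mu>, j)" "\<mu> \<in> fst (cc k)" "j \<in> M" "fst \<mu> = jet21 Q j"
    using w by (auto simp: W0_chart_def)
  obtain q v p0 p1 where \<mu>: "snd (cc k) \<mu> = ((q, v), (p0, p1))" by (metis surj_pair)
  have t\<mu>: "fst \<mu> \<in> fst (tc k)" "snd (tc k) (fst \<mu>) = (q, v)"
    using wj(2) fst_cotangent_chart[OF TQ, of "tc k" \<mu>] \<mu> by (simp_all add: cotangent_chart_mem_iff[OF TQ])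
  have j2: "j \<in> fst (jc k)"
  proof -
    obtain k' where k': "k' \<in> Q" "j \<in> fst (jc k')"
      using wj(3) by (auto simp: constraint_submanifold_def points_def jet2_atlas_def)
    then have "jet_base (fst \<mu>) = jet_base j"
      using jet21_chart(3)[OF Q k'] wj(4) by (metis prod_cases3)
    moreover have "jet_base (fst \<mu>) \<in> fst k" using t\<mu>(1) tangent_chart_mem_iff[OF Q t\<mu>(1), of k] by simp
    ultimately show ?thesis using jet2_chart_mem_iff[OF Q k'] by simp
  qed
  then have jc: "j \<in> fst (Mc k)" using wj(3) by (simp add: constraint_chart_def)
  obtain q' v' a where c: "snd (Mc k) j = (q', v', a)" by (metis prod_cases3)
  note d = constraint_chartD[OF k jc c]
  have qv: "q' = q" "v' = v" using jet21_chart(2)[OF Q k d(2,3)] t\<mu>(2) wj(4) by simp_all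
  show ?thesis
    by (rule that[OF wj(1,2) jc wj(4) \<mu> c[unfolded qv] d(4)[unfolded qv]])
      (simp add: W0_chart_def wj(1) \<mu> c)
qed

lemma W0_chartI:
  assumes k: "k \<in> Q" and q: "q \<in> cdom k"
  obtains w where "w \<in> fst (Wc k)" "snd (Wc k) w = (q, v, p0, p1, a)"
proof -
  obtain j where j: "j \<in> fst (Mc k)" "snd (Mc k) j = (q, v, a)"
    by (rule constraint_chartI[OF k q])
  note d = constraint_chartD[OF k j]
  note t = jet21_chart[OF Q k d(2,3)]
  let ?\<mu> = "(jet21 Q j, covector (TQ A1 A2) (tc k) (p0, p1) (jet21 Q j))"
  have "?\<mu> \<in> fst (cc k)" "snd (cc k) ?\<mu> = ((q, v), (p0, p1))"
    using covector_in[OF TQ tc_in[OF k] t(1)] cotangent_chart_covector[OF TQ tc_in[OF k] t(1)] t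
    by (simp_all add: cotangent_chart_mem_iff[OF TQ])
  then show ?thesis using that[of "(?\<mu>, j)"] j d(1) by (simp add: W0_chart_def)
qed

lemma inj_on_W0_chart:
  assumes k: "k \<in> Q"
  shows "inj_on (snd (Wc k)) (fst (Wc k))"
proof (rule inj_onI)
  fix w w' assume w: "w \<in> fst (Wc k)" and w': "w' \<in> fst (Wc k)" and eq: "snd (Wc k) w = snd (Wc k) w'"
  obtain \<mu> j q v p0 p1 a where 1: "w = (\<mu>, j)" "\<mu> \<in> fst (cc k)" "j \<in> fst (Mc k)"
    "snd (cc k) \<mu> = ((q, v), (p0, p1))" "snd (Mc k) j = (q, v, a)" "snd (Wc k) w = (q, v, p0, p1, a)"
    by (rule W0_chartE[OF k w])
  obtain \<mu>' j' q' v' p0' p1' a' where 2: "w' = (\<mu>', j')" "\<mu>' \<in> fst (cc k)" "j' \<in> fst (Mc k)"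
    "snd (cc k) \<mu>' = ((q', v'), (p0', p1'))" "snd (Mc k) j' = (q', v', a')"
        "snd (Wc k) w' = (q', v', p0', p1', a')"
    by (rule W0_chartE[OF k w'])
  have "\<mu> = \<mu>'"
    by (rule inj_onD[OF inj_on_cotangent_chart[OF TQ tc_in[OF k]] _ 1(2) 2(2)]) (use 1 2 eq in simp)
  moreover have "j = j'"
    by (rule inj_onD[OF inj_on_constraint_chart[OF k] _ 1(3) 2(3)]) (use 1 2 eq in simp)
  ultimately show "w = w'" using 1 2 by simp
qed

text \<open>Membership depends on the base point in \<open>Q\<close> alone, so the fibre coordinates
  are unrestricted on overlaps.\<close>

lemma W0_chart_mem_iff:
  assumes w: "w \<in> fst (Wc k)"
  shows "w \<in> fst (Wc k') \<longleftrightarrow> jet_base (fst (fst w)) \<in> fst k'"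
proof -
  obtain \<mu> j where "w = (\<mu>, j)" "\<mu> \<in> fst (cc k)" "j \<in> M" "fst \<mu> = jet21 Q j"
    using w by (auto simp: W0_chart_def)
  then show ?thesis
    using tangent_chart_mem_iff[OF Q, of "fst \<mu>" k k']
        by (simp add: W0_chart_def cotangent_chart_mem_iff[OF TQ])
qed

lemma fst_W0_chart:
  assumes k: "k \<in> Q" and w: "w \<in> fst (Wc k)"
  shows "jet_base (fst (fst w)) \<in> fst k" "fst (snd (Wc k) w) = snd k (jet_base (fst (fst w)))"
proof -
  show x: "jet_base (fst (fst w)) \<in> fst k" using W0_chart_mem_iff[OF w] w by blast
  obtain \<mu> j q v p0 p1 a where 1: "w = (\<mu>, j)" "\<mu> \<in> fst (cc k)" "snd (cc k) \<mu> = ((q, v), (p0, p1))"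
      "snd (Wc k) w = (q, v, p0, p1, a)"
    by (rule W0_chartE[OF k w])
  then have t: "fst \<mu> \<in> fst (tc k)" "snd (tc k) (fst \<mu>) = (q, v)"
    using fst_cotangent_chart[OF TQ, of "tc k" \<mu>] by (simp_all add: cotangent_chart_mem_iff[OF TQ])
  show "fst (snd (Wc k) w) = snd k (jet_base (fst (fst w)))"
    by (rule tangent_chartE[OF Q k t(1)]) (use 1 t in simp)
qed

lemma overlap_W0_chart:
  assumes k: "k \<in> Q"
  shows "overlap (Wc k) (Wc k') = overlap k k' \<times> UNIV"
proof -
  have "y \<in> overlap k k' \<times> UNIV" if y: "y \<in> overlap (Wc k) (Wc k')" for y
  proof -
    obtain w where w: "w \<in> fst (Wc k)" "w \<in> fst (Wc k')" "y = snd (Wc k) w"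
      using y by (auto simp: overlap_def)
    then show ?thesis
      using fst_W0_chart[OF k w(1)] W0_chart_mem_iff[OF w(1), of k'] by (simp add: mem_Times_iff overlapI)
  qed
  moreover have "y \<in> overlap (Wc k) (Wc k')" if y: "fst y \<in> overlap k k'" for y
  proof -
    obtain q v p0 p1 a where yq: "y = (q, v, p0, p1, a)" by (metis prod_cases5)
    obtain x where x: "x \<in> fst k" "x \<in> fst k'" "q = snd k x"
      using y unfolding yq fst_conv by (rule overlapE[OF Q k])
    obtain w where w: "w \<in> fst (Wc k)" "snd (Wc k) w = y"
      unfolding yq by (rule W0_chartI[OF k]) (use x in auto)
    have "jet_base (fst (fst w)) = x"
      using fst_W0_chart[OF k w(1)] w(2) yq x inv_of_chart[OF Q k] by (metis fst_conv)
    then show ?thesis using W0_chart_mem_iff[OF w(1)] x(2) overlapI[OF w(1)] w(2) by metis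
  qed
  ultimately show ?thesis by (auto simp: mem_Times_iff)
qed

lemma W0_chart_image: "k \<in> Q \<Longrightarrow> snd (Wc k) ` fst (Wc k) = cdom k \<times> UNIV"
  using overlap_W0_chart[of k k] by (simp add: overlap_self)

text \<open>Local expression of the projection from \<open>W0\<close> to the cotangent bundle of
  \<open>TQ\<close>. It forgets the accelerations and, being linear, is its own derivative.\<close>

definition cotangent_part :: "'e \<times> 'e \<times> 'e \<times> 'e \<times> 'f \<Rightarrow> ('e \<times> 'e) \<times> ('e \<times> 'e)" where
  "cotangent_part = (\<lambda>(q, v, p0, p1, a). ((q, v), (p0, p1)))"

lemma bounded_linear_cotangent_part:
  "bounded_linear (cotangent_part :: 'e::euclidean_space \<times> 'e \<times> 'e \<times> 'e \<times> 'f::euclidean_space \<Rightarrow> _)"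
  unfolding linear_conv_bounded_linear[symmetric] cotangent_part_def
  by (auto intro!: linearI)

lemma cotangent_part_W0_chart:
  assumes k: "k \<in> Q" and w: "w \<in> fst (Wc k)"
  shows "fst w \<in> fst (cc k)" "snd (cc k) (fst w) = cotangent_part (snd (Wc k) w)"
proof -
  obtain \<mu> j q v p0 p1 a where 1: "w = (\<mu>, j)" "\<mu> \<in> fst (cc k)" "snd (cc k) \<mu> = ((q, v), (p0, p1))"
      "snd (Wc k) w = (q, v, p0, p1, a)"
    by (rule W0_chartE[OF k w])
  then show "fst w \<in> fst (cc k)" "snd (cc k) (fst w) = cotangent_part (snd (Wc k) w)"
    by (simp_all add: cotangent_part_def)
qed

text \<open>The second derivative of the transition map enters through the derivative of the tangent map in the
  direction \<open>(v, a)\<close>, a form whose smoothness is evident.\<close>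

lemma W0_chart_change:
  assumes k: "k \<in> Q" "k' \<in> Q"
  defines "\<psi> \<equiv> \<lambda>(q, v, p0, p1, a). ((\<lambda>((q', v'), (p0', p1')) a'. (q', v', p0', p1', a'))
      (transition (cc k) (cc k') ((q, v), (p0, p1)))
      (fst (fderiv (\<lambda>(q, v). fderiv (transition k k') q v) (q, v) (v, (a, G k (q, v, a))))))"
  shows "smooth_on \<psi> (overlap (Wc k) (Wc k'))"
    and "\<And>w. w \<in> fst (Wc k) \<Longrightarrow> w \<in> fst (Wc k') \<Longrightarrow> snd (Wc k') w = \<psi> (snd (Wc k) w)"
proof -
  let ?S = "overlap (Wc k) (Wc k')" and ?d = "\<lambda>y. fderiv (transition k k') (fst y) (snd y)"
  have ov: "overlap (Wc k) (Wc k') = overlap k k' \<times> UNIV" by (rule overlap_W0_chart[OF k(1)])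
  have opk: "open (overlap k k')" by (rule open_overlap[OF Q k])
  have op: "open ?S" using ov opk by (simp add: open_Times)
  have opTQ: "open (overlap k k' \<times> (UNIV :: ('r, 's) coords set))" using opk by (simp add: open_Times)
  have d: "smooth_on ?d (overlap k k' \<times> UNIV)"
    by (intro smooth_on_fderiv_apply[OF opTQ smooth_on_transition[OF Q k]] smooth opTQ opk) auto
  have "overlap (cc k) (cc k') = (overlap k k' \<times> UNIV) \<times> UNIV"
    by (simp add: overlap_cotangent_chart[OF TQ tc_in[OF k(1)]] overlap_tangent_chart[OF Q k])
  then have c: "smooth_on (transition (cc k) (cc k')) ((overlap k k' \<times> UNIV) \<times> UNIV)"
    using smooth_on_transition[OF T cc_in[OF k(1)] cc_in[OF k(2)]] by simp
  have opc: "open ((overlap k k' \<times> (UNIV :: ('r, 's) coords set)) \<times> (UNIV :: (('r, 's) coords \<times> ('r, 's)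
      coords) set))"
    using opTQ by (simp add: open_Times)
  have Gc: "smooth_on (G k) (cdom k \<times> UNIV \<times> UNIV)" by (rule smooth_on_G[OF k(1)])
  have sub: "overlap k k' \<subseteq> cdom k" by (rule overlap_subset)
  let ?t = "\<lambda>x. transition (cc k) (cc k') ((fst x, fst (snd x)), (fst (snd (snd x)), fst (snd (snd (snd x)))))"
  have t: "smooth_on ?t ?S"
    by (rule smooth_on_compose[OF op c opc]) (intro smooth op, auto simp: ov)
  have g: "smooth_on (\<lambda>x. G k (fst x, fst (snd x), snd (snd (snd (snd x))))) ?S"
    by (rule smooth_on_compose[OF op Gc open_coords[OF k(1)]]) (intro smooth op, use sub in \<open>auto simp: ov\<close>)
  have "smooth_on (\<lambda>x. fderiv ?d (fst x, fst (snd x))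
      (fst (snd x), (snd (snd (snd (snd x))), G k (fst x, fst (snd x), snd (snd (snd (snd x))))))) ?S"
    by (intro smooth_on_fderiv_apply[OF op d opTQ] smooth op g) (auto simp: ov)
  then have "smooth_on (\<lambda>x. (fst (fst (?t x)), snd (fst (?t x)), fst (snd (?t x)), snd (snd (?t x)),
      fst (fderiv ?d (fst x, fst (snd x)) (fst (snd x), (snd (snd (snd (snd x))), G k (fst x, fst (snd x), snd
          (snd (snd (snd x)))))))))  ?S"
    by (intro smooth op t)
  then show "smooth_on \<psi> ?S"
    unfolding \<psi>_def split_beta .
  fix w assume w: "w \<in> fst (Wc k)" and w': "w \<in> fst (Wc k')"
  obtain \<mu> j q v p0 p1 a where 1: "w = (\<mu>, j)" "\<mu> \<in> fst (cc k)" "j \<in> fst (Mc k)"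
    "snd (cc k) \<mu> = ((q, v), (p0, p1))" "snd (Mc k) j = (q, v, a)" "q \<in> cdom k"
        "snd (Wc k) w = (q, v, p0, p1, a)"
    by (rule W0_chartE[OF k(1) w])
  obtain \<mu>' j' q' v' p0' p1' a' where "w = (\<mu>', j')" "j' \<in> fst (Mc k')"
    "snd (cc k') \<mu>' = ((q', v'), (p0', p1'))" "snd (Mc k') j' = (q', v', a')"
        "snd (Wc k') w = (q', v', p0', p1', a')"
    by (rule W0_chartE[OF k(2) w'])
  then have 2: "j \<in> fst (Mc k')"
    "snd (cc k') \<mu> = ((q', v'), (p0', p1'))" "snd (Mc k') j = (q', v', a')"
        "snd (Wc k') w = (q', v', p0', p1', a')"
    using 1(1) by auto
  have tr: "transition (cc k) (cc k') ((q, v), (p0, p1)) = ((q', v'), (p0', p1'))"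
    using transition_chart[OF T cc_in[OF k(1)] 1(2), of "cc k'"] 1(4) 2(2) by simp
  note d1 = constraint_chartD[OF k(1) 1(3,5)] and d2 = constraint_chartD[OF k(2) 2(1,3)]
  have x': "jet_base j \<in> fst k'" using jet2_chart_rep[OF Q k(2) d2(2)] by simp
  have "jet_base j \<in> fst k" "snd k (jet_base j) = q"
    using jet2_chart_rep[OF Q k(1) d1(2)] d1(3) by simp_all
  with x' have qo: "q \<in> overlap k k'" using overlapI by metis
  \<comment> \<open>On \<open>M\<close> the full acceleration is \<open>(a, G k (q, v, a))\<close>;
    the second-order law applies to the whole of it, and only the first component is kept.\<close>
  have "(a', G k' (q', v', a')) = fderiv (\<lambda>z. fderiv (transition k k') z v) q v + fderiv (transition k k') q
      (a, G k (q, v, a))"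
    using trans[OF d2(3)[symmetric] jet2_chart_change[OF Q k(1) d1(2) k(2) x' d1(3)]]
    unfolding prod.inject by blast
  then have "a' = fst (fderiv (\<lambda>z. fderiv (transition k k') z v) q v + fderiv (transition k k') q (a, G k (q,
      v, a)))"
    by (metis fst_conv)
  also have "fderiv (\<lambda>z. fderiv (transition k k') z v) q v + fderiv (transition k k') q (a, G k (q, v, a))
      = fderiv ?d (q, v) (v, (a, G k (q, v, a)))"
  proof -
    have "(?d has_derivative (\<lambda>h. fderiv (\<lambda>z. fderiv (transition k k') z (snd (q, v))) (fst (q, v)) (fst h)
        + fderiv (transition k k') (fst (q, v)) (snd h))) (at (q, v))"
      using qo
      by (intro has_derivative_fderiv_apply[OF smooth_on_transition[OF Q k] opk _ has_derivative_fst[OF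
          has_derivative_ident]
            has_derivative_snd[OF has_derivative_ident]]) simp
    from fderiv_eqI[OF this] show ?thesis by simp
  qed
  finally show "snd (Wc k') w = \<psi> (snd (Wc k) w)"
    unfolding \<psi>_def 1(7) 2(4) split_beta fst_conv snd_conv tr by simp
qed

lemma smooth_atlas_W0: "smooth_atlas W"
proof (rule smooth_atlasI; unfold W0_def; elim imageE; hypsubst)
  fix k assume k: "k \<in> Q"
  show "inj_on (snd (Wc k)) (fst (Wc k))" by (rule inj_on_W0_chart[OF k])
  show "open (snd (Wc k) ` fst (Wc k))" using W0_chart_image[OF k] open_chart[OF Q k] by (simp add: open_Times)
  fix k' assume k': "k' \<in> Q"
  show "open (overlap (Wc k) (Wc k'))" using overlap_W0_chart[OF k, of k'] open_overlap[OF Q k k']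
      by (simp add: open_Times)
  show "\<exists>\<psi>. smooth_on \<psi> (overlap (Wc k) (Wc k'))
      \<and> (\<forall>w\<in>fst (Wc k) \<inter> fst (Wc k'). snd (Wc k') w = \<psi> (snd (Wc k) w))"
    using W0_chart_change[OF k k'] by blast
qed

lemma W0_chart_in: "k \<in> Q \<Longrightarrow> Wc k \<in> W"
  by (simp add: W0_def)

lemma open_W0_image: "k \<in> Q \<Longrightarrow> open (snd (Wc k) ` fst (Wc k))"
  by (rule open_chart[OF smooth_atlas_W0 W0_chart_in])

lemma Omega_W0_coord_vector:
  assumes k: "k \<in> Q" and w: "w \<in> fst (Wc k)"
  shows "Omega_W0 A1 A2 (coord_vector W (Wc k) (q, v, p0, p1, a) w) (coord_vector W (Wc k) (q', v', p0', p1',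
      a') w) =
    (q, v) \<bullet> (p0', p1') - (q', v') \<bullet> (p0, p1)"
proof -
  have F: "smooth_on cotangent_part (snd (Wc k) ` fst (Wc k))"
    by (rule smooth_on_bounded_linear[OF open_W0_image[OF k] bounded_linear_cotangent_part smooth_on_ident])
  have "fderiv cotangent_part y = cotangent_part"
      for y :: "('r, 's) coords \<times> ('r, 's) coords \<times> ('r, 's) coords \<times> ('r, 's) coords \<times> (real^'r)"
    by (rule fderiv_eqI[OF bounded_linear_imp_has_derivative[OF bounded_linear_cotangent_part]])
  then have "tangent_map T fst (coord_vector W (Wc k) u w)
      = coord_vector T (cc k) (cotangent_part u) (fst w)" for u
    using tangent_map_coord_vector[OF smooth_atlas_W0 W0_chart_in[OF k] T cc_in[OF k] w F, of fst u]
    by (simp add: cotangent_part_W0_chart[OF k])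
  then show ?thesis
    using canonical_form_coord_vector[OF TQ tc_in[OF k] cotangent_part_W0_chart(1)[OF k w], of "(q, v)"
        "(p0, p1)" "(q', v')" "(p0', p1')"]
    by (simp add: Omega_W0_def pullback2_def cotangent_part_def)
qed

lemma kernel_Omega_W0:
  assumes k: "k \<in> Q" and w: "w \<in> fst (Wc k)"
  shows "form2_kernel W (Omega_W0 A1 A2) w = range (\<lambda>a. coord_vector W (Wc k) (0, 0, 0, 0, a) w)"
proof -
  have ts: "tangent_space W w = range (\<lambda>u. coord_vector W (Wc k) u w)"
    by (rule tangent_space_eq[OF smooth_atlas_W0 W0_chart_in[OF k] w])
  have "coord_vector W (Wc k) (0, 0, 0, 0, a) w \<in> form2_kernel W (Omega_W0 A1 A2) w" for a
    by (auto simp: form2_kernel_def ts Omega_W0_coord_vector[OF k w] inner_prod_def)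
  moreover have "V \<in> range (\<lambda>a. coord_vector W (Wc k) (0, 0, 0, 0, a) w)"
    if V: "V \<in> form2_kernel W (Omega_W0 A1 A2) w" for V
  proof -
    obtain u where u: "V = coord_vector W (Wc k) u w" using V ts by (auto simp: form2_kernel_def)
    obtain q v p0 p1 a where uq: "u = (q, v, p0, p1, a)" by (metis prod_cases5)
    have 0: "(q, v) \<bullet> (p0', p1') - (q', v') \<bullet> (p0, p1) = 0" for q' v' p0' p1'
    proof -
      have "Omega_W0 A1 A2 V (coord_vector W (Wc k) (q', v', p0', p1', 0) w) = 0"
        using V unfolding form2_kernel_def ts by blast
      then show ?thesis by (simp add: u uq Omega_W0_coord_vector[OF k w])
    qed
    \<comment> \<open>The test vector with momenta \<open>(q, v)\<close> turns the pairing into a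
      squared norm; the next step does the same with \<open>(p0, p1)\<close> as base vector.\<close>
    have "(q, v) = 0" using 0[where p0'=q and p1'=v and q'=0 and v'=0]
      by (simp only: zero_prod_def[symmetric] inner_zero_left diff_zero inner_eq_zero_iff)
    moreover have "(p0, p1) = 0" using 0[where q'=p0 and v'=p1 and p0'=0 and p1'=0]
      by (simp only: zero_prod_def[symmetric] inner_zero_right diff_0 neg_equal_0_iff_equal inner_eq_zero_iff)
    ultimately show ?thesis using u uq by (auto simp: zero_prod_def)
  qed
  ultimately show ?thesis by blast
qed

section \<open>The Hamiltonian and the local equations of \<open>W1\<close>\<close>

definition "H_loc k = (\<lambda>(q, v, p0, p1, a). p0 \<bullet> v + p1 \<bullet> (a, G k (q, v, a)) - LM k (q, v, a))"

text \<open>The embedded 2-jet has components \<open>v\<close> and the full acceleration, whose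
  dependent part is given by \<open>G k\<close>; this turns the pairing into the two momentum terms
  of \<open>H_loc\<close>.\<close>

lemma H_W0_eq:
  assumes k: "k \<in> Q" and w: "w \<in> fst (Wc k)"
  shows "H_W0 A1 A2 L C w = H_loc k (snd (Wc k) w)"
proof -
  obtain \<mu> j q v p0 p1 a where 1: "w = (\<mu>, j)" "\<mu> \<in> fst (cc k)" "j \<in> fst (Mc k)"
    "fst \<mu> = jet21 Q j" "snd (cc k) \<mu> = ((q, v), (p0, p1))" "snd (Mc k) j = (q, v, a)"
        "snd (Wc k) w = (q, v, p0, p1, a)"
    by (rule W0_chartE[OF k w])
  note d = constraint_chartD[OF k 1(3,6)]
  have m: "jet21 Q j \<in> fst (tc k)" "snd \<mu> \<in> cotangent_space (TQ A1 A2) (jet21 Q j)"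
    using 1(2,4) by (simp_all add: cotangent_chart_mem_iff[OF TQ])
  have "snd \<mu> (jet2_embed Q j) = (p0, p1) \<bullet> (v, (a, G k (q, v, a)))"
  proof -
    have "(jet21 Q j, snd \<mu>) = \<mu>" by (simp add: 1(4)[symmetric])
    then show ?thesis
      unfolding jet2_embed_coord_vector[OF Q k d(2,3), folded TQ_def]
      using cotangent_apply[OF TQ tc_in[OF k] m] 1(5) by simp
  qed
  then show ?thesis
    using LM_eq_cost[OF k 1(3)] 1(6,7) by (simp add: H_W0_def 1(1) H_loc_def split_beta)
qed

lemma smooth_on_H_loc:
  assumes k: "k \<in> Q"
  shows "smooth_on (H_loc k) (snd (Wc k) ` fst (Wc k))"
proof -
  let ?S = "snd (Wc k) ` fst (Wc k)"
  note op = open_W0_image[OF k]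
  have sub: "fst x \<in> cdom k" if "x \<in> ?S" for x
    using that W0_chart_image[OF k] by (auto simp: mem_Times_iff)
  have 1: "smooth_on (\<lambda>x. G k (fst x, fst (snd x), snd (snd (snd (snd x))))) ?S"
    by (rule smooth_on_compose[OF op smooth_on_G[OF k] open_coords[OF k]]) (intro smooth op, use sub in auto)
  have 2: "smooth_on (\<lambda>x. LM k (fst x, fst (snd x), snd (snd (snd (snd x))))) ?S"
    by (rule smooth_on_compose[OF op smooth_on_LM[OF k] open_coords[OF k]]) (intro smooth op, use sub in auto)
  show ?thesis unfolding H_loc_def split_beta by (intro smooth op 1 2)
qed

text \<open>\<open>W\<^sub>1\<close> is the graph \<open>p\<^sup>1\<^sub>a = p1a (q, v, a, p\<^sup>1\<^sub>\<alpha>)\<close>.\<close>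

definition "p1a k = (\<lambda>(q, v, a, p). \<Sum>b\<in>Basis.
  (fderiv (LM k) (q, v, a) (0, 0, b) - p \<bullet> fderiv (G k) (q, v, a) (0, 0, b)) *\<^sub>R b)"

text \<open>The sum over \<open>Basis\<close> in \<open>p1a\<close> is the vector representing a
  linear form, so pairing it with an arbitrary \<open>b\<close> gives the form back.\<close>

lemma p1a_inner:
  assumes k: "k \<in> Q" and q: "q \<in> cdom k"
  shows "p1a k (q, v, a, p) \<bullet> b = fderiv (LM k) (q, v, a) (0, 0, b) - p \<bullet> fderiv (G k) (q, v, a) (0, 0, b)"
proof -
  let ?f = "\<lambda>b. fderiv (LM k) (q, v, a) (0, 0, b) - p \<bullet> fderiv (G k) (q, v, a) (0, 0, b)"
  have x: "(q, v, a) \<in> cdom k \<times> UNIV \<times> UNIV" using q by simp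
  have "linear ?f"
    using linear_fderiv[OF smooth_on_LM[OF k] x] linear_fderiv[OF smooth_on_G[OF k] x]
    by (intro linearI)
      (simp_all add: linear_add[of _ "(0, 0, _)" "(0, 0, _)", simplified] linear_scale[of _ _
          "(0, 0, _)", simplified] inner_add_right algebra_simps)
  then have "?f b = (\<Sum>c\<in>Basis. (b \<bullet> c) *\<^sub>R ?f c)" by (rule linear_eq_sum_Basis)
  also have "\<dots> = p1a k (q, v, a, p) \<bullet> b"
    unfolding p1a_def prod.case inner_sum_left inner_scaleR_left
    by (intro sum.cong) (simp_all add: inner_commute)
  finally show ?thesis by simp
qed

text \<open>Along a kernel direction only the accelerations vary. The momentum \<open>p1\<close>
  pairs with \<open>b\<close> and with the induced change of \<open>G\<close>, and the second
  contribution is absorbed into \<open>p1a\<close>.\<close>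

lemma differential_H_W0:
  assumes k: "k \<in> Q" and w: "w \<in> fst (Wc k)" and c: "snd (Wc k) w = (q, v, p0, p1, a)"
  shows "differential (H_W0 A1 A2 L C) (coord_vector W (Wc k) (0, 0, 0, 0, b) w) =
    (fst p1 - p1a k (q, v, a, snd p1)) \<bullet> b"
proof -
  have "snd (Wc k) w \<in> cdom k \<times> UNIV" using W0_chart_image[OF k] w by blast
  then have q: "q \<in> cdom k" by (simp add: c)
  then have x: "(q, v, a) \<in> cdom k \<times> UNIV \<times> UNIV" by simp
  have "differential (H_W0 A1 A2 L C) (coord_vector W (Wc k) (0, 0, 0, 0, b) w)
      = fderiv (H_loc k) (snd (Wc k) w) (0, 0, 0, 0, b)"
    by (rule differential_coord_vector[OF smooth_atlas_W0 W0_chart_in[OF k] w smooth_on_H_loc[OF k] H_W0_eq[OF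
        k]])
  also have "fderiv (H_loc k) (snd (Wc k) w) (0, 0, 0, 0, b) =
      p1 \<bullet> (b, fderiv (G k) (q, v, a) (0, 0, b)) - fderiv (LM k) (q, v, a) (0, 0, b)"
  proof -
    let ?h = "\<lambda>h. (fst h, fst (snd h), snd (snd (snd (snd h))))"
    have h: "(?h has_derivative ?h) (at y)" for y ::
        "('r, 's) coords \<times> ('r, 's) coords \<times> ('r, 's) coords \<times> ('r, 's) coords \<times> (real^'r)"
      by (intro has_derivative_Pair has_derivative_fst has_derivative_snd has_derivative_ident)
    have "(H_loc k has_derivative (\<lambda>h.
        (p0 \<bullet> fst (snd h) + fst (snd (snd h)) \<bullet> v)
        + (p1 \<bullet> (snd (snd (snd (snd h))), fderiv (G k) (q, v, a) (?h h)) + fst (snd (snd (snd h)))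
            \<bullet> (a, G k (q, v, a)))
        - fderiv (LM k) (q, v, a) (?h h))) (at (q, v, p0, p1, a))"
      unfolding H_loc_def split_beta
      by (rule has_derivative_eq_rhs[OF has_derivative_diff[OF has_derivative_add[OF has_derivative_inner
          has_derivative_inner[OF _ has_derivative_Pair[OF _
                has_derivative_compose[OF h smooth_on_has_derivative[OF smooth_on_G[OF k]]]]]]
              has_derivative_compose[OF h smooth_on_has_derivative[OF smooth_on_LM[OF k]]]]])
        (use x in \<open>auto intro!: has_derivative_fst has_derivative_snd has_derivative_ident\<close>)
    from fderiv_eqI[OF this] show ?thesis by (simp add: c)
  qed
  also have "\<dots> = (fst p1 - p1a k (q, v, a, snd p1)) \<bullet> b"
    by (simp add: inner_diff_left p1a_inner[OF k q] inner_prod_def)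
  finally show ?thesis .
qed

text \<open>A vector orthogonal to every direction \<open>b\<close> vanishes, so the condition on
  the kernel becomes a single vector equation.\<close>

lemma W1_points_iff:
  assumes k: "k \<in> Q" and w: "w \<in> fst (Wc k)" and c: "snd (Wc k) w = (q, v, p0, p1, a)"
  shows "w \<in> W1_points A1 A2 L C \<longleftrightarrow> fst p1 = p1a k (q, v, a, snd p1)"
proof -
  have "w \<in> points W" using W0_chart_in[OF k] w by (auto simp: points_def)
  then have "w \<in> W1_points A1 A2 L C \<longleftrightarrow> (\<forall>b. (fst p1 - p1a k (q, v, a, snd p1)) \<bullet> b = 0)"
    by (simp add: W1_points_def kernel_Omega_W0[OF k w] differential_H_W0[OF assms])
  also have "\<dots> \<longleftrightarrow> fst p1 = p1a k (q, v, a, snd p1)"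
    by (metis inner_eq_zero_iff inner_zero_left right_minus_eq)
  finally show ?thesis .
qed

end

section \<open>Symplecticity of the final constraint manifold\<close>

text \<open>The 2-form \<open>dx\<^sup>i \<and> d\<sigma>\<^sub>i\<close>, where the linear map \<open>b\<close> gives the components \<open>dx\<^sup>i\<close>.\<close>

context
  fixes b :: "'a::euclidean_space \<Rightarrow> 'c::euclidean_space" and \<sigma> :: "'a \<Rightarrow> 'c" and S
  assumes b: "linear b" and \<sigma>: "smooth_on \<sigma> S" and S: "open S"
begin

abbreviation "tform y u v \<equiv> b u \<bullet> fderiv \<sigma> y v - b v \<bullet> fderiv \<sigma> y u"

lemma bilinear_tform:
  assumes "y \<in> S"
  shows "bilinear (tform y)"
  unfolding bilinear_def
  using linear_fderiv[OF \<sigma> assms] b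
  by (auto intro!: linearI simp: linear_add linear_scale inner_add_left inner_add_right algebra_simps)

lemma smooth_on_tform: "smooth_on (\<lambda>y. tform y u v) S"
  by (intro smooth S smooth_on_fderiv[OF \<sigma>])

text \<open>As \<open>b\<close> is linear and independent of the point, only second derivatives of
  \<sigma> occur; in the cyclic sum each appears twice with opposite signs once its arguments are
  exchanged.\<close>

lemma closed_tform:
  assumes y: "y \<in> S"
  shows "fderiv (\<lambda>y. tform y v w) y u + fderiv (\<lambda>y. tform y w u) y v + fderiv (\<lambda>y. tform y u v) y w = 0"
proof -
  let ?D = "\<lambda>u v. fderiv (\<lambda>y. fderiv \<sigma> y u) y v"
  have 1: "fderiv (\<lambda>y. tform y u v) y w = b u \<bullet> ?D v w - b v \<bullet> ?D u w" for u v w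
  proof -
    have "((\<lambda>y. tform y u v) has_derivative (\<lambda>w. b u \<bullet> ?D v w - b v \<bullet> ?D u w)) (at y)"
      by (intro has_derivative_diff has_derivative_inner_right smooth_on_has_derivative[OF smooth_on_fderiv[OF
          \<sigma>] y])
    from fderiv_eqI[OF this] show ?thesis by simp
  qed
  have "?D u v = ?D v u" for u v by (rule fderiv_symmetric[OF \<sigma> S y])
  from this[of u v] this[of v w] this[of u w] show ?thesis unfolding 1 by simp
qed

end

context control_system
begin

section \<open>Charts of \<open>W1\<close>\<close>

abbreviation "W1c \<equiv> W1_chart A1 A2 L C"
abbreviation "Z \<equiv> W1 A1 A2 L C"

text \<open>The pulled-back momenta. They are the map \<sigma> for which the form on
  \<open>W1\<close> becomes an instance of the general 2-form above, with \<open>W1_base\<close> as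
  the linear map.\<close>

definition "momenta k = (\<lambda>(q, v, a, p0 :: ('r, 's) coords, p). (p0, (p1a k (q, v, a, p), p)))"
text \<open>Local expression of the inclusion into \<open>W0\<close>. The accelerations stand third
  in the coordinates of \<open>W1\<close> and last in those of \<open>W0\<close>.\<close>

definition "W1_incl k = (\<lambda>y. (fst y, fst (snd y), fst (momenta k y), snd (momenta k y), fst (snd (snd y))))"

lemma W1_incl_simp: "W1_incl k (q, v, a, p0, p) = (q, v, p0, (p1a k (q, v, a, p), p), a)"
  by (simp add: W1_incl_def momenta_def)

lemma W1_chart_mem: "w \<in> fst (W1c k) \<longleftrightarrow> w \<in> W1_points A1 A2 L C \<and> w \<in> fst (Wc k)"
  by (simp add: W1_chart_def)

definition "W1_proj = (\<lambda>(q, v, p0, p1, a). (q, v, a, p0, snd p1))"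

lemma snd_W1_chart: "snd (W1c k) w = W1_proj (snd (Wc k) w)"
  by (simp add: W1_chart_def W1_proj_def)

lemma W0_chart_on_W1:
  assumes k: "k \<in> Q" and w: "w \<in> fst (W1c k)"
  shows "snd (Wc k) w = W1_incl k (snd (W1c k) w)"
proof -
  obtain q v p0 p1 a where c: "snd (Wc k) w = (q, v, p0, p1, a)" by (metis prod_cases5)
  have "fst p1 = p1a k (q, v, a, snd p1)"
    using w W1_points_iff[OF k _ c] by (simp add: W1_chart_mem)
  then show ?thesis by (simp add: c snd_W1_chart W1_proj_def W1_incl_simp prod_eq_iff)
qed

lemma fst_W1_chart: "fst (snd (W1c k) w) = fst (snd (Wc k) w)"
  by (simp add: snd_W1_chart W1_proj_def split_beta)

lemma W1_chartI:
  assumes k: "k \<in> Q" and y: "fst y \<in> cdom k"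
  obtains w where "w \<in> fst (W1c k)" "snd (W1c k) w = y"
proof -
  obtain q v a p0 p where yq: "y = (q, v, a, p0, p)" by (metis prod_cases5)
  obtain w where w: "w \<in> fst (Wc k)" "snd (Wc k) w = (q, v, p0, (p1a k (q, v, a, p), p), a)"
    using y unfolding yq fst_conv by (rule W0_chartI[OF k])
  have "w \<in> W1_points A1 A2 L C" using W1_points_iff[OF k w] by simp
  then show ?thesis using that[of w] w by (simp add: W1_chart_mem snd_W1_chart W1_proj_def yq)
qed

lemma inj_on_W1_chart: "k \<in> Q \<Longrightarrow> inj_on (snd (W1c k)) (fst (W1c k))"
  by (rule inj_onI) (metis W0_chart_on_W1 W1_chart_mem inj_onD inj_on_W0_chart)

lemma overlap_W1_chart:
  assumes k: "k \<in> Q" "k' \<in> Q"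
  shows "overlap (W1c k) (W1c k') = overlap k k' \<times> UNIV"
proof -
  have "y \<in> overlap k k' \<times> UNIV" if y: "y \<in> overlap (W1c k) (W1c k')" for y
  proof -
    obtain w where w: "w \<in> fst (W1c k)" "w \<in> fst (W1c k')" "y = snd (W1c k) w"
      using y by (auto simp: overlap_def)
    then have "snd (Wc k) w \<in> overlap (Wc k) (Wc k')" by (intro overlapI) (simp_all add: W1_chart_mem)
    then show ?thesis using w(3) by (simp add: overlap_W0_chart[OF k(1)] mem_Times_iff fst_W1_chart)
  qed
  moreover have "y \<in> overlap (W1c k) (W1c k')" if y: "fst y \<in> overlap k k'" for y
  proof -
    have yd: "fst y \<in> cdom k" by (rule subsetD[OF overlap_subset y])
    obtain w where w: "w \<in> fst (W1c k)" "snd (W1c k) w = y" by (rule W1_chartI[OF k(1) yd])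
    have w0: "w \<in> fst (Wc k)" "w \<in> W1_points A1 A2 L C" using w(1) by (simp_all add: W1_chart_mem)
    have "snd (Wc k) w \<in> overlap (Wc k) (Wc k')"
      using y w(2) by (simp add: overlap_W0_chart[OF k(1)] mem_Times_iff fst_W1_chart[symmetric])
    then obtain w' where w': "w' \<in> fst (Wc k)" "w' \<in> fst (Wc k')" "snd (Wc k) w' = snd (Wc k) w"
      by (auto simp: overlap_def)
    then have "w' = w" using inj_onD[OF inj_on_W0_chart[OF k(1)] _ w'(1) w0(1)] by simp
    then have "w \<in> fst (W1c k')" using w0 w'(2) by (simp add: W1_chart_mem)
    from overlapI[OF w(1) this] show ?thesis using w(2) by simp
  qed
  ultimately show ?thesis by (auto simp: mem_Times_iff)
qed

lemma W1_chart_image: "k \<in> Q \<Longrightarrow> snd (W1c k) ` fst (W1c k) = cdom k \<times> UNIV"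
  using overlap_W1_chart[of k k] by (simp add: overlap_self)

lemma open_p1a_domain: "k \<in> Q \<Longrightarrow> open (cdom k \<times> (UNIV :: (('r, 's) coords \<times> (real^'r) \<times> (real^'s)) set))"
  by (intro open_Times open_chart[OF Q] open_UNIV)

lemma smooth_on_p1a:
  assumes k: "k \<in> Q"
  shows "smooth_on (p1a k) (cdom k \<times> UNIV)"
  unfolding p1a_def split_beta
  by (intro smooth open_p1a_domain k smooth_on_fderiv_apply[OF open_p1a_domain[OF k] smooth_on_G[OF k]
      open_coords[OF k]]
      smooth_on_fderiv_apply[OF open_p1a_domain[OF k] smooth_on_LM[OF k] open_coords[OF k]]) auto

lemma open_W1_domain:
  "k \<in> Q \<Longrightarrow> open (cdom k \<times> (UNIV :: (('r, 's) coords \<times> (real^'r) \<times> ('r, 's) coords \<times> (real^'s)) set))"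
  by (intro open_Times open_chart[OF Q] open_UNIV)

lemma smooth_on_momenta:
  assumes k: "k \<in> Q"
  shows "smooth_on (momenta k) (cdom k \<times> UNIV)"
proof -
  let ?S = "cdom k \<times> (UNIV :: (('r, 's) coords \<times> (real^'r) \<times> ('r, 's) coords \<times> (real^'s)) set)"
  have P: "smooth_on (\<lambda>y. p1a k (fst y, fst (snd y), fst (snd (snd y)), snd (snd (snd (snd y))))) ?S"
    by (rule smooth_on_compose[OF open_W1_domain[OF k] smooth_on_p1a[OF k] open_p1a_domain[OF k]])
      (intro smooth open_W1_domain[OF k], auto)
  show ?thesis unfolding momenta_def split_beta by (intro smooth open_W1_domain[OF k] P)
qed

lemma smooth_on_W1_incl:
  assumes k: "k \<in> Q"
  shows "smooth_on (W1_incl k) (cdom k \<times> UNIV)"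
  unfolding W1_incl_def by (intro smooth open_W1_domain[OF k] smooth_on_momenta[OF k])

text \<open>A transition of \<open>W1\<close> is the one of \<open>W0\<close> read on the graph:
  include, change the chart, forget the dependent momenta.\<close>

lemma smooth_atlas_W1: "smooth_atlas Z"
proof (rule smooth_atlasI; unfold W1_def; elim imageE; hypsubst)
  fix k assume k: "k \<in> Q"
  show "inj_on (snd (W1c k)) (fst (W1c k))" by (rule inj_on_W1_chart[OF k])
  show "open (snd (W1c k) ` fst (W1c k))" using W1_chart_image[OF k] open_W1_domain[OF k] by simp
  fix k' assume k': "k' \<in> Q"
  show op: "open (overlap (W1c k) (W1c k'))"
    using overlap_W1_chart[OF k k'] open_overlap[OF Q k k'] by (simp add: open_Times)
  obtain \<psi> where \<psi>: "smooth_on \<psi> (overlap (Wc k) (Wc k'))"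
    "\<And>w. w \<in> fst (Wc k) \<Longrightarrow> w \<in> fst (Wc k') \<Longrightarrow> snd (Wc k') w = \<psi> (snd (Wc k) w)"
    using W0_chart_change[OF k k'] by blast
  have sub: "overlap (W1c k) (W1c k') \<subseteq> cdom k \<times> UNIV"
    unfolding overlap_W1_chart[OF k k'] by (intro Sigma_mono overlap_subset) simp
  have op0: "open (overlap (Wc k) (Wc k'))"
    by (rule open_overlap[OF smooth_atlas_W0 W0_chart_in[OF k] W0_chart_in[OF k']])
  have "smooth_on (\<lambda>y. \<psi> (W1_incl k y)) (overlap (W1c k) (W1c k'))"
    by (rule smooth_on_compose[OF op \<psi>(1) op0 smooth_on_subset[OF smooth_on_W1_incl[OF k] sub]])
      (auto simp: overlap_W1_chart[OF k k'] overlap_W0_chart[OF k] W1_incl_def)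
  then have "smooth_on (\<lambda>y. W1_proj (\<psi> (W1_incl k y))) (overlap (W1c k) (W1c k'))"
    unfolding W1_proj_def split_beta by (intro smooth op)
  moreover have "\<forall>w\<in>fst (W1c k) \<inter> fst (W1c k'). snd (W1c k') w = W1_proj (\<psi> (W1_incl k (snd (W1c k) w)))"
    using W0_chart_on_W1[OF k] by (auto simp: snd_W1_chart[of k'] W1_chart_mem \<psi>(2))
  ultimately show "\<exists>\<psi>. smooth_on \<psi> (overlap (W1c k) (W1c k'))
      \<and> (\<forall>w\<in>fst (W1c k) \<inter> fst (W1c k'). snd (W1c k') w = \<psi> (snd (W1c k) w))"
    by (intro exI[of _ "\<lambda>y. W1_proj (\<psi> (W1_incl k y))"]) blast
qed

lemma W1_chart_in: "k \<in> Q \<Longrightarrow> W1c k \<in> Z"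
  by (simp add: W1_def)

section \<open>The pulled-back form in coordinates\<close>

abbreviation W1_base :: "('r, 's) coords \<times> ('r, 's) coords \<times> (real^'r) \<times> ('r, 's) coords \<times> (real^'s) \<Rightarrow> ('r, 's)
    coords \<times> ('r, 's) coords"
  where "W1_base u \<equiv> (fst u, fst (snd u))"

abbreviation "W1_form k y u v \<equiv> W1_base u \<bullet> fderiv (momenta k) y v - W1_base v \<bullet> fderiv (momenta k) y u"

text \<open>The inclusion keeps positions and velocities and inserts \<open>momenta k\<close>, so
  substituting its derivative into the form on \<open>W0\<close> yields
  \<open>W1_form\<close>.\<close>

lemma Omega_W1_coord_vector:
  assumes k: "k \<in> Q" and w: "w \<in> fst (W1c k)"
  shows "Omega_W1 A1 A2 L (coord_vector Z (W1c k) u w) (coord_vector Z (W1c k) v w)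
      = W1_form k (snd (W1c k) w) u v"
proof -
  let ?y = "snd (W1c k) w"
  let ?D = "\<lambda>u. (fst u, fst (snd u), fst (fderiv (momenta k) ?y u), snd (fderiv (momenta k) ?y u), fst (snd
      (snd u)))"
  have w0: "w \<in> fst (Wc k)" using w by (simp add: W1_chart_mem)
  have y: "?y \<in> cdom k \<times> UNIV" using W1_chart_image[OF k] w by blast
  have "(W1_incl k has_derivative ?D) (at ?y)"
    unfolding W1_incl_def
    by (intro has_derivative_Pair has_derivative_fst has_derivative_snd has_derivative_ident
        smooth_on_has_derivative[OF smooth_on_momenta[OF k] y])
  then have D: "fderiv (W1_incl k) ?y = ?D" by (rule fderiv_eqI)
  have "tangent_map W (\<lambda>w. w) (coord_vector Z (W1c k) u w)
      = coord_vector W (Wc k) (fderiv (W1_incl k) ?y u) w" for u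
    by (rule tangent_map_coord_vector[OF smooth_atlas_W1 W1_chart_in[OF k] smooth_atlas_W0 W0_chart_in[OF k] w])
      (simp_all add: W1_chart_image[OF k] smooth_on_W1_incl[OF k] W0_chart_on_W1[OF k], simp add: W1_chart_mem)
  then show ?thesis
    by (simp add: Omega_W1_def pullback2_def D Omega_W0_coord_vector[OF k w0])
qed

lemma linear_W1_base: "linear W1_base"
  by (auto intro!: linearI)

lemma form2_in_W1_chart:
  assumes k: "k \<in> Q" and y: "y \<in> snd (W1c k) ` fst (W1c k)"
  shows "form2_in_chart Z (W1c k) (Omega_W1 A1 A2 L) y u v = W1_form k y u v"
  using Omega_W1_coord_vector[OF k chart_inv_in[OF y]]
  by (simp add: form2_in_chart_def chart_of_inv[OF y])

lemma is_form2_Omega_W1: "is_form2 Z (Omega_W1 A1 A2 L)"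
  unfolding is_form2_def
proof
  fix l assume "l \<in> Z"
  then obtain k where k: "k \<in> Q" and l: "l = W1c k" by (auto simp: W1_def)
  note img = W1_chart_image[OF k]
  note t = linear_W1_base smooth_on_momenta[OF k] open_W1_domain[OF k]
  have "bilinear (form2_in_chart Z (W1c k) (Omega_W1 A1 A2 L) y) \<and>
      (\<forall>u. form2_in_chart Z (W1c k) (Omega_W1 A1 A2 L) y u u = 0)" if y: "y
          \<in> snd (W1c k) ` fst (W1c k)" for y
  proof -
    have "y \<in> cdom k \<times> UNIV" using y img by blast
    moreover have "form2_in_chart Z (W1c k) (Omega_W1 A1 A2 L) y = W1_form k y"
      by (intro ext form2_in_W1_chart[OF k y])
    ultimately show ?thesis using bilinear_tform[OF t] by simp
  qed
  moreover have "smooth_on (\<lambda>y. form2_in_chart Z (W1c k) (Omega_W1 A1 A2 L) y u v) (snd (W1c k) ` fst (W1c k))"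
      for u v
    by (rule smooth_on_cong_imp[of _ "\<lambda>y. W1_form k y u v"])
      (use smooth_on_tform[OF t] form2_in_W1_chart[OF k] img t(3) in simp_all)
  ultimately show "(\<forall>y\<in>snd l ` fst l. bilinear (form2_in_chart Z l (Omega_W1 A1 A2 L) y) \<and>
      (\<forall>u. form2_in_chart Z l (Omega_W1 A1 A2 L) y u u = 0)) \<and>
      (\<forall>u v. smooth_on (\<lambda>y. form2_in_chart Z l (Omega_W1 A1 A2 L) y u v) (snd l ` fst l))"
    unfolding l by blast
qed

lemma closed_form2_Omega_W1: "closed_form2 Z (Omega_W1 A1 A2 L)"
  unfolding closed_form2_def
proof (intro ballI allI)
  fix l y u v w assume "l \<in> Z" and yl: "y \<in> snd l ` fst l"
  then obtain k where k: "k \<in> Q" and l: "l = W1c k" by (auto simp: W1_def)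
  note y = yl[unfolded l]
  note img = W1_chart_image[OF k]
  note t = linear_W1_base smooth_on_momenta[OF k] open_W1_domain[OF k]
  have yd: "y \<in> cdom k \<times> UNIV" using y img by blast
  \<comment> \<open>The chart expression is known to agree with \<open>W1_form\<close> on the open
    coordinate domain, which is enough for equal derivatives.\<close>
  have eq: "fderiv (\<lambda>y. form2_in_chart Z (W1c k) (Omega_W1 A1 A2 L) y u v) y
      = fderiv (\<lambda>y. W1_form k y u v) y" for u v
    by (rule fderiv_cong[OF t(3) yd smooth_on_tform[OF t], symmetric]) (use form2_in_W1_chart[OF k] img in simp)
  show "fderiv (\<lambda>y. form2_in_chart Z l (Omega_W1 A1 A2 L) y v w) y u
      + fderiv (\<lambda>y. form2_in_chart Z l (Omega_W1 A1 A2 L) y w u) y v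
      + fderiv (\<lambda>y. form2_in_chart Z l (Omega_W1 A1 A2 L) y u v) y w = 0"
    unfolding l eq by (rule closed_tform[OF t yd])
qed

text \<open>Since \<open>coord_vector\<close> is a bijection onto the tangent space, triviality of
  the kernel becomes a statement about component vectors.\<close>

lemma kernel_Omega_W1_trivial_iff:
  assumes k: "k \<in> Q" and w: "w \<in> fst (W1c k)"
  shows "form2_kernel Z (Omega_W1 A1 A2 L) w = {zero_vector Z w} \<longleftrightarrow>
    (\<forall>u. (\<forall>v. W1_form k (snd (W1c k) w) u v = 0) \<longrightarrow> u = 0)"
proof -
  let ?c = "\<lambda>u. coord_vector Z (W1c k) u w"
  note Zc = smooth_atlas_W1 W1_chart_in[OF k]
  have ts: "tangent_space Z w = range ?c" by (rule tangent_space_eq[OF Zc w])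
  have zv: "zero_vector Z w = ?c 0" by (rule zero_vector_eq[OF Zc w])
  have ker: "?c u \<in> form2_kernel Z (Omega_W1 A1 A2 L) w \<longleftrightarrow> (\<forall>v. W1_form k (snd (W1c k) w) u v = 0)" for u
    unfolding form2_kernel_def ts by (simp add: Omega_W1_coord_vector[OF k w])
  have sub: "form2_kernel Z (Omega_W1 A1 A2 L) w \<subseteq> range ?c" unfolding form2_kernel_def ts by blast
  have inj: "?c u = ?c 0 \<longleftrightarrow> u = 0" for u by (rule coord_vector_inj[OF Zc w])
  have 0: "?c 0 \<in> form2_kernel Z (Omega_W1 A1 A2 L) w"
  proof -
    have "snd (W1c k) w \<in> cdom k \<times> UNIV" using W1_chart_image[OF k] w by blast
    from linear_0[OF linear_fderiv[OF smooth_on_momenta[OF k] this]]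
    show ?thesis unfolding ker by (simp add: inner_prod_def)
  qed
  show ?thesis
  proof
    assume K: "form2_kernel Z (Omega_W1 A1 A2 L) w = {zero_vector Z w}"
    show "\<forall>u. (\<forall>v. W1_form k (snd (W1c k) w) u v = 0) \<longrightarrow> u = 0"
    proof (intro allI impI)
      fix u assume "\<forall>v. W1_form k (snd (W1c k) w) u v = 0"
      then have "?c u \<in> {?c 0}" unfolding ker[symmetric] K zv .
      then show "u = 0" using inj by simp
    qed
  next
    assume nd: "\<forall>u. (\<forall>v. W1_form k (snd (W1c k) w) u v = 0) \<longrightarrow> u = 0"
    have "V = ?c 0" if V: "V \<in> form2_kernel Z (Omega_W1 A1 A2 L) w" for V
    proof -
      obtain u where u: "V = ?c u" using V sub by blast
      have "\<forall>v. W1_form k (snd (W1c k) w) u v = 0" using V unfolding u ker .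
      then have "u = 0" using nd by blast
      then show ?thesis by (simp add: u)
    qed
    then show "form2_kernel Z (Omega_W1 A1 A2 L) w = {zero_vector Z w}"
      unfolding zv using 0 by blast
  qed
qed

section \<open>Nondegeneracy and the matrix \<open>R\<close>\<close>

lemma fderiv_momenta:
  assumes k: "k \<in> Q" and q: "q \<in> cdom k"
  shows "fderiv (momenta k) (q, v, a, p0, p) h = (fst (snd (snd (snd h))),
    (fderiv (p1a k) (q, v, a, p) (fst h, fst (snd h), fst (snd (snd h)), snd (snd (snd (snd h)))),
     snd (snd (snd (snd h)))))"
proof -
  let ?h = "\<lambda>h. (fst h, fst (snd h), fst (snd (snd h)), snd (snd (snd (snd h))))"
  have h: "(?h has_derivative ?h) (at y)" for y ::
      "('r, 's) coords \<times> ('r, 's) coords \<times> (real^'r) \<times> ('r, 's) coords \<times> (real^'s)"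
    by (intro has_derivative_Pair has_derivative_fst has_derivative_snd has_derivative_ident)
  have P: "((\<lambda>y. p1a k (?h y)) has_derivative (\<lambda>h. fderiv (p1a k) (q, v, a, p) (?h h))) (at (q, v, a, p0, p))"
    by (rule has_derivative_compose[OF h]) (use q in \<open>simp add: smooth_on_has_derivative[OF smooth_on_p1a[OF
        k]]\<close>)
  have "(momenta k has_derivative (\<lambda>h. (fst (snd (snd (snd h))), (fderiv (p1a k) (q, v, a, p) (?h h), snd (snd
      (snd (snd h))))))) (at (q, v, a, p0, p))"
    unfolding momenta_def split_beta
    by (intro P has_derivative_Pair has_derivative_fst has_derivative_snd has_derivative_ident)
  from fderiv_eqI[OF this] show ?thesis by simp
qed

text \<open>Differentiating along an acceleration leaves \<open>snd p1\<close> fixed, so only second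
  derivatives of the restricted cost and of \<open>G\<close> survive. \<open>R_matrix\<close> takes
  components of \<open>G\<close> before differentiating, which requires exchanging components with
  both derivatives.\<close>

lemma R_matrix_entry:
  assumes k: "k \<in> Q" and q: "q \<in> cdom k"
  shows "R_matrix A1 A2 L C k (q, v, p0, p1, a) $ i $ j =
    fderiv (p1a k) (q, v, a, snd p1) (0, 0, axis i 1, 0) $ j"
proof -
  let ?x = "(q, v, a)" and ?e = "\<lambda>i. (0 :: ('r, 's) coords, 0 :: ('r, 's) coords, axis i 1 :: real^'r)"
  let ?S = "cdom k \<times> (UNIV :: ('r, 's) coords set) \<times> (UNIV :: (real^'r) set)"
  note op = open_coords[OF k]
  have x: "?x \<in> ?S" using q by simp
  note G = smooth_on_G[OF k] and LM = smooth_on_LM[OF k]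
  have vec_nth: "fderiv (\<lambda>z. f z $ \<alpha>) y = (\<lambda>h. fderiv f y h $ \<alpha>)" if "smooth_on f ?S" "y \<in> ?S"
    for f :: "('r, 's) coords \<times> ('r, 's) coords \<times> (real^'r) \<Rightarrow> real^'s" and y \<alpha>
    by (intro fderiv_eqI bounded_linear.has_derivative[OF bounded_linear_vec_nth] smooth_on_has_derivative[OF
        that])
  have G2: "second_partial (\<lambda>z. G k z $ \<alpha>) (?e i) (?e j) ?x
      = fderiv (\<lambda>z. fderiv (G k) z (?e j)) ?x (?e i) $ \<alpha>" for \<alpha>
  proof -
    have "fderiv (\<lambda>y. fderiv (G k) y (?e j) $ \<alpha>) ?x = fderiv (\<lambda>y. fderiv (\<lambda>z. G k z $ \<alpha>) y (?e j)) ?x"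
      by (rule fderiv_cong[OF op x smooth_on_vec_nth[OF op smooth_on_fderiv[OF G]]]) (simp only: vec_nth[OF G])
    then show ?thesis
      unfolding second_partial_def using vec_nth[OF smooth_on_fderiv[OF G] x] by metis
  qed
  let ?h = "\<lambda>h. (fst h, fst (snd h), fst (snd (snd h)))" and ?p = "snd p1"
  have h: "(?h has_derivative ?h) (at y)" for y :: "('r, 's) coords \<times> ('r, 's) coords \<times> (real^'r) \<times> (real^'s)"
    by (intro has_derivative_Pair has_derivative_fst has_derivative_snd has_derivative_ident)
  have DG: "((\<lambda>y. fderiv (G k) (?h y) (?e j)) has_derivative (\<lambda>h. fderiv (\<lambda>z. fderiv (G k) z (?e j)) ?x (?h
      h))) (at (q, v, a, ?p))"
    using x by (intro has_derivative_compose[OF h]) (simp add: smooth_on_has_derivative[OF smooth_on_fderiv[OF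
        G]])
  have DLM: "((\<lambda>y. fderiv (LM k) (?h y) (?e j)) has_derivative (\<lambda>h. fderiv (\<lambda>z. fderiv (LM k) z (?e j)) ?x (?h
      h))) (at (q, v, a, ?p))"
    using x by (intro has_derivative_compose[OF h]) (simp add: smooth_on_has_derivative[OF smooth_on_fderiv[OF
        LM]])
  have "((\<lambda>y. fderiv (LM k) (?h y) (?e j) - snd (snd (snd y)) \<bullet> fderiv (G k) (?h y) (?e j)) has_derivative
      (\<lambda>h. fderiv (\<lambda>z. fderiv (LM k) z (?e j)) ?x (?h h) -
        (snd (snd (snd (q, v, a, ?p))) \<bullet> fderiv (\<lambda>z. fderiv (G k) z (?e j)) ?x (?h h)
          + snd (snd (snd h)) \<bullet> fderiv (G k) (?h (q, v, a, ?p)) (?e j)))) (at (q, v, a, ?p))"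
    by (intro has_derivative_diff DLM has_derivative_inner DG has_derivative_snd has_derivative_ident)
  then have "((\<lambda>y. p1a k y $ j) has_derivative
      (\<lambda>h. fderiv (\<lambda>z. fderiv (LM k) z (?e j)) ?x (?h h) -
        (snd (snd (snd (q, v, a, ?p))) \<bullet> fderiv (\<lambda>z. fderiv (G k) z (?e j)) ?x (?h h)
          + snd (snd (snd h)) \<bullet> fderiv (G k) (?h (q, v, a, ?p)) (?e j)))) (at (q, v, a, ?p))"
  proof (rule has_derivative_transform_within_open[OF _ open_p1a_domain[OF k]])
    show "(q, v, a, ?p) \<in> cdom k \<times> UNIV" using q by simp
    fix y :: "('r, 's) coords \<times> ('r, 's) coords \<times> (real^'r) \<times> (real^'s)" assume "y \<in> cdom k \<times> UNIV"
    then obtain q v a p where y: "y = (q, v, a, p)" "q \<in> cdom k" by (metis mem_Sigma_iff prod_cases4)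
    show "fderiv (LM k) (?h y) (?e j) - snd (snd (snd y)) \<bullet> fderiv (G k) (?h y) (?e j) = p1a k y $ j"
      using p1a_inner[OF k y(2), of v a p "axis j 1"] by (simp add: y(1) inner_axis)
  qed
  from fderiv_eqI[OF this]
  have 1: "fderiv (\<lambda>y. p1a k y $ j) (q, v, a, ?p) (0, 0, axis i 1, 0) =
      fderiv (\<lambda>z. fderiv (LM k) z (?e j)) ?x (?e i) - ?p \<bullet> fderiv (\<lambda>z. fderiv (G k) z (?e j)) ?x (?e i)" by simp
  have "fderiv (\<lambda>y. p1a k y $ j) (q, v, a, ?p) = (\<lambda>h. fderiv (p1a k) (q, v, a, ?p) h $ j)"
    using q by (intro fderiv_eqI bounded_linear.has_derivative[OF bounded_linear_vec_nth]
        smooth_on_has_derivative[OF smooth_on_p1a[OF k]]) simp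
  then have "fderiv (p1a k) (q, v, a, ?p) (0, 0, axis i 1, 0) $ j =
      fderiv (\<lambda>z. fderiv (LM k) z (?e j)) ?x (?e i) - ?p \<bullet> fderiv (\<lambda>z. fderiv (G k) z (?e j)) ?x (?e i)"
    using 1 by metis
  then show ?thesis
    by (simp add: R_matrix_def G2 inner_vec_def) (simp add: second_partial_def)
qed

text \<open>The Jacobian of \<open>p1a\<close> has the differentiation index as column, whereas
  \<open>R_matrix\<close> has it as row; hence the transpose.\<close>

lemma fderiv_p1a_eq_R_matrix:
  assumes k: "k \<in> Q" and q: "q \<in> cdom k"
  shows "fderiv (p1a k) (q, v, a, snd p1) (0, 0, h, 0)
      = transpose (R_matrix A1 A2 L C k (q, v, p0, p1, a)) *v h"
proof -
  let ?D = "fderiv (p1a k) (q, v, a, snd p1)"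
  have lin: "linear ?D" using q by (intro linear_fderiv[OF smooth_on_p1a[OF k]]) simp
  have h: "(0, 0, h, 0) = (\<Sum>i\<in>UNIV. (h $ i) *\<^sub>R ((0, 0, axis i 1, 0) ::
      ('r, 's) coords \<times> ('r, 's) coords \<times> (real^'r) \<times> (real^'s)))"
    by (simp add: prod_eq_iff fst_sum snd_sum vec_eq_iff axis_def if_distrib cong: if_cong)
  have "?D (0, 0, h, 0) $ j = (\<Sum>i\<in>UNIV. h $ i * ?D (0, 0, axis i 1, 0) $ j)" for j
    by (simp only: h linear_sum[OF lin] linear_scale[OF lin] sum_component vector_scaleR_component
        real_scaleR_def)
  then show ?thesis
    by (simp add: vec_eq_iff matrix_vector_mult_def transpose_def R_matrix_entry[OF k q] mult.commute del:
        transpose_matrix_vector)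
qed

text \<open>Apart from \<open>p1a\<close> the pairings are canonical. The matrix acts as
  \<open>R\<close> on the first part of \<open>uv\<close> and as its transpose on \<open>ua\<close>,
  and the determinant makes both injective.\<close>

lemma nondegenerate_iff_det:
  assumes k: "k \<in> Q" and q: "q \<in> cdom k"
  shows "(\<forall>u. (\<forall>u'. W1_form k (q, v, a, p0, snd p1) u u' = 0) \<longrightarrow> u = 0) \<longleftrightarrow>
    det (R_matrix A1 A2 L C k (q, v, p0, p1, a)) \<noteq> 0"
proof -
  let ?y = "(q, v, a, p0, snd p1)" and ?D = "fderiv (p1a k) (q, v, a, snd p1)"
  define R where "R = R_matrix A1 A2 L C k (q, v, p0, p1, a)"
  have D: "?D (0, 0, h, 0) = transpose R *v h" for h
    unfolding R_def by (rule fderiv_p1a_eq_R_matrix[OF k q])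
  have D0: "?D (0, 0, 0, 0) = 0" using D[of 0] by simp
  have inj: "(\<forall>x. A *v x = 0 \<longrightarrow> x = 0) \<longleftrightarrow> det A \<noteq> 0" for A :: "real^'r^'r"
    by (metis invertible_det_nz invertible_left_inverse matrix_left_invertible_ker)
  have form: "W1_form k ?y (uq, uv, ua, up, us) (q', v', a', p', s') =
      uq \<bullet> p' + fst uv \<bullet> ?D (q', v', a', s') + snd uv \<bullet> s' - (q' \<bullet> up + fst v' \<bullet> ?D (uq, uv, ua, us) + snd v'
          \<bullet> us)"
    for uq uv ua up us q' v' a' p' s'
    by (simp add: fderiv_momenta[OF k q] inner_prod_def)
  show ?thesis
    unfolding R_def[symmetric]
  proof
    assume nd: "\<forall>u. (\<forall>u'. W1_form k ?y u u' = 0) \<longrightarrow> u = 0"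
    have "h = 0" if h: "transpose R *v h = 0" for h
    proof -
      have "W1_form k ?y (0, 0, h, 0, 0) (q', v', a', p', s') = 0" for q' v' a' p' s'
        unfolding form D h by simp
      then have "(0, 0, h, 0, 0) = (0 :: ('r, 's) coords \<times> ('r, 's) coords \<times> (real^'r) \<times> ('r, 's) coords \<times>
          (real^'s))"
        using nd by (metis prod_cases5)
      then show ?thesis by (simp add: zero_prod_def)
    qed
    then have "det (transpose R) \<noteq> 0" using inj by blast
    then show "det R \<noteq> 0" by simp
  next
    assume "det R \<noteq> 0"
    then have R: "R *v x = 0 \<Longrightarrow> x = 0" and RT: "transpose R *v x = 0 \<Longrightarrow> x = 0" for x
      using inj[of R] inj[of "transpose R"] unfolding det_transpose by blast+
    show "\<forall>u. (\<forall>u'. W1_form k ?y u u' = 0) \<longrightarrow> u = 0"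
    proof (intro allI impI)
      fix u assume "\<forall>u'. W1_form k ?y u u' = 0"
      moreover obtain uq uv ua up us where u: "u = (uq, uv, ua, up, us)" by (metis prod_cases5)
      ultimately have 0: "uq \<bullet> p' + fst uv \<bullet> ?D (q', v', a', s') + snd uv \<bullet> s'
          - (q' \<bullet> up + fst v' \<bullet> ?D (uq, uv, ua, us) + snd v' \<bullet> us) = 0" for q' v' a' p' s'
        unfolding form[symmetric] u by blast
      \<comment> \<open>Each test vector below has a single nonzero entry; apart from the one with
        the arbitrary acceleration \<open>h\<close>, it turns one summand of the form into a squared
        norm.\<close>
      have uq: "uq = 0" using 0[where p'=uq and q'=0 and v'=0 and a'=0 and s'=0] D0 by simp
      have "fst uv \<bullet> (transpose R *v h) = 0" for h
        using 0[where p'=0 and q'=0 and v'=0 and a'=h and s'=0] unfolding D by simp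
      then have "(R *v fst uv) \<bullet> h = 0" for h
        by (metis dot_lmul_matrix inner_commute transpose_matrix_vector)
      then have uv1: "fst uv = 0" using R by (metis inner_eq_zero_iff)
      \<comment> \<open>The entry \<open>s'\<close> also enters through \<open>?D\<close>; that
        contribution is gone because \<open>fst uv\<close> already vanishes.\<close>
      have uv2: "snd uv = 0"
        using 0[where p'=0 and q'=0 and v'=0 and a'=0 and s'="snd uv"] uv1 by simp
      have uv: "uv = 0" using uv1 uv2 by (simp add: prod_eq_iff)
      have up: "up = 0" using 0[where p'=0 and q'=up and v'=0 and a'=0 and s'=0] uq uv by simp
      have us: "us = 0" using 0[where p'=0 and q'=0 and v'="(0, us)" and a'=0 and s'=0] uq uv by simp
      have "?D (uq, uv, ua, us) = 0"
        using 0[where p'=0 and q'=0 and v'="(?D (uq, uv, ua, us), 0)" and a'=0 and s'=0] uq uv by simp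
      then have "transpose R *v ua = 0" unfolding uq uv us D .
      then have "ua = 0" by (rule RT)
      then show "u = 0" by (simp add: u uq uv up us zero_prod_def)
    qed
  qed
qed

text \<open>The form is always a closed 2-form, so only the kernel condition is at stake. It
  mentions no chart, and at each point it is equivalent to the determinant condition in every
  product chart around that point, so all charts are treated at once.\<close>

theorem symplectic_W1_iff:
  "symplectic Z (Omega_W1 A1 A2 L) \<longleftrightarrow>
    (\<forall>k\<in>Q. \<forall>w\<in>W1_points A1 A2 L C \<inter> fst (Wc k). det (R_matrix A1 A2 L C k (snd (Wc k) w)) \<noteq> 0)"
proof -
  have pt: "form2_kernel Z (Omega_W1 A1 A2 L) w = {zero_vector Z w}
      \<longleftrightarrow> det (R_matrix A1 A2 L C k (snd (Wc k) w)) \<noteq> 0"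
    if k: "k \<in> Q" and w: "w \<in> fst (W1c k)" for k w
  proof -
    obtain q v p0 p1 a where c: "snd (Wc k) w = (q, v, p0, p1, a)" by (metis prod_cases5)
    have "snd (W1c k) w \<in> cdom k \<times> UNIV" using W1_chart_image[OF k] w by blast
    moreover have c1: "snd (W1c k) w = (q, v, a, p0, snd p1)" by (simp add: snd_W1_chart c W1_proj_def)
    ultimately have "q \<in> cdom k" by simp
    then show ?thesis
      unfolding kernel_Omega_W1_trivial_iff[OF k w] c c1 by (rule nondegenerate_iff_det[OF k])
  qed
  have "symplectic Z (Omega_W1 A1 A2 L) \<longleftrightarrow> (\<forall>w\<in>points Z. form2_kernel Z (Omega_W1 A1 A2 L) w
      = {zero_vector Z w})"
    by (simp add: symplectic_def is_form2_Omega_W1 closed_form2_Omega_W1)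
  also have "\<dots> \<longleftrightarrow> (\<forall>k\<in>Q. \<forall>w\<in>fst (W1c k). form2_kernel Z (Omega_W1 A1 A2 L) w = {zero_vector Z w})"
    by (auto simp: points_def W1_def)
  also have "\<dots> \<longleftrightarrow> (\<forall>k\<in>Q. \<forall>w\<in>fst (W1c k). det (R_matrix A1 A2 L C k (snd (Wc k) w)) \<noteq> 0)"
    by (intro ball_cong refl pt)
  also have "\<dots> \<longleftrightarrow> (\<forall>k\<in>Q. \<forall>w\<in>W1_points A1 A2 L C \<inter> fst (Wc k). det (R_matrix A1 A2 L C k (snd (Wc k) w)) \<noteq> 0)"
    by (auto simp: W1_chart_def)
  finally show ?thesis .
qed

end

theorem proposition5p1:
  fixes A1 :: "('x, real^'r::finite) atlas"
    and A2 :: "('y, real^'s::finite) atlas"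
    and L :: "('x \<times> 'y) jet \<Rightarrow> real"
    and C :: "('x, 'y) control_point \<Rightarrow> real"
  assumes "smooth_manifold A1" and "smooth_manifold A2"
    and "smooth_function (TQ A1 A2) L"
    and "regular_lagrangian A1 A2 L"
    and "smooth_function (control_atlas A1 A2) C"
  shows "symplectic (W1 A1 A2 L C) (Omega_W1 A1 A2 L) \<longleftrightarrow>
         (\<forall>\<kappa>\<in>prod_atlas A1 A2. \<forall>w\<in>W1_points A1 A2 L C \<inter> fst (W0_chart A1 A2 L \<kappa>).
            det (R_matrix A1 A2 L C \<kappa> (snd (W0_chart A1 A2 L \<kappa>) w)) \<noteq> 0)"
proof -
  interpret control_system A1 A2 L C
    using assms by unfold_locales (auto simp: smooth_manifold_def)
  show ?thesis by (rule symplectic_W1_iff)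
qed

end
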